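(* There exists an algorithm for the clustering problem with the faulty oracle of error probability $\frac12-\lambda$ ($0<\lambda<\frac12$) and no side information whose round complexity is within an $\tilde O(\sqrt{\log n})$ factor of the optimum and which recovers $\hat G$, the maximum likelihood estimate of the clustering based on all $\binom n2$ queries, with high probability.
   Context: Clustering problem: the vertex set is $V=[n]$, partitioned into $k$ unknown nonempty clusters. Faulty oracle with error probability $p=\frac12-\lambda$ (known): a query is a pair $\{u,v\}$; the answer is the correct value ($+1$ if same cluster, $-1$ otherwise) with probability $1-p$ and the opposite value with probability $p$, independently; each pair may be queried at most once. Rounds: in each round the algorithm may submit up to $\Theta(n\log n)$ queries simultaneously, chosen based only on answers from earlier rounds; the round complexity is the number of rounds, and the optimum is the smallest round complexity achievable by any algorithm for the problem. $\tilde O(\cdot)$ hides polylogarithmic factors in $n$. Maximum likelihood estimate: with $\omega_{u,v}\in\{\pm1\}$ the oracle's answer for $\{u,v\}$ (considering all $\binom n2$ pairs), $\hat G$ is a partition $V=\bigsqcup_\ell S_\ell$ maximizing $\sum_\ell\sum_{i,j\in S_\ell,\,i<j}\omega_{i,j}$. *)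

theory Defs
  imports "HOL-Probability.Probability" "HOL-Library.Landau_Symbols" "HOL-Library.Disjoint_Sets"
begin

text \<open>The vertex set is \<open>{1..n}\<close>; a clustering is a set \<open>G\<close> of blocks with
  \<open>partition_on {1..n} G\<close>; an unordered pair is a two-element set of vertices.\<close>

definition all_pairs :: "nat \<Rightarrow> nat set set" where
  "all_pairs n = {e. e \<subseteq> {1..n} \<and> card e = 2}"

definition correct_answer :: "nat set set \<Rightarrow> nat set \<Rightarrow> int" where
  "correct_answer G e = (if \<exists>S\<in>G. e \<subseteq> S then 1 else -1)"

definition noisy_answer :: "real \<Rightarrow> nat set set \<Rightarrow> nat set \<Rightarrow> int pmf" where
  "noisy_answer p G e =
     map_pmf (\<lambda>err. if err then - correct_answer G e else correct_answer G e) (bernoulli_pmf p)"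

text \<open>Answers to all pairs are drawn up front, independently. As no pair is queried twice,
  this is the same as drawing each answer at the time of its query, and it is needed to speak
  of the maximum likelihood estimate based on all pairs.\<close>

definition answer_table :: "nat \<Rightarrow> real \<Rightarrow> nat set set \<Rightarrow> (nat set \<Rightarrow> int) pmf" where
  "answer_table n p G = Pi_pmf (all_pairs n) 0 (noisy_answer p G)"

definition likelihood_score :: "(nat set \<Rightarrow> int) \<Rightarrow> nat set set \<Rightarrow> int" where
  "likelihood_score w P = (\<Sum>S\<in>P. \<Sum>j\<in>S. \<Sum>i\<in>{i\<in>S. i < j}. w {i, j})"

text \<open>The maximizer need not be unique; every maximizer is a maximum likelihood estimate.
  The number of blocks is not constrained.\<close>

definition max_likelihood :: "nat \<Rightarrow> (nat set \<Rightarrow> int) \<Rightarrow> nat set set \<Rightarrow> bool" where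
  "max_likelihood n w P \<longleftrightarrow> is_arg_max (likelihood_score w) (partition_on {1..n}) P"

text \<open>A deterministic strategy either stops with an output or submits one round of queries and
  continues depending on the answers. The continuation only sees the answers restricted to the
  pairs just submitted, so every choice depends on answers from earlier rounds only.\<close>

datatype strategy =
    Output "nat set set"
  | Round "nat set set" "(nat set \<Rightarrow> int) \<Rightarrow> strategy"

primrec run :: "strategy \<Rightarrow> (nat set \<Rightarrow> int) \<Rightarrow> nat set set" where
  "run (Output P) w = P"
| "run (Round E f) w = run (f (restrict w E)) w"

primrec rounds :: "strategy \<Rightarrow> (nat set \<Rightarrow> int) \<Rightarrow> nat" where
  "rounds (Output P) w = 0"
| "rounds (Round E f) w = Suc (rounds (f (restrict w E)) w)"

text \<open>At most \<open>b\<close> queries per round, and no pair outside of \<open>{1..n}\<close> or among those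
  already \<open>asked\<close>.\<close>

primrec admissible :: "nat \<Rightarrow> nat \<Rightarrow> nat set set \<Rightarrow> strategy \<Rightarrow> bool" where
  "admissible n b asked (Output P) \<longleftrightarrow> True"
| "admissible n b asked (Round E f) \<longleftrightarrow>
     E \<subseteq> all_pairs n \<and> E \<inter> asked = {} \<and> card E \<le> b \<and>
     (\<forall>ans \<in> E \<rightarrow>\<^sub>E {-1, 1}. admissible n b (asked \<union> E) (f ans))"

text \<open>A (randomized) algorithm is a distribution over strategies, drawn independently of the
  answers. It is not given the number of clusters: one and the same algorithm has to succeed,
  up to failure probability \<open>d\<close>, on every clustering of \<open>{1..n}\<close>.\<close>

definition outcome :: "nat \<Rightarrow> real \<Rightarrow> nat set set \<Rightarrow> strategy pmf \<Rightarrow>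
    (strategy \<times> (nat set \<Rightarrow> int)) pmf" where
  "outcome n p G A = pair_pmf A (answer_table n p G)"

definition recovers_estimate :: "nat \<Rightarrow> nat \<Rightarrow> real \<Rightarrow> real \<Rightarrow> strategy pmf \<Rightarrow> bool" where
  "recovers_estimate n b p d A \<longleftrightarrow>
     (\<forall>s \<in> set_pmf A. admissible n b {} s) \<and>
     (\<forall>G. partition_on {1..n} G \<longrightarrow>
        measure_pmf.prob (outcome n p G A) {(s, w). max_likelihood n w (run s w)} \<ge> 1 - d)"

text \<open>Round complexity on the instances with \<open>k\<close> clusters. Every answer table has positive
  probability under every clustering, so a bound over all answer tables could not depend on
  \<open>k\<close>; the number of rounds is therefore bounded up to probability \<open>d\<close>.\<close>

definition round_complexity :: "nat \<Rightarrow> real \<Rightarrow> real \<Rightarrow> strategy pmf \<Rightarrow> nat \<Rightarrow> nat" where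
  "round_complexity n p d A k =
     (LEAST r. \<forall>G. partition_on {1..n} G \<and> card G = k \<longrightarrow>
        measure_pmf.prob (outcome n p G A) {(s, w). rounds s w \<le> r} \<ge> 1 - d)"

definition optimal_rounds :: "nat \<Rightarrow> nat \<Rightarrow> real \<Rightarrow> real \<Rightarrow> nat \<Rightarrow> nat" where
  "optimal_rounds n b p d k =
     (LEAST r. \<exists>A. recovers_estimate n b p d A \<and> round_complexity n p d A k = r)"

definition soft_O :: "(nat \<Rightarrow> real) \<Rightarrow> (nat \<Rightarrow> real) set" where
  "soft_O f = {g. \<exists>m::nat. g \<in> O(\<lambda>n. f n * ln (real n) ^ m)}"

end

theory Submission imports Defs "HOL-Real_Asymp.Real_Asymp" begin

text \<open>With high probability every cluster of at least \<open>l = C log n\<close> vertices is a block of every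
  optimal partition. If it is not, many of its vertices sit in blocks dominated by other clusters that
  are broken in the same way. What a set \<open>D\<close> of vertices of two such clusters can gain from the rest of
  the graph is a maximum of sums of few independent signs. By Maurey's property (tau) it concentrates so
  well that a union bound over all \<open>D\<close> works, and by symmetry its mean depends on the size of \<open>D\<close> only.
  Hence the vertices of the two clusters can be exchanged at almost no cost, whereas the number of pairs
  inside a block is strictly convex, so that one of the exchanges improves the partition.

  The algorithm compares one vertex with all others per round. Once about \<open>2 l\<close> vertices of a cluster
  have been treated, an optimal partition of the treated vertices reveals the cluster, and its
  remaining vertices are skipped. This takes \<open>O(k l)\<close> rounds, and the answers left out do not matter,
  as the large clusters are blocks of the maximum likelihood estimate anyway.

  An algorithm with \<open>r\<close> rounds of \<open>b\<close> queries satisfies \<open>n k \<le> 64 l^4 b r\<close>. If \<open>2 k l \<le> n\<close>, there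
  are \<open>k^(n - k l)\<close> clusterings into \<open>k\<close> clusters that each contain a prescribed core of size \<open>l\<close>, and
  they have to be distinguished, although a query ties a vertex to a cluster only with a positive
  answer, which can happen at most \<open>n\<close> times. Otherwise \<open>k - 1\<close> singletons are compared with a clustering
  that merges \<open>l\<close> of them: a query inside the merged set has to be made, but there are about \<open>(k / l)^2\<close>
  places where it might be needed.\<close>

section \<open>Weights of cuts\<close>

text \<open>A bounded-difference inequality would charge all pairs between two clusters of size
  \<open>s\<close> and the rest, about \<open>s * n\<close> of them, and is useless when
  \<open>s\<close> is of order log n. A single placement of stray vertices, however, uses at most
  about \<open>s ^ 2\<close> pairs, and for a maximum of such sums this number alone governs the
  concentration: a deviation of order \<open>s ^ 2\<close> has probability
  \<open>exp (- const * s ^ 2)\<close>, which beats the \<open>4 ^ s\<close> choices of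
  \<open>D\<close>. To keep the pairs this few, hosts must not be larger than about
  \<open>s\<close>; therefore a broken cluster of maximal size is considered. The mean of the
  maximum is never computed. Clusters below the threshold may be arranged in any way by an optimal
  partition, so only the comparison of two sets \<open>D\<close> of equal size is available. The two
  bounds on the number of rounds are \<open>3 * l * k\<close> and
  \<open>n * k / (64 * l ^ 4 * b)\<close>. With \<open>b\<close> of order n log n they differ by a
  constant times \<open>ln n ^ 6\<close>, a polylogarithmic factor, which is all that the soft O
  notation asks for.\<close>

definition cut :: "('a set \<Rightarrow> real) \<Rightarrow> 'a set \<Rightarrow> 'a set \<Rightarrow> real" where
  "cut w A B = (\<Sum>a\<in>A. \<Sum>b\<in>B. if a = b then 0 else w {a, b})"

lemma cut_empty [simp]: "cut w {} B = 0" "cut w A {} = 0"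
  by (simp_all add: cut_def)

lemma cut_commute: "cut w A B = cut w B A"
  unfolding cut_def by (subst sum.swap) (auto intro!: sum.cong simp: insert_commute)

lemma cut_Un_left:
  "finite A \<Longrightarrow> finite A' \<Longrightarrow> A \<inter> A' = {} \<Longrightarrow> cut w (A \<union> A') B = cut w A B + cut w A' B"
  unfolding cut_def by (rule sum.union_disjoint)

lemma cut_Un_right:
  "finite A \<Longrightarrow> finite A' \<Longrightarrow> A \<inter> A' = {} \<Longrightarrow> cut w B (A \<union> A') = cut w B A + cut w B A'"
  using cut_Un_left[of A A' w B] by (simp add: cut_commute)

lemma cut_split_left: "finite A \<Longrightarrow> cut w A B = cut w (A \<inter> Z) B + cut w (A - Z) B"
  by (subst cut_Un_left[symmetric]) (auto intro!: arg_cong[of _ _ "\<lambda>x. cut w x B"])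

lemma cut_split_right: "finite A \<Longrightarrow> cut w B A = cut w B (A \<inter> Z) + cut w B (A - Z)"
  using cut_split_left[of A w B Z] by (simp add: cut_commute)

lemma cut_UN_left:
  assumes "finite I" "\<And>i. i \<in> I \<Longrightarrow> finite (f i)" "disjoint_family_on f I"
  shows "cut w (\<Union>i\<in>I. f i) B = (\<Sum>i\<in>I. cut w (f i) B)"
  unfolding cut_def using assms
  by (subst sum.UNION_disjoint) (auto simp: disjoint_family_on_def)

lemma cut_Un_self:
  assumes "finite A" "finite A'" "A \<inter> A' = {}"
  shows "cut w (A \<union> A') (A \<union> A') = cut w A A + 2 * cut w A A' + cut w A' A'"
  using assms by (simp add: cut_Un_left cut_Un_right cut_commute[of w A' A])

lemma cut_singleton_self [simp]: "cut w {u} {u} = 0"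
  by (simp add: cut_def)

lemma cut_abs_le:
  assumes "\<And>a b. a \<in> A \<Longrightarrow> b \<in> B \<Longrightarrow> a \<noteq> b \<Longrightarrow> \<bar>w {a, b}\<bar> \<le> 1"
  shows "\<bar>cut w A B\<bar> \<le> real (card A) * real (card B)"
proof -
  have "\<bar>cut w A B\<bar> \<le> (\<Sum>a\<in>A. \<Sum>b\<in>B. \<bar>if a = b then 0 else w {a, b}\<bar>)"
    unfolding cut_def by (rule order_trans[OF sum_abs] sum_mono sum_abs)+
  also have "\<dots> \<le> (\<Sum>a\<in>A. \<Sum>b\<in>B. 1)"
    using assms by (intro sum_mono) auto
  finally show ?thesis by simp
qed

text \<open>As \<open>cut\<close> runs over ordered pairs, every pair inside a block counts twice,
  so this is twice the likelihood score. In return \<open>cut\<close> is additive in both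
  arguments.\<close>

definition score :: "('a set \<Rightarrow> real) \<Rightarrow> 'a set set \<Rightarrow> real" where
  "score w P = (\<Sum>B\<in>P. cut w B B)"

text \<open>Rearrangements may empty some blocks, so new partitions are given as disjoint families
  with possibly empty members.\<close>

lemma partition_on_image:
  assumes "disjoint_family_on f I" "(\<Union>i\<in>I. f i) = U"
  shows "partition_on U (f ` I - {{}})"
proof (rule partition_onI)
  show "\<Union> (f ` I - {{}}) = U" using assms(2) by auto
  fix p p' assume "p \<in> f ` I - {{}}" "p' \<in> f ` I - {{}}" "p \<noteq> p'"
  then obtain i j where "i \<in> I" "j \<in> I" "p = f i" "p' = f j" "i \<noteq> j" by blast
  then show "disjnt p p'" using assms(1) by (simp add: disjoint_family_on_def disjnt_def)
qed auto

lemma sum_image_nonempty: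
  fixes h :: "'a set \<Rightarrow> real"
  assumes "finite I" "disjoint_family_on f I" "h {} = 0"
  shows "(\<Sum>B\<in>f ` I - {{}}. h B) = (\<Sum>i\<in>I. h (f i))"
proof -
  let ?J = "{i \<in> I. f i \<noteq> {}}"
  have inj: "inj_on f ?J"
  proof (rule inj_onI)
    fix i j assume ij: "i \<in> ?J" "j \<in> ?J" "f i = f j"
    show "i = j"
    proof (rule ccontr)
      assume "i \<noteq> j"
      then have "f i \<inter> f j = {}" using assms(2) ij by (auto simp: disjoint_family_on_def)
      then show False using ij by auto
    qed
  qed
  have "f ` I - {{}} = f ` ?J" by auto
  then have "(\<Sum>B\<in>f ` I - {{}}. h B) = (\<Sum>i\<in>?J. h (f i))"
    using sum.reindex[OF inj, of h] by simp
  also have "\<dots> = (\<Sum>i\<in>I. h (f i))"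
    using assms by (intro sum.mono_neutral_left) auto
  finally show ?thesis .
qed

text \<open>\<open>D\<close> stands for the vertices of two clusters outside their hearts,
  \<open>V\<close> for the vertices outside both clusters; the host \<open>{}\<close> means staying
  alone. The bound \<open>\<beta>\<close> on hosts limits the number of pairs that a placement uses
  and thereby sets the scale of concentration. The bound \<open>h\<close> on guests limits the pairs
  among guests.\<close>

definition placement :: "'a set \<Rightarrow> 'a set \<Rightarrow> real \<Rightarrow> real \<Rightarrow> 'a set set \<Rightarrow> ('a \<Rightarrow> 'a set) \<Rightarrow> bool" where
  "placement V D \<beta> h Q \<tau> \<longleftrightarrow> partition_on V Q \<and>
     (\<forall>u\<in>D. \<tau> u \<in> insert {} Q \<and> real (card (\<tau> u)) \<le> \<beta>) \<and>
     (\<forall>B\<in>Q. real (card {u \<in> D. \<tau> u = B}) \<le> h)"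

text \<open>Halving \<open>score\<close> counts every pair once. Pairs inside \<open>D\<close> are
  left out: apart from pairs inside \<open>V\<close>, the value depends only on pairs between
  \<open>D\<close> and \<open>V\<close>, whose answers are exchangeable.\<close>

definition placement_value :: "('a set \<Rightarrow> real) \<Rightarrow> 'a set \<Rightarrow> 'a set set \<Rightarrow> ('a \<Rightarrow> 'a set) \<Rightarrow> real" where
  "placement_value w D Q \<tau> = score w Q / 2 + (\<Sum>u\<in>D. cut w {u} (\<tau> u))"

lemma subfamily_sum_between:
  fixes f :: "'i \<Rightarrow> real"
  assumes "finite I" "\<And>i. i \<in> I \<Longrightarrow> f i < K" "K \<le> sum f I" "K > 0"
  shows "\<exists>J\<subseteq>I. K \<le> sum f J \<and> sum f J < 2 * K"
  using assms
proof (induction I rule: finite_induct)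
  case empty
  then show ?case by simp
next
  case (insert x I)
  show ?case
  proof (cases "K \<le> sum f I")
    case True
    with insert show ?thesis by (meson insertCI subset_insertI2)
  next
    case False
    have "sum f (insert x I) = f x + sum f I" using insert by simp
    moreover have "f x < K" using insert by simp
    ultimately have "sum f (insert x I) < 2 * K" using False by linarith
    then show ?thesis using insert.prems by blast
  qed
qed

lemma partition_on_sum_card:
  assumes "finite U" "partition_on U P" "Z \<subseteq> U"
  shows "(\<Sum>B\<in>P. card (B \<inter> Z)) = card Z"
proof -
  have "finite P" using assms finite_elements by blast
  have "Z = (\<Union>B\<in>P. B \<inter> Z)" using assms by (auto simp: partition_on_def)
  also have "card \<dots> = (\<Sum>B\<in>P. card (B \<inter> Z))"
    using assms \<open>finite P\<close> by (intro card_UN_disjoint)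
      (auto simp: partition_on_def disjoint_def intro: finite_subset[of _ U])
  finally show ?thesis by simp
qed

section \<open>Optimality under cutting out, splitting and merging blocks\<close>

locale optimal_partition =
  fixes w :: "'a set \<Rightarrow> real" and U :: "'a set" and P :: "'a set set"
  assumes finU: "finite U"
    and partP: "partition_on U P"
    and optP: "\<And>P'. partition_on U P' \<Longrightarrow> score w P' \<le> score w P"
begin

lemma finP: "finite P"
  using finite_elements[OF finU partP] .

lemma fin_sub: "A \<subseteq> U \<Longrightarrow> finite A"
  using finU finite_subset by blast

lemma block_sub: "B \<in> P \<Longrightarrow> B \<subseteq> U"
  using partP by (auto simp: partition_on_def)

lemma block_disj: "B \<in> P \<Longrightarrow> B' \<in> P \<Longrightarrow> B \<noteq> B' \<Longrightarrow> B \<inter> B' = {}"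
  using partP by (auto simp: partition_on_def disjoint_def)

lemma block_ne: "B \<in> P \<Longrightarrow> B \<noteq> {}"
  using partP by (auto simp: partition_on_def)

lemma ex_block: "u \<in> U \<Longrightarrow> \<exists>B\<in>P. u \<in> B"
  using partP by (auto simp: partition_on_def)

lemma score_family_le:
  assumes "finite I" "disjoint_family_on f I" "(\<Union>i\<in>I. f i) = U"
  shows "(\<Sum>i\<in>I. cut w (f i) (f i)) \<le> score w P"
  using optP[OF partition_on_image[OF assms(2,3)]] sum_image_nonempty[OF assms(1,2), of "\<lambda>B. cut w B B"]
  by (simp add: score_def)

text \<open>Compare with the partition in which \<open>Z\<close> is cut out of all blocks and becomes a block.
  Splitting a block and merging two blocks are special cases.\<close>

lemma extract_le:
  assumes "Z \<subseteq> U"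
  shows "cut w Z Z \<le> (\<Sum>B\<in>P. cut w (B \<inter> Z) (B \<inter> Z) + 2 * cut w (B \<inter> Z) (B - Z))"
proof -
  \<comment> \<open>\<open>None\<close> indexes the new block, \<open>Some B\<close> the possibly
    empty rest of \<open>B\<close>.\<close>
  define f where "f i = (case i of None \<Rightarrow> Z | Some B \<Rightarrow> B - Z)" for i
  let ?I = "insert None (Some ` P)"
  have "(\<Sum>i\<in>?I. cut w (f i) (f i)) \<le> score w P"
    using assms partP finP block_disj
    by (intro score_family_le) (auto simp: disjoint_family_on_def f_def partition_on_def)
  moreover have "(\<Sum>i\<in>?I. cut w (f i) (f i)) = cut w Z Z + (\<Sum>B\<in>P. cut w (B - Z) (B - Z))"
    using finP by (subst sum.insert) (auto simp: f_def sum.reindex)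
  moreover have "score w P = (\<Sum>B\<in>P. cut w (B \<inter> Z) (B \<inter> Z) + 2 * cut w (B \<inter> Z) (B - Z) + cut w (B - Z) (B - Z))"
    unfolding score_def
  proof (rule sum.cong)
    fix B assume "B \<in> P"
    then have "finite B" using fin_sub block_sub by auto
    then have "cut w (B \<inter> Z \<union> (B - Z)) (B \<inter> Z \<union> (B - Z)) =
        cut w (B \<inter> Z) (B \<inter> Z) + 2 * cut w (B \<inter> Z) (B - Z) + cut w (B - Z) (B - Z)"
      by (intro cut_Un_self) auto
    moreover have "B \<inter> Z \<union> (B - Z) = B" by auto
    ultimately show "cut w B B = cut w (B \<inter> Z) (B \<inter> Z) + 2 * cut w (B \<inter> Z) (B - Z) + cut w (B - Z) (B - Z)"
      by metis
  qed simp
  ultimately show ?thesis by (simp add: sum.distrib)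
qed

lemma split_nonneg:
  assumes "B \<in> P" "X \<subseteq> B"
  shows "0 \<le> cut w X (B - X)"
proof -
  have "cut w X X \<le> (\<Sum>B'\<in>P. cut w (B' \<inter> X) (B' \<inter> X) + 2 * cut w (B' \<inter> X) (B' - X))"
    using assms block_sub by (intro extract_le) auto
  also have "\<dots> = (\<Sum>B'\<in>P. if B' = B then cut w X X + 2 * cut w X (B - X) else 0)"
  proof (intro sum.cong refl)
    fix B' assume "B' \<in> P"
    show "cut w (B' \<inter> X) (B' \<inter> X) + 2 * cut w (B' \<inter> X) (B' - X)
       = (if B' = B then cut w X X + 2 * cut w X (B - X) else 0)"
    proof (cases "B' = B")
      case True
      then show ?thesis using assms by (simp add: inf.absorb2)
    next
      case False
      then have "B' \<inter> X = {}" using block_disj[OF \<open>B' \<in> P\<close> assms(1)] assms(2) by auto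
      then show ?thesis using False by simp
    qed
  qed
  also have "\<dots> = cut w X X + 2 * cut w X (B - X)"
    using assms finP by simp
  finally show ?thesis by simp
qed

lemma merge_nonpos:
  assumes "B \<in> P" "B' \<in> P" "B \<noteq> B'"
  shows "cut w B B' \<le> 0"
proof -
  let ?Z = "B \<union> B'"
  have "cut w ?Z ?Z \<le> (\<Sum>X\<in>P. cut w (X \<inter> ?Z) (X \<inter> ?Z) + 2 * cut w (X \<inter> ?Z) (X - ?Z))"
    using assms block_sub by (intro extract_le) auto
  also have "\<dots> = (\<Sum>X\<in>P. (if X = B then cut w B B else 0) + (if X = B' then cut w B' B' else 0))"
  proof (intro sum.cong refl)
    fix X assume X: "X \<in> P"
    consider "X = B" | "X = B'" | "X \<noteq> B" "X \<noteq> B'" by auto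
    then show "cut w (X \<inter> ?Z) (X \<inter> ?Z) + 2 * cut w (X \<inter> ?Z) (X - ?Z) =
        (if X = B then cut w B B else 0) + (if X = B' then cut w B' B' else 0)"
    proof cases
      case 1
      have e: "B \<inter> ?Z = B" "B - ?Z = {}" by auto
      show ?thesis using 1 assms unfolding 1 e by simp
    next
      case 2
      have e: "B' \<inter> ?Z = B'" "B' - ?Z = {}" by auto
      show ?thesis using 2 assms unfolding 2 e by simp
    next
      case 3
      then have "X \<inter> ?Z = {}" using block_disj X assms by blast
      then show ?thesis using 3 by simp
    qed
  qed
  also have "\<dots> = cut w B B + cut w B' B'"
    using assms finP by (simp add: sum.distrib)
  finally show ?thesis
    using cut_Un_self[of B B' w] block_disj[OF assms] assms fin_sub block_sub by auto
qed

end

section \<open>Large clusters are blocks of every optimal partition\<close>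

text \<open>All randomness enters the structural argument through these properties.
  \<open>K\<close>, of order log n, is the size from which union bounds over vertex sets succeed; in
  \<open>small_cut\<close> and \<open>outside\<close> one side may be tiny because the other is
  large. The bound on \<open>\<epsilon>\<close> comes from the convexity gain of order
  \<open>\<mu> ^ 5 * s ^ 2\<close> in \<open>no_two_broken\<close>.\<close>

locale typical_weights =
  fixes w :: "'a set \<Rightarrow> real" and U :: "'a set" and Cl :: "'a set set" and \<mu> \<epsilon> K :: real
  assumes finite_U: "finite U"
    and partC: "partition_on U Cl"
    and w_bound: "\<And>a b. a \<in> U \<Longrightarrow> b \<in> U \<Longrightarrow> a \<noteq> b \<Longrightarrow> \<bar>w {a, b}\<bar> \<le> 1"
    and \<mu>: "0 < \<mu>" "\<mu> \<le> 1"
    and K: "1 \<le> K"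
    and eps: "0 < \<epsilon>" "\<epsilon> \<le> \<mu> ^ 5 / 400000"
    and cross_neg: "\<And>X Y. X \<subseteq> U \<Longrightarrow> Y \<subseteq> U \<Longrightarrow> X \<inter> Y = {} \<Longrightarrow> K \<le> card X \<Longrightarrow> K \<le> card Y \<Longrightarrow>
       (\<And>S. S \<in> Cl \<Longrightarrow> X \<inter> S = {} \<or> Y \<inter> S = {}) \<Longrightarrow> cut w X Y < 0"
    and same_pos: "\<And>S X Y. S \<in> Cl \<Longrightarrow> X \<subseteq> S \<Longrightarrow> Y \<subseteq> S \<Longrightarrow> X \<inter> Y = {} \<Longrightarrow> K \<le> card X \<Longrightarrow> K \<le> card Y \<Longrightarrow>
       \<mu> / 2 * real (card X) * real (card Y) \<le> cut w X Y"
    and inner: "\<And>S X. S \<in> Cl \<Longrightarrow> X \<subseteq> S \<Longrightarrow> K \<le> card X \<Longrightarrow>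
       \<bar>cut w X X - \<mu> * real (card X) ^ 2\<bar> \<le> \<epsilon> * real (card X) ^ 2"
    and small_cut: "\<And>S A. S \<in> Cl \<Longrightarrow> A \<subseteq> S \<Longrightarrow> K \<le> card (S - A) \<Longrightarrow>
       \<mu> / 2 * real (card A) * real (card (S - A)) \<le> cut w A (S - A)"
    and outside: "\<And>S v. S \<in> Cl \<Longrightarrow> K \<le> card S \<Longrightarrow> v \<in> U - S \<Longrightarrow> cut w {v} S \<le> - (\<mu> / 2 * real (card S))"
    and exchange: "\<And>S1 S2 s D D' Q \<tau>. S1 \<in> Cl \<Longrightarrow> S2 \<in> Cl \<Longrightarrow> S1 \<noteq> S2 \<Longrightarrow> card S1 \<le> s \<Longrightarrow> card S2 \<le> s \<Longrightarrow> K \<le> real s \<Longrightarrow> s \<le> card U \<Longrightarrow>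
       D \<subseteq> S1 \<union> S2 \<Longrightarrow> D' \<subseteq> S1 \<union> S2 \<Longrightarrow> card D = card D' \<Longrightarrow>
       placement (U - (S1 \<union> S2)) D (2 * real s) (16 * K / \<mu>) Q \<tau> \<Longrightarrow>
       \<exists>Q' \<tau>'. placement (U - (S1 \<union> S2)) D' (2 * real s) (16 * K / \<mu>) Q' \<tau>' \<and>
         placement_value w D Q \<tau> - \<epsilon> * real s ^ 2 \<le> placement_value w D' Q' \<tau>'"

locale typical_optimum = typical_weights w U Cl \<mu> \<epsilon> K + optimal_partition w U P
  for w :: "'a set \<Rightarrow> real" and U Cl \<mu> \<epsilon> K P
begin

text \<open>Since \<open>\<mu> / 2 * H = 4 * K\<close>, two parts of a cluster of this size attract
  each other strongly enough to outweigh the fewer than \<open>K\<close> foreign vertices in their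
  blocks.\<close>

definition H :: real where "H = 8 * K / \<mu>"

lemma H_ge: "8 * K \<le> H"
  unfolding H_def using K \<mu> by (simp add: field_simps)

section \<open>How blocks of an optimal partition meet clusters\<close>

lemma cluster_sub: "S \<in> Cl \<Longrightarrow> S \<subseteq> U"
  using partC by (auto simp: partition_on_def)

lemma cluster_disj: "S \<in> Cl \<Longrightarrow> S' \<in> Cl \<Longrightarrow> S \<noteq> S' \<Longrightarrow> S \<inter> S' = {}"
  using partC by (auto simp: partition_on_def disjoint_def)

lemma finC: "finite Cl"
  using finite_elements[OF finU partC] .

lemma cut_le_cards: "A \<subseteq> U \<Longrightarrow> B \<subseteq> U \<Longrightarrow> \<bar>cut w A B\<bar> \<le> real (card A) * real (card B)"
  using w_bound by (intro cut_abs_le) auto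

lemma card_split: "A \<subseteq> U \<Longrightarrow> real (card A) = real (card (A \<inter> Z)) + real (card (A - Z))"
  using card_Un_disjoint[of "A \<inter> Z" "A - Z"] fin_sub[of A]
  by (metis Diff_disjoint Int_Diff_Un Int_Diff_disjoint finite_Diff finite_Int of_nat_add)

text \<open>A cut that separates no cluster has negative weight if both sides have \<open>K\<close>
  vertices, so splitting \<open>B\<close> along \<open>S\<close> would be an improvement.\<close>

lemma remainder_small:
  assumes "B \<in> P" "S \<in> Cl" "K \<le> card (B \<inter> S)"
  shows "real (card (B - S)) < K"
proof (rule ccontr)
  assume "\<not> ?thesis"
  then have c: "K \<le> real (card (B - S))" by simp
  have "cut w (B \<inter> S) (B - S) < 0"
  proof (rule cross_neg)
    fix S' assume "S' \<in> Cl"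
    then show "B \<inter> S \<inter> S' = {} \<or> (B - S) \<inter> S' = {}" using cluster_disj[OF assms(2)] by (cases "S' = S") auto
  qed (use assms c block_sub in auto)
  moreover have "0 \<le> cut w (B \<inter> S) (B - B \<inter> S)"
    by (rule split_nonneg[OF assms(1)]) auto
  moreover have "B - B \<inter> S = B - S" by auto
  ultimately show False by simp
qed

text \<open>Merging the two blocks would gain \<open>\<mu> / 2\<close> per pair of their parts in
  \<open>S\<close>. The three other kinds of pairs have a side of fewer than \<open>K\<close>
  foreign vertices and cost at most a quarter of this gain each.\<close>

lemma unique_heavy:
  assumes "B \<in> P" "B' \<in> P" "S \<in> Cl" "H \<le> card (B \<inter> S)" "H \<le> card (B' \<inter> S)"
  shows "B = B'"
proof (rule ccontr)
  assume ne: "B \<noteq> B'"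
  let ?a = "real (card (B \<inter> S))" and ?b = "real (card (B' \<inter> S))"
  let ?t = "real (card (B - S))" and ?u = "real (card (B' - S))"
  have sub: "B \<subseteq> U" "B' \<subseteq> U" using assms block_sub by auto
  have K': "K \<le> ?a" "K \<le> ?b" using assms H_ge K by linarith+
  have t: "?t < K" "?u < K"
    using remainder_small assms K' by blast+
  have fin: "finite B" "finite B'" using sub fin_sub by auto
  have e: "cut w B B' = cut w (B \<inter> S) (B' \<inter> S) + cut w (B \<inter> S) (B' - S) + cut w (B - S) (B' \<inter> S) + cut w (B - S) (B' - S)"
    using cut_split_left[of B w B' S] cut_split_right[of B' w "B \<inter> S" S] cut_split_right[of B' w "B - S" S] fin by simp
  have 1: "\<mu> / 2 * ?a * ?b \<le> cut w (B \<inter> S) (B' \<inter> S)"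
    using assms K' block_disj[OF assms(1,2) ne] by (intro same_pos) auto
  have 2: "\<bar>cut w (B \<inter> S) (B' - S)\<bar> \<le> ?a * ?u" "\<bar>cut w (B - S) (B' \<inter> S)\<bar> \<le> ?t * ?b"
    "\<bar>cut w (B - S) (B' - S)\<bar> \<le> ?t * ?u"
    using sub by (intro cut_le_cards; auto)+
  have 3: "?a * ?u \<le> ?a * K" "?t * ?b \<le> K * ?b" "?t * ?u \<le> K * ?b"
    using t K' by (intro mult_mono; simp)+
  have "?a * (8 * K) \<le> ?a * (\<mu> * ?b)" "(8 * K) * ?b \<le> (\<mu> * ?a) * ?b"
    using assms \<mu> unfolding H_def by (intro mult_left_mono mult_right_mono; simp add: field_simps)+
  then have 4: "4 * (?a * K) \<le> \<mu> / 2 * ?a * ?b" "4 * (K * ?b) \<le> \<mu> / 2 * ?a * ?b"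
    by (simp_all add: algebra_simps)
  have "0 < ?a * K" "0 < K * ?b" using K K' by auto
  then have "0 < cut w B B'" using e 1 2 3 4 by linarith
  then show False using merge_nonpos[OF assms(1,2) ne] by simp
qed

text \<open>If every cluster met \<open>B\<close> in fewer than \<open>K\<close> vertices, some of
  them together would contribute between \<open>K\<close> and \<open>2 * K\<close>. Cutting these
  off separates no cluster and leaves at least \<open>K\<close> vertices, so it would be an
  improvement. Once one cluster has \<open>K\<close> vertices in \<open>B\<close>, it has all but
  fewer than \<open>K\<close> of them.\<close>

lemma big_block_heavy:
  assumes "B \<in> P" "H + K \<le> card B"
  shows "\<exists>S\<in>Cl. H \<le> card (B \<inter> S)"
proof -
  have BU: "B \<subseteq> U" using assms block_sub by auto
  have sum: "(\<Sum>S\<in>Cl. real (card (B \<inter> S))) = real (card B)"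
    using partition_on_sum_card[OF finU partC BU] by (simp flip: of_nat_sum add: Int_commute)
  have "\<exists>S\<in>Cl. K \<le> card (B \<inter> S)"
  proof (rule ccontr)
    assume "\<not> ?thesis"
    then have small: "\<And>S. S \<in> Cl \<Longrightarrow> real (card (B \<inter> S)) < K" by force
    obtain J where J: "J \<subseteq> Cl" "K \<le> (\<Sum>S\<in>J. real (card (B \<inter> S)))" "(\<Sum>S\<in>J. real (card (B \<inter> S))) < 2 * K"
      using subfamily_sum_between[OF finC, of "\<lambda>S. real (card (B \<inter> S))" K] small sum assms H_ge K by auto
    have fJ: "finite J" using J finC finite_subset by blast
    let ?X = "\<Union>S\<in>J. B \<inter> S"
    have "card ?X = (\<Sum>S\<in>J. card (B \<inter> S))"
    proof (intro card_UN_disjoint ballI impI)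
      fix S S' assume "S \<in> J" "S' \<in> J" "S \<noteq> S'"
      then show "B \<inter> S \<inter> (B \<inter> S') = {}" using J(1) cluster_disj[of S S'] by auto
    qed (use fJ fin_sub[OF BU] in auto)
    then have cX: "real (card ?X) = (\<Sum>S\<in>J. real (card (B \<inter> S)))" by simp
    have "B \<inter> ?X = ?X" by auto
    then have cY: "real (card (B - ?X)) = real (card B) - real (card ?X)"
      using card_split[OF BU, of ?X] by simp
    have "cut w ?X (B - ?X) < 0"
    proof (rule cross_neg)
      fix S assume S: "S \<in> Cl"
      show "?X \<inter> S = {} \<or> (B - ?X) \<inter> S = {}"
      proof (cases "S \<in> J")
        case False
        then show ?thesis using cluster_disj[OF S] J(1) by blast
      qed auto
    qed (use BU J cX cY assms H_ge K in auto)
    moreover have "0 \<le> cut w ?X (B - ?X)" using assms by (intro split_nonneg) auto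
    ultimately show False by simp
  qed
  then obtain S where S: "S \<in> Cl" "K \<le> card (B \<inter> S)" by blast
  then have "real (card (B - S)) < K" using remainder_small assms by blast
  then show ?thesis using S card_split[OF BU, of S] assms by (intro bexI[of _ S]) auto
qed

text \<open>The set \<open>B \<inter> S\<close> is the heart of \<open>S\<close>. The proportion
  \<open>\<mu> / 2\<close> is the rate at which \<open>S\<close> repels a foreign vertex according
  to \<open>outside\<close>: with fewer vertices missing, \<open>B\<close> cannot afford any foreign
  vertex.\<close>

definition broken :: "'a set \<Rightarrow> 'a set \<Rightarrow> bool" where
  "broken S B \<longleftrightarrow> S \<in> Cl \<and> B \<in> P \<and> H \<le> card (B \<inter> S) \<and> \<mu> / 2 * real (card S) \<le> card (S - B)"

text \<open>Each foreign vertex of \<open>B\<close> loses at least \<open>\<mu> / 2 * card S\<close>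
  against the whole of \<open>S\<close>, and the vertices of \<open>S\<close> missing from
  \<open>B\<close> are too few to account for this loss. So splitting the foreign vertices off would
  be an improvement.\<close>

lemma not_broken_subset:
  assumes "S \<in> Cl" "B \<in> P" "H \<le> card (B \<inter> S)" "\<not> broken S B"
  shows "B \<subseteq> S"
proof (rule ccontr)
  assume "\<not> B \<subseteq> S"
  then have T: "B - S \<noteq> {}" by auto
  have sub: "B \<subseteq> U" "S \<subseteq> U" using assms block_sub cluster_sub by auto
  have fin: "finite S" "finite B" using sub fin_sub by auto
  have cS: "K \<le> card S"
    using assms(3) H_ge K card_mono[of S "B \<inter> S"] fin by simp
  have d: "real (card (S - B)) < \<mu> / 2 * real (card S)"
    using assms by (auto simp: broken_def)
  have "cut w (B - S) S = (\<Sum>v\<in>B - S. cut w {v} S)"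
    by (simp add: cut_def)
  also have "\<dots> \<le> (\<Sum>v\<in>B - S. - (\<mu> / 2 * real (card S)))"
    using sub by (intro sum_mono outside[OF assms(1) cS]) auto
  finally have 1: "cut w (B - S) S \<le> - (real (card (B - S)) * (\<mu> / 2 * real (card S)))" by simp
  have 2: "\<bar>cut w (B - S) (S - B)\<bar> \<le> real (card (B - S)) * real (card (S - B))"
    using sub by (intro cut_le_cards) auto
  have "0 < card (B - S)" using T fin by (simp add: card_gt_0_iff)
  then have "real (card (B - S)) * real (card (S - B)) < real (card (B - S)) * (\<mu> / 2 * real (card S))"
    using d by simp
  then have "cut w (B - S) (S \<inter> B) < 0"
    using 1 2 cut_split_right[of S w "B - S" B] fin by linarith
  moreover have "0 \<le> cut w (B - S) (B - (B - S))" by (rule split_nonneg[OF assms(2)]) auto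
  moreover have "B - (B - S) = S \<inter> B" by auto
  ultimately show False by simp
qed

text \<open>If a large cluster is not a block, its stray vertices must gain by staying with the hearts of
  other broken clusters: bringing them home is not an improvement.\<close>

lemma stray_hosts:
  assumes S: "S \<in> Cl" "S \<notin> P" and big: "64 * (2 * H + K) / \<mu> \<le> card S"
  defines "Hosts \<equiv> {B \<in> P. \<exists>S'. S' \<noteq> S \<and> broken S' B}"
  obtains D where "D \<subseteq> S" "D \<noteq> {}" "\<And>B. B \<in> P \<Longrightarrow> H \<le> card (B \<inter> S) \<Longrightarrow> D = S - B"
    "\<mu> / 16 * real (card D) * real (card S)
      \<le> (\<Sum>B\<in>Hosts. real (card (B \<inter> D)) * real (card (B \<inter> (THE S'. broken S' B))))"
    "\<And>B. B \<in> Hosts \<Longrightarrow> real (card (B \<inter> D)) < K"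
proof -
  let ?s = "real (card S)"
  have SU: "S \<subseteq> U" using S cluster_sub by auto
  have fS: "finite S" using SU fin_sub by auto
  have cS: "64 * (2 * H + K) \<le> \<mu> * ?s" using big \<mu> by (simp add: field_simps)
  have "\<mu> * ?s \<le> ?s" using \<mu> by (simp add: mult_left_le_one_le)
  from order_trans[OF cS this] have sH: "128 * H \<le> ?s" using K by simp
  \<comment> \<open>The heart block, unique by \<open>unique_heavy\<close>. Without one,
    \<open>{}\<close> is the right default: bringing the strays home then means making
    \<open>S\<close> a block of its own.\<close>
  define B0 where "B0 = (if \<exists>B\<in>P. H \<le> card (B \<inter> S) then (SOME B. B \<in> P \<and> H \<le> card (B \<inter> S)) else {})"
  have B0: "B0 = {} \<or> (B0 \<in> P \<and> H \<le> card (B0 \<inter> S))"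
    unfolding B0_def by (auto intro: someI2)
  have B0_iff: "B0 = B" if "B \<in> P" "H \<le> card (B \<inter> S)" for B
    using that unique_heavy[OF _ that(1) S(1) _ that(2)] unfolding B0_def
    by (metis (mono_tags, lifting) someI_ex)
  have B0U: "B0 \<subseteq> U" using B0 block_sub by auto
  have fB0: "finite B0" using B0U fin_sub by auto
  define D where "D = S - B0"
  have DS: "D \<subseteq> S" and DU: "D \<subseteq> U" using SU by (auto simp: D_def)
  have fD: "finite D" using DU fin_sub by auto
  have Dne: "D \<noteq> {}"
  proof
    assume "D = {}"
    then have "S \<subseteq> B0" by (auto simp: D_def)
    then have inter: "B0 \<inter> S = S" by auto
    have "0 < ?s" using sH H_ge K by linarith
    then have "S \<noteq> {}" by auto
    then have "B0 \<in> P" using B0 \<open>S \<subseteq> B0\<close> by auto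
    moreover have "H \<le> card (B0 \<inter> S)" using inter sH H_ge K by simp
    moreover have "\<not> broken S B0"
    proof
      assume "broken S B0"
      moreover have "card (S - B0) = 0" using \<open>D = {}\<close> unfolding D_def by (metis card.empty)
      ultimately have "\<mu> / 2 * ?s \<le> 0" by (simp add: broken_def)
      then show False using \<mu> \<open>0 < ?s\<close> by (simp add: mult_le_0_iff)
    qed
    ultimately have "B0 \<subseteq> S" using not_broken_subset S by blast
    then have "B0 = S" using \<open>S \<subseteq> B0\<close> by auto
    then show False using \<open>B0 \<in> P\<close> S by simp
  qed
  define P' where "P' = P - {B0}"
  have finP': "finite P'" using finP by (simp add: P'_def)
  have disjP': "B \<inter> B0 = {}" if "B \<in> P'" for B
    using that B0 block_disj by (auto simp: P'_def)
  have BD: "B \<inter> D = B \<inter> S" if "B \<in> P'" for B using disjP'[OF that] by (auto simp: D_def)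
  have DUn: "D = (\<Union>B\<in>P'. B \<inter> S)"
  proof
    show "D \<subseteq> (\<Union>B\<in>P'. B \<inter> S)"
    proof
      fix u assume "u \<in> D"
      then obtain B where "B \<in> P" "u \<in> B" using ex_block DU by blast
      then show "u \<in> (\<Union>B\<in>P'. B \<inter> S)" using \<open>u \<in> D\<close> by (auto simp: D_def P'_def)
    qed
    show "(\<Union>B\<in>P'. B \<inter> S) \<subseteq> D" using disjP' by (auto simp: D_def)
  qed
  have djf: "disjoint_family_on (\<lambda>B. B \<inter> S) P'"
    using block_disj by (auto simp: disjoint_family_on_def P'_def)
  have cD: "real (card D) = (\<Sum>B\<in>P'. real (card (B \<inter> S)))"
    unfolding DUn using djf fS finP' by (subst card_UN_disjoint) (auto simp: disjoint_family_on_def)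
  have light: "real (card (B \<inter> S)) < H" if "B \<in> P'" for B
    using B0_iff[of B] that by (force simp: P'_def)
  have cutD: "cut w D Y = (\<Sum>B\<in>P'. cut w (B \<inter> S) Y)" for Y
    unfolding DUn using djf finP' fS by (intro cut_UN_left) auto
  \<comment> \<open>Foreign vertices of \<open>B0\<close> stay where they are, so only pairs that
    involve \<open>D\<close> change.\<close>
  have \<open>cut w (B0 \<union> S) (B0 \<union> S)
      \<le> (\<Sum>B\<in>P. cut w (B \<inter> (B0 \<union> S)) (B \<inter> (B0 \<union> S)) + 2 * cut w (B \<inter> (B0 \<union> S)) (B - (B0 \<union> S)))\<close>
    using B0U SU by (intro extract_le) auto
  also have "\<dots> = cut w B0 B0 + (\<Sum>B\<in>P'. cut w (B \<inter> S) (B \<inter> S) + 2 * cut w (B \<inter> S) (B - S))"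
  proof -
    let ?f = "\<lambda>B. cut w (B \<inter> (B0 \<union> S)) (B \<inter> (B0 \<union> S)) + 2 * cut w (B \<inter> (B0 \<union> S)) (B - (B0 \<union> S))"
    have e: "?f B = cut w (B \<inter> S) (B \<inter> S) + 2 * cut w (B \<inter> S) (B - S)" if "B \<in> P'" for B
    proof -
      have "B \<inter> (B0 \<union> S) = B \<inter> S" "B - (B0 \<union> S) = B - S" using disjP'[OF that] by auto
      then show ?thesis by simp
    qed
    show ?thesis
    proof (cases "B0 \<in> P")
      case True
      have "B0 \<inter> (B0 \<union> S) = B0" "B0 - (B0 \<union> S) = {}" by auto
      then have "?f B0 = cut w B0 B0" by (metis add_0_right cut_empty(2) mult_zero_right)
      moreover have "sum ?f P = ?f B0 + sum ?f P'"
        using True finP by (simp add: P'_def sum.remove)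
      moreover have "sum ?f P' = (\<Sum>B\<in>P'. cut w (B \<inter> S) (B \<inter> S) + 2 * cut w (B \<inter> S) (B - S))"
        using e by (rule sum.cong[OF refl])
      ultimately show ?thesis by linarith
    next
      case False
      then have "B0 = {}" "P' = P" using B0 by (auto simp: P'_def)
      then show ?thesis by simp
    qed
  qed
  finally have main: "cut w (B0 \<union> S) (B0 \<union> S) \<le> \<dots>" .
  have "B0 \<union> S = B0 \<union> D" by (auto simp: D_def)
  then have lhs: "cut w (B0 \<union> S) (B0 \<union> S) = cut w B0 B0 + 2 * cut w B0 D + cut w D D"
    using cut_Un_self[of B0 D w] fB0 fD by (auto simp: D_def)
  \<comment> \<open>Arranged so that the pairs inside a stray piece cancel in the
    comparison.\<close>
  have pieces: "cut w (B \<inter> S) D + cut w (B \<inter> S) (B0 \<inter> S) = cut w (B \<inter> S) (B \<inter> S) + cut w (B \<inter> S) (S - B)" if "B \<in> P'" for B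
  proof -
    have "cut w (B \<inter> S) (D \<union> (B0 \<inter> S)) = cut w (B \<inter> S) D + cut w (B \<inter> S) (B0 \<inter> S)"
      using fD fB0 by (intro cut_Un_right) (auto simp: D_def)
    moreover have "D \<union> (B0 \<inter> S) = (S \<inter> B) \<union> (S - B)" by (auto simp: D_def)
    moreover have "cut w (B \<inter> S) ((S \<inter> B) \<union> (S - B)) = cut w (B \<inter> S) (S \<inter> B) + cut w (B \<inter> S) (S - B)"
      using fS by (intro cut_Un_right) auto
    ultimately show ?thesis by (simp add: Int_commute)
  qed
  have "cut w D D + cut w D (B0 \<inter> S) = (\<Sum>B\<in>P'. cut w (B \<inter> S) (B \<inter> S) + cut w (B \<inter> S) (S - B))"
    unfolding cutD sum.distrib[symmetric] using pieces by (intro sum.cong refl) auto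
  moreover have "cut w B0 D = cut w D (B0 \<inter> S) + cut w D (B0 - S)"
    using cut_split_right[OF fB0, of w D S] by (simp add: cut_commute)
  ultimately have "(\<Sum>B\<in>P'. cut w (B \<inter> S) (S - B)) + cut w D (B0 \<inter> S) + 2 * cut w D (B0 - S)
      \<le> 2 * (\<Sum>B\<in>P'. cut w (B \<inter> S) (B - S))"
    using main lhs by (simp add: sum.distrib sum_distrib_left)
  moreover have "0 \<le> cut w D (B0 \<inter> S)"
  proof (cases "B0 = {}")
    case False
    then have "H \<le> card (B0 \<inter> S)" using B0 by auto
    moreover have "S - D = B0 \<inter> S" by (auto simp: D_def)
    ultimately have "\<mu> / 2 * real (card D) * real (card (S - D)) \<le> cut w D (S - D)"
      using S DS H_ge K by (intro small_cut) auto
    moreover have "0 \<le> \<mu> / 2 * real (card D) * real (card (S - D))" using \<mu> by auto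
    ultimately show ?thesis using \<open>S - D = B0 \<inter> S\<close> by simp
  qed auto
  moreover have "- (real (card D) * K) \<le> cut w D (B0 - S)"
  proof -
    have "real (card (B0 - S)) \<le> K"
    proof (cases "B0 = {}")
      case False
      then have "B0 \<in> P" "K \<le> card (B0 \<inter> S)" using B0 H_ge K by auto
      then show ?thesis using remainder_small[OF _ S(1)] by (simp add: less_imp_le)
    qed (use K in auto)
    then have "real (card D) * real (card (B0 - S)) \<le> real (card D) * K" by (simp add: mult_left_mono)
    moreover have "\<bar>cut w D (B0 - S)\<bar> \<le> real (card D) * real (card (B0 - S))"
      using DU B0U by (intro cut_le_cards) auto
    ultimately show ?thesis by linarith
  qed
  \<comment> \<open>A stray piece has fewer than \<open>H\<close> vertices, so more than half of
    \<open>S\<close> lies outside its block; \<open>small_cut\<close> then works however small the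
    piece is.\<close>
  moreover have "\<mu> / 4 * real (card D) * ?s \<le> (\<Sum>B\<in>P'. cut w (B \<inter> S) (S - B))"
  proof -
    have "\<mu> / 4 * real (card D) * ?s = (\<Sum>B\<in>P'. \<mu> / 4 * ?s * real (card (B \<inter> S)))"
      by (simp add: cD sum_distrib_left mult_ac)
    also have "\<dots> \<le> (\<Sum>B\<in>P'. cut w (B \<inter> S) (S - B))"
    proof (rule sum_mono)
      fix B assume B: "B \<in> P'"
      have e: "S - B \<inter> S = S - B" by auto
      have c: "?s / 2 \<le> real (card (S - B))"
        using light[OF B] card_split[OF SU, of B] sH H_ge K by (simp add: Int_commute)
      have "\<mu> / 4 * ?s * real (card (B \<inter> S)) = \<mu> / 2 * real (card (B \<inter> S)) * (?s / 2)" by simp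
      also have "\<dots> \<le> \<mu> / 2 * real (card (B \<inter> S)) * real (card (S - B))"
        using c \<mu> by (intro mult_left_mono) auto
      also have "\<dots> \<le> cut w (B \<inter> S) (S - B)"
        using small_cut[OF S(1), of "B \<inter> S"] e c sH H_ge K by simp
      finally show "\<mu> / 4 * ?s * real (card (B \<inter> S)) \<le> cut w (B \<inter> S) (S - B)" .
    qed
    finally show ?thesis .
  qed
  ultimately have gain: "\<mu> / 8 * real (card D) * ?s - real (card D) * K \<le> (\<Sum>B\<in>P'. cut w (B \<inter> S) (B - S))"
    by simp
  have HP': "B \<in> P'" if "B \<in> Hosts" for B
  proof -
    from that obtain S' where S': "B \<in> P" "S' \<noteq> S" "broken S' B" by (auto simp: Hosts_def)
    have "B \<noteq> B0"
    proof
      assume "B = B0"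
      moreover have "B \<noteq> {}" using block_ne S' by auto
      ultimately have "K \<le> card (B \<inter> S)" using B0 H_ge K by auto
      then have "real (card (B - S)) < K" using remainder_small S' S by auto
      moreover have "B \<inter> S' \<subseteq> B - S" using cluster_disj[of S' S] S' S by (auto simp: broken_def)
      then have "card (B \<inter> S') \<le> card (B - S)"
        using fin_sub[OF block_sub[OF S'(1)]] by (intro card_mono) auto
      ultimately show False using S' H_ge K by (auto simp: broken_def)
    qed
    then show ?thesis using S' by (auto simp: P'_def)
  qed
  have the: "(THE S'. broken S' B) = S'" if "broken S' B" for S' B
  proof (rule the_equality[of "\<lambda>S'. broken S' B" S', OF that])
    fix S'' assume b: "broken S'' B"
    show "S'' = S'"
    proof (rule ccontr)
      assume "S'' \<noteq> S'"
      then have "B \<inter> S'' \<subseteq> B - S'" using cluster_disj[of S'' S'] b that by (auto simp: broken_def)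
      then have "card (B \<inter> S'') \<le> card (B - S')"
        using fin_sub[OF block_sub] b by (intro card_mono) (auto simp: broken_def)
      moreover have "real (card (B - S')) < K"
        using that H_ge K by (intro remainder_small) (auto simp: broken_def)
      ultimately show False using b H_ge K by (auto simp: broken_def)
    qed
  qed
  \<comment> \<open>Blocks of fewer than \<open>H + K\<close> vertices contribute a lower-order
    term. A larger one is heavy for some \<open>S' \<noteq> S\<close>. If \<open>S'\<close> is not
    broken there, the block lies inside \<open>S'\<close> and holds no stray of \<open>S\<close>;
    otherwise it is a host, and what counts is its heart.\<close>
  have piece_bound: "cut w (B \<inter> S) (B - S) \<le> real (card (B \<inter> S)) * (H + K)
      + (if B \<in> Hosts then real (card (B \<inter> S)) * real (card (B \<inter> (THE S'. broken S' B))) else 0)"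
    if B: "B \<in> P'" for B
  proof -
    have BP: "B \<in> P" using B by (auto simp: P'_def)
    have BU: "B \<subseteq> U" using block_sub BP by auto
    have "\<bar>cut w (B \<inter> S) (B - S)\<bar> \<le> real (card (B \<inter> S)) * real (card (B - S))"
      using BU SU by (intro cut_le_cards) auto
    also have "\<dots> \<le> real (card (B \<inter> S)) * real (card B)"
      using fin_sub[OF BU] by (intro mult_left_mono) (auto intro: card_mono)
    finally have b: "cut w (B \<inter> S) (B - S) \<le> real (card (B \<inter> S)) * real (card B)" by simp
    consider "real (card B) < H + K" | "B \<inter> S = {}" | S' where "S' \<noteq> S" "broken S' B" "H + K \<le> card B"
    proof (cases "real (card B) < H + K")
      case False
      then obtain S' where S': "S' \<in> Cl" "H \<le> card (B \<inter> S')" using big_block_heavy[OF BP] by auto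
      have "S' \<noteq> S" using light[OF B] S' by auto
      show ?thesis
      proof (cases "broken S' B")
        case True then show ?thesis using that(3) \<open>S' \<noteq> S\<close> False by auto
      next
        case f: False
        then have "B \<subseteq> S'" using not_broken_subset BP S' by blast
        then have "B \<inter> S = {}" using cluster_disj[OF S'(1) S(1) \<open>S' \<noteq> S\<close>] by auto
        then show ?thesis using that(2) by auto
      qed
    qed (use that in auto)
    then show ?thesis
    proof cases
      case 1
      then have "real (card (B \<inter> S)) * real (card B) \<le> real (card (B \<inter> S)) * (H + K)"
        by (intro mult_left_mono) auto
      moreover have "0 \<le> real (card (B \<inter> S)) * real (card (B \<inter> (THE S'. broken S' B)))" by simp
      ultimately show ?thesis using b by (auto intro: order_trans)
    next
      case 2
      then show ?thesis by simp
    next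
      case 3
      then have "B \<in> Hosts" using BP by (auto simp: Hosts_def)
      have "real (card (B - S')) < K"
        using 3 BP H_ge K by (intro remainder_small) (auto simp: broken_def)
      then have "real (card B) \<le> (H + K) + real (card (B \<inter> S'))"
        using card_split[OF BU, of S'] H_ge K by linarith
      then have "real (card (B \<inter> S)) * real (card B) \<le> real (card (B \<inter> S)) * ((H + K) + real (card (B \<inter> S')))"
        by (intro mult_left_mono) auto
      then show ?thesis using b \<open>B \<in> Hosts\<close> the[OF 3(2)] by (simp add: distrib_left)
    qed
  qed
  let ?v = "\<lambda>B. real (card (B \<inter> S)) * real (card (B \<inter> (THE S'. broken S' B)))"
  have "(\<Sum>B\<in>P'. cut w (B \<inter> S) (B - S)) \<le> (\<Sum>B\<in>P'. real (card (B \<inter> S)) * (H + K) + (if B \<in> Hosts then ?v B else 0))"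
    using piece_bound by (rule sum_mono)
  also have "\<dots> = real (card D) * (H + K) + (\<Sum>B\<in>P'. if B \<in> Hosts then ?v B else 0)"
    by (simp add: sum.distrib cD sum_distrib_right)
  also have "(\<Sum>B\<in>P'. if B \<in> Hosts then ?v B else 0) = (\<Sum>B\<in>Hosts. ?v B)"
  proof -
    have "P' \<inter> {B. B \<in> Hosts} = Hosts" using HP' by auto
    then show ?thesis using finP' by (simp add: sum.If_cases)
  qed
  also have "\<dots> = (\<Sum>B\<in>Hosts. real (card (B \<inter> D)) * real (card (B \<inter> (THE S'. broken S' B))))"
    using BD HP' by (intro sum.cong) auto
  finally have "\<mu> / 8 * real (card D) * ?s - real (card D) * (H + 2 * K)
     \<le> (\<Sum>B\<in>Hosts. real (card (B \<inter> D)) * real (card (B \<inter> (THE S'. broken S' B))))"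
    using gain by (simp add: algebra_simps)
  moreover have "real (card D) * (16 * (H + 2 * K)) \<le> real (card D) * (\<mu> * ?s)"
    using cS H_ge K by (intro mult_left_mono) auto
  ultimately have res: "\<mu> / 16 * real (card D) * ?s
     \<le> (\<Sum>B\<in>Hosts. real (card (B \<inter> D)) * real (card (B \<inter> (THE S'. broken S' B))))"
    by (simp add: algebra_simps)
  have guest: "real (card (B \<inter> D)) < K" if "B \<in> Hosts" for B
  proof -
    from that obtain S' where S': "B \<in> P" "S' \<noteq> S" "broken S' B" by (auto simp: Hosts_def)
    have "real (card (B - S')) < K"
      using S' H_ge K by (intro remainder_small) (auto simp: broken_def)
    moreover have "B \<inter> D \<subseteq> B - S'" using DS cluster_disj[of S' S] S' S by (auto simp: broken_def)
    then have "card (B \<inter> D) \<le> card (B - S')"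
      using fin_sub[OF block_sub[OF S'(1)]] by (intro card_mono) auto
    ultimately show ?thesis by linarith
  qed
  show thesis
  proof (rule that[OF DS Dne _ res guest])
    fix B assume "B \<in> P" "H \<le> card (B \<inter> S)"
    then show "D = S - B" using B0_iff[of B] by (simp add: D_def)
  qed auto
qed


text \<open>A placement gives a partition of \<open>U\<close>: guests join their hosts, vertices
  placed at \<open>{}\<close> become singletons, \<open>A1\<close> and \<open>A2\<close> become
  blocks. The value ignores only pairs among guests of a common host, which cost at most
  \<open>h\<close> per guest.\<close>

lemma score_ge_placement:
  assumes pl: "placement V D \<beta> h Q \<tau>" and U: "U = V \<union> D \<union> A1 \<union> A2"
    and dj: "V \<inter> D = {}" "(V \<union> D) \<inter> (A1 \<union> A2) = {}" "A1 \<inter> A2 = {}" and ne: "A1 \<noteq> {}" "A2 \<noteq> {}" and h0: "0 \<le> h"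
  shows "cut w A1 A1 + cut w A2 A2 + 2 * placement_value w D Q \<tau> - h * real (card D) \<le> score w P"
proof -
  have Q: "partition_on V Q" and \<tau>: "\<And>u. u \<in> D \<Longrightarrow> \<tau> u \<in> insert {} Q"
    and hb: "\<And>B. B \<in> Q \<Longrightarrow> real (card {u \<in> D. \<tau> u = B}) \<le> h"
    using pl by (auto simp: placement_def)
  define N where "N i = {u \<in> D. \<tau> u = i}" for i
  define I1 where "I1 = (\<lambda>u. {u}) ` N {}"
  define I where "I = Q \<union> (I1 \<union> {A1, A2})"
  define f where "f i = i \<union> N i" for i
  have fin: "finite V" "finite D" "finite A1" "finite A2" using U finU by auto
  have finN: "finite (N i)" for i using fin by (simp add: N_def)
  have finQ: "finite Q" using finite_elements[OF fin(1) Q] .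
  have Qsub: "\<And>B. B \<in> Q \<Longrightarrow> B \<subseteq> V" and Qne: "\<And>B. B \<in> Q \<Longrightarrow> B \<noteq> {}" and QV: "\<Union> Q = V"
    and Qdj: "\<And>B B'. B \<in> Q \<Longrightarrow> B' \<in> Q \<Longrightarrow> B \<noteq> B' \<Longrightarrow> B \<inter> B' = {}"
    using Q by (auto simp: partition_on_def disjoint_def)
  have ND: "N i \<subseteq> D" for i by (auto simp: N_def)
  have notQ: "i \<notin> Q" if "i \<in> I1 \<union> {A1, A2}" for i
  proof
    assume "i \<in> Q"
    then have "i \<subseteq> V" "i \<noteq> {}" using Qsub Qne by auto
    moreover have "i \<subseteq> D \<union> (A1 \<union> A2)" using that ND[of "{}"] by (auto simp: I1_def)
    ultimately show False using dj by blast
  qed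
  have Nempty: "N i = {}" if "i \<in> I1 \<union> {A1, A2}" for i
  proof -
    have "i \<noteq> {}" using that ne by (auto simp: I1_def)
    then show ?thesis using notQ[OF that] \<tau> by (auto simp: N_def)
  qed
  have finI1: "finite I1" using finN by (simp add: I1_def)
  have finI: "finite I" using finQ finI1 by (simp add: I_def)
  have "(\<Union>i\<in>I. f i) = U"
  proof
    show "(\<Union>i\<in>I. f i) \<subseteq> U" using Qsub ND U by (fastforce simp: I_def I1_def f_def)
    show "U \<subseteq> (\<Union>i\<in>I. f i)"
    proof
      fix x assume "x \<in> U"
      then consider "x \<in> V" | "x \<in> D" "\<tau> x = {}" | "x \<in> D" "\<tau> x \<in> Q" | "x \<in> A1 \<union> A2" using U \<tau> by auto
      then show "x \<in> (\<Union>i\<in>I. f i)"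
        by cases (use QV in \<open>auto simp: I_def I1_def f_def N_def\<close>)
    qed
  qed
  moreover have "disjoint_family_on f I"
  proof -
    have "f i \<inter> f j = {}" if "i \<in> I" "j \<in> I" "i \<noteq> j" for i j
    proof -
      have NN: "N i \<inter> N j = {}" using that by (auto simp: N_def)
      have ij: "i \<inter> j = {}"
      proof (cases "i \<in> Q"; cases "j \<in> Q")
        assume "i \<notin> Q" "j \<notin> Q"
        then show ?thesis using that dj ND[of "{}"] by (auto simp: I_def I1_def)
      next
        assume a: "i \<in> Q" "j \<notin> Q"
        then have "j \<in> I1 \<union> {A1, A2}" using that by (auto simp: I_def)
        then have "j \<inter> V = {}" using dj ND[of "{}"] by (auto simp: I1_def)
        then show ?thesis using Qsub[OF a(1)] by auto
      next
        assume a: "i \<notin> Q" "j \<in> Q"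
        then have "i \<in> I1 \<union> {A1, A2}" using that by (auto simp: I_def)
        then have "i \<inter> V = {}" using dj ND[of "{}"] by (auto simp: I1_def)
        then show ?thesis using Qsub[OF a(2)] by auto
      qed (use Qdj that in auto)
      have iN: "k \<inter> N l = {}" if "k \<in> I" "l \<in> I" "k \<noteq> l" for k l
      proof (cases "l \<in> Q")
        case False
        then show ?thesis using Nempty[of l] that by (auto simp: I_def)
      next
        case l: True
        show ?thesis
        proof (cases "k \<in> I1")
          case True
          then obtain u where "k = {u}" "\<tau> u = {}" by (auto simp: I1_def N_def)
          then show ?thesis using Qne[OF l] by (auto simp: N_def)
        next
          case False
          then have "k \<subseteq> V \<union> (A1 \<union> A2)" using \<open>k \<in> I\<close> Qsub by (auto simp: I_def)
          then show ?thesis using dj ND[of l] by blast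
        qed
      qed
      show ?thesis using NN ij iN[OF that] iN[OF that(2,1)] that(3) by (auto simp: f_def)
    qed
    then show ?thesis by (auto simp: disjoint_family_on_def)
  qed
  ultimately have le: "(\<Sum>i\<in>I. cut w (f i) (f i)) \<le> score w P"
    by (intro score_family_le finI)
  have "(\<Sum>i\<in>I. cut w (f i) (f i)) = (\<Sum>i\<in>Q. cut w (f i) (f i)) + (\<Sum>i\<in>I1 \<union> {A1, A2}. cut w (f i) (f i))"
    unfolding I_def using notQ finQ finI1 by (intro sum.union_disjoint) auto
  also have "(\<Sum>i\<in>I1 \<union> {A1, A2}. cut w (f i) (f i)) = (\<Sum>i\<in>I1 \<union> {A1, A2}. cut w i i)"
    using Nempty by (intro sum.cong) (auto simp: f_def)
  also have "\<dots> = (\<Sum>i\<in>I1. cut w i i) + (\<Sum>i\<in>{A1, A2}. cut w i i)"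
    using finI1 dj ne ND[of "{}"] by (intro sum.union_disjoint) (auto simp: I1_def)
  also have "(\<Sum>i\<in>I1. cut w i i) = 0" by (auto simp: I1_def intro!: sum.neutral)
  also have "(\<Sum>i\<in>{A1, A2}. cut w i i) = cut w A1 A1 + cut w A2 A2"
    using dj ne by (subst sum.insert) auto
  also have "(\<Sum>i\<in>Q. cut w (f i) (f i)) = (\<Sum>i\<in>Q. cut w i i + 2 * cut w (N i) i + cut w (N i) (N i))"
  proof (rule sum.cong[OF refl])
    fix i assume i: "i \<in> Q"
    have "i \<inter> N i = {}" using Qsub[OF i] ND[of i] dj by auto
    moreover have "finite i" using Qsub[OF i] fin(1) finite_subset by blast
    ultimately show "cut w (f i) (f i) = cut w i i + 2 * cut w (N i) i + cut w (N i) (N i)"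
      unfolding f_def using finN[of i] cut_Un_self[of i "N i" w] cut_commute[of w i "N i"] by simp
  qed
  also have "\<dots> = score w Q + 2 * (\<Sum>i\<in>Q. cut w (N i) i) + (\<Sum>i\<in>Q. cut w (N i) (N i))"
    by (simp add: score_def sum.distrib sum_distrib_left)
  also have "(\<Sum>i\<in>Q. cut w (N i) i) = (\<Sum>u\<in>D. cut w {u} (\<tau> u))"
  proof -
    have "(\<Sum>u\<in>D. cut w {u} (\<tau> u)) = (\<Sum>i\<in>insert {} Q. \<Sum>u\<in>N i. cut w {u} (\<tau> u))"
      unfolding N_def using \<tau> finQ fin by (intro sum.group[symmetric]) auto
    also have "\<dots> = (\<Sum>i\<in>insert {} Q. cut w (N i) i)"
      by (intro sum.cong refl) (simp add: cut_def N_def)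
    also have "\<dots> = (\<Sum>i\<in>Q. cut w (N i) i)"
      using Qne finQ by (subst sum.insert) auto
    finally show ?thesis ..
  qed
  finally have eq: "(\<Sum>i\<in>I. cut w (f i) (f i))
     = cut w A1 A1 + cut w A2 A2 + 2 * placement_value w D Q \<tau> + (\<Sum>i\<in>Q. cut w (N i) (N i))"
    by (simp add: placement_value_def)
  have "- (h * real (card D)) \<le> (\<Sum>i\<in>Q. cut w (N i) (N i))"
  proof -
    have "(\<Sum>i\<in>Q. real (card (N i))) \<le> real (card D)"
    proof -
      have "(\<Sum>i\<in>Q. card (N i)) = card (\<Union>i\<in>Q. N i)"
        using finQ finN by (intro card_UN_disjoint[symmetric]) (auto simp: N_def)
      also have "\<dots> \<le> card D" using ND fin by (intro card_mono) auto
      finally show ?thesis by (simp flip: of_nat_sum)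
    qed
    then have "(\<Sum>i\<in>Q. h * real (card (N i))) \<le> h * real (card D)"
      unfolding sum_distrib_left[symmetric] using h0 by (rule mult_left_mono)
    moreover have "(\<Sum>i\<in>Q. - (h * real (card (N i)))) \<le> (\<Sum>i\<in>Q. cut w (N i) (N i))"
    proof (rule sum_mono)
      fix i assume i: "i \<in> Q"
      have "\<bar>cut w (N i) (N i)\<bar> \<le> real (card (N i)) * real (card (N i))"
        using ND[of i] U by (intro cut_le_cards) auto
      also have "\<dots> \<le> h * real (card (N i))"
        using hb[OF i] by (intro mult_right_mono) (auto simp: N_def)
      finally show "- (h * real (card (N i))) \<le> cut w (N i) (N i)" by linarith
    qed
    ultimately show ?thesis by (simp add: sum_negf)
  qed
  then show ?thesis using le eq by linarith
qed


text \<open>Two heavy parts of one cluster lie in the same block, and a block with \<open>H\<close>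
  vertices of one cluster has fewer than \<open>K\<close> left for any other.\<close>

lemma broken_unique:
  assumes "broken S B" "broken S' B'" "B \<inter> B' \<noteq> {} \<or> S = S'"
  shows "S = S' \<and> B = B'"
proof -
  have P: "B \<in> P" "B' \<in> P" "S \<in> Cl" "S' \<in> Cl" "H \<le> card (B \<inter> S)" "H \<le> card (B' \<inter> S')"
    using assms by (auto simp: broken_def)
  have B: "B = B'"
  proof (cases "B \<inter> B' = {}")
    case True
    then show ?thesis using assms(3) unique_heavy[OF P(1,2,3,5)] P(6) by simp
  next
    case False
    then show ?thesis using block_disj[OF P(1,2)] by blast
  qed
  moreover have "S = S'"
  proof (rule ccontr)
    assume "S \<noteq> S'"
    then have "B \<inter> S \<subseteq> B - S'" using cluster_disj[of S S'] P by auto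
    then have "card (B \<inter> S) \<le> card (B - S')"
      using fin_sub[OF block_sub] P by (intro card_mono) auto
    moreover have "real (card (B - S')) < K"
      using P B H_ge K by (intro remainder_small) auto
    ultimately show False using P H_ge K by linarith
  qed
  ultimately show ?thesis by simp
qed

text \<open>Two broken clusters cannot coexist: by the exchange property the stray vertices of \<open>S1\<close> and the
  vertices of the heart of \<open>S2\<close> can take over each other's places outside, and the number of
  pairs inside the two hearts is a convex function of the number of exchanged vertices.\<close>

lemma no_two_broken:
  assumes b1: "broken S1 B1" and b2: "broken S2 B2" and ne: "S1 \<noteq> S2"
    and s: "card S1 \<le> s" "card S2 \<le> s" "\<And>S B. broken S B \<Longrightarrow> card S \<le> s"
    and hearts: "\<mu> / 32 * real s \<le> card (B1 \<inter> S1)" "\<mu> / 32 * real s \<le> card (B2 \<inter> S2)"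
    and le: "card (B2 \<inter> S2) \<le> card (B1 \<inter> S1)"
    and big: "10 ^ 7 * K / \<mu> ^ 6 \<le> s" and sU: "s \<le> card U"
  shows False
proof -
  let ?s = "real s"
  define A1 where "A1 = B1 \<inter> S1"
  define A2 where "A2 = B2 \<inter> S2"
  define C where "C = S1 \<union> S2"
  define V where "V = U - C"
  define A where "A = A1 \<union> A2"
  define D where "D = C - A"
  have P: "B1 \<in> P" "B2 \<in> P" "S1 \<in> Cl" "S2 \<in> Cl" "H \<le> card A1" "H \<le> card A2"
    using b1 b2 by (auto simp: broken_def A1_def A2_def)
  have sub: "S1 \<subseteq> U" "S2 \<subseteq> U" "B1 \<subseteq> U" "B2 \<subseteq> U" using P cluster_sub block_sub by auto
  have Sdj: "S1 \<inter> S2 = {}" using cluster_disj P ne by auto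
  have Bdj: "B1 \<inter> B2 = {}" using broken_unique[OF b1 b2] ne by auto
  have fin: "finite S1" "finite S2" "finite B1" "finite B2" using sub fin_sub by auto
  have Hpos: "0 < H" using H_ge K by linarith
  have ne12: "A1 \<noteq> {}" "A2 \<noteq> {}" using P Hpos by auto
  have Adj: "A1 \<inter> A2 = {}" using Bdj by (auto simp: A1_def A2_def)
  have CU: "C \<subseteq> U" using sub by (auto simp: C_def)
  have \<mu>6: "0 < \<mu> ^ 6" "\<mu> ^ 6 \<le> \<mu>" "\<mu> ^ 6 \<le> \<mu>\<^sup>2" "\<mu>^6 \<le> 1"
    using \<mu> power_decreasing[of 1 6 \<mu>] power_decreasing[of 2 6 \<mu>] power_le_one[of \<mu> 6] by auto
  have sK: "10 ^ 7 * K \<le> \<mu> ^ 6 * ?s"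
    using big \<mu>6 by (simp add: field_simps)
  have sK2: "10 ^ 7 * K \<le> \<mu>\<^sup>2 * ?s" and sK1: "10 ^ 7 * K \<le> \<mu> * ?s" and sK0: "10 ^ 7 * K \<le> ?s"
    using sK \<mu>6 mult_right_mono[of "\<mu>^6" "\<mu>\<^sup>2" ?s] mult_right_mono[of "\<mu>^6" "\<mu>" ?s] mult_right_mono[of "\<mu>^6" 1 ?s] by simp_all
  have sH: "4 * H \<le> ?s"
  proof -
    have "4 * H * \<mu> \<le> ?s * \<mu>" using sK1 K \<mu> unfolding H_def by (simp add: mult.commute)
    then show ?thesis using \<mu> by simp
  qed
  have part: "B = ((B \<inter> V) \<union> (B \<inter> D)) \<union> (B \<inter> A)" if "B \<in> P" for B
    using block_sub[OF that] by (auto simp: V_def D_def)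
  have BA: "B \<inter> A = (if B = B1 then A1 else if B = B2 then A2 else {})" if "B \<in> P" for B
    using block_disj[OF that P(1)] block_disj[OF that P(2)] Bdj by (auto simp: A_def A1_def A2_def)
  have DS: "D = (S1 - B1) \<union> (S2 - B2)"
    using Sdj by (auto simp: D_def C_def A_def A1_def A2_def)
  \<comment> \<open>Outside its own heart block a cluster is heavy nowhere, so a block holds fewer
    than \<open>H\<close> strays of each of the two clusters. Hence the guest bound
    \<open>16 * K / \<mu> = 2 * H\<close>.\<close>
  have light: "real (card (B \<inter> D)) \<le> 2 * H" if "B \<in> P" for B
  proof -
    have "real (card (B \<inter> (S - B'))) < H" if "broken S B'" for S B'
    proof (cases "B = B'")
      case True
      then have "B \<inter> (S - B') = {}" by auto
      then show ?thesis using Hpos by simp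
    next
      case False
      have "real (card (B \<inter> S)) < H"
        using unique_heavy[OF \<open>B \<in> P\<close>, of B' S] that False by (force simp: broken_def)
      moreover have "card (B \<inter> (S - B')) \<le> card (B \<inter> S)"
        using fin_sub[OF block_sub[OF \<open>B \<in> P\<close>]] by (intro card_mono) auto
      ultimately show ?thesis by linarith
    qed
    from this[OF b1] this[OF b2]
    have "real (card (B \<inter> (S1 - B1))) + real (card (B \<inter> (S2 - B2))) \<le> 2 * H" by linarith
    moreover have "B \<inter> D = (B \<inter> (S1 - B1)) \<union> (B \<inter> (S2 - B2))" by (auto simp: DS)
    then have "card (B \<inter> D) \<le> card (B \<inter> (S1 - B1)) + card (B \<inter> (S2 - B2))" by (simp add: card_Un_le)
    ultimately show ?thesis by linarith
  qed
  \<comment> \<open>A large host is heavy for some cluster \<open>S\<close>. If \<open>S\<close>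
    were not broken there, the host would lie inside \<open>S\<close> and, as it meets
    \<open>D\<close>, be the heart block of \<open>S1\<close> or \<open>S2\<close>; but that block
    contains no stray of its own cluster. So \<open>S\<close> has at most \<open>s\<close> vertices,
    and the host fewer than \<open>K\<close> others.\<close>
  have size: "real (card B) \<le> 2 * ?s" if "B \<in> P" "B \<inter> D \<noteq> {}" for B
  proof (cases "H + K \<le> card B")
    case False
    then show ?thesis using sH H_ge K by linarith
  next
    case True
    with big_block_heavy[OF that(1)] obtain S where S: "S \<in> Cl" "H \<le> card (B \<inter> S)" by blast
    have "broken S B"
    proof (rule ccontr)
      assume "\<not> broken S B"
      then have BS: "B \<subseteq> S" using not_broken_subset S that by blast
      from that(2) obtain u where u: "u \<in> B" "u \<in> D" by auto
      have "S = Si \<Longrightarrow> broken Si Bi \<Longrightarrow> B = Bi" for Si Bi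
        using unique_heavy[OF that(1) _ S(1) S(2), of Bi] by (auto simp: broken_def)
      moreover have "S = S1 \<or> S = S2"
        using u BS cluster_disj[OF S(1)] P by (auto simp: DS)
      ultimately show False using u BS b1 b2 Sdj by (auto simp: DS)
    qed
    then have "card S \<le> s" using s by auto
    moreover have "card (B \<inter> S) \<le> card S" using fin_sub[OF cluster_sub[OF S(1)]] by (intro card_mono) auto
    moreover have "real (card (B - S)) < K" using S that H_ge K by (intro remainder_small) auto
    moreover have "K \<le> ?s" using sK0 K by simp
    ultimately show ?thesis using card_split[OF block_sub[OF that(1)], of S] by linarith
  qed
  define Q where "Q = (\<lambda>B. B \<inter> V) ` P - {{}}"
  define blk where "blk u = (THE B. B \<in> P \<and> u \<in> B)" for u
  have blk: "blk u = B" if "B \<in> P" "u \<in> B" for u B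
    unfolding blk_def using that block_disj by (intro the_equality) auto
  define \<tau> where "\<tau> u = blk u \<inter> V" for u
  have DU: "D \<subseteq> U" using CU by (auto simp: D_def)
  have blkP: "blk u \<in> P" "u \<in> blk u" if "u \<in> D" for u
    using ex_block[of u] DU that blk by auto
  have djV: "disjoint_family_on (\<lambda>B. B \<inter> V) P" using block_disj by (auto simp: disjoint_family_on_def)
  have pl: "placement V D (2 * ?s) (16 * K / \<mu>) Q \<tau>"
    unfolding placement_def
  proof (intro conjI ballI)
    have "(\<Union>B\<in>P. B \<inter> V) = V" using ex_block by (auto simp: V_def)
    then show "partition_on V Q" unfolding Q_def using djV by (intro partition_on_image)
  next
    fix u assume u: "u \<in> D"
    show "\<tau> u \<in> insert {} Q" using blkP[OF u] by (auto simp: \<tau>_def Q_def)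
    have "card (\<tau> u) \<le> card (blk u)"
      using fin_sub[OF block_sub] blkP[OF u] by (auto simp: \<tau>_def intro: card_mono)
    moreover have "real (card (blk u)) \<le> 2 * ?s" using size blkP[OF u] u by blast
    ultimately show "real (card (\<tau> u)) \<le> 2 * ?s" by linarith
  next
    fix B' assume "B' \<in> Q"
    then obtain B where B: "B \<in> P" "B' = B \<inter> V" "B' \<noteq> {}" by (auto simp: Q_def)
    have "{u \<in> D. \<tau> u = B'} \<subseteq> B \<inter> D"
    proof
      fix u assume "u \<in> {u \<in> D. \<tau> u = B'}"
      then have u: "u \<in> D" "blk u \<inter> V = B \<inter> V" using B by (auto simp: \<tau>_def)
      then have "blk u = B" using B block_disj[of "blk u" B] blkP by blast
      then show "u \<in> B \<inter> D" using u blkP by blast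
    qed
    then have "card {u \<in> D. \<tau> u = B'} \<le> card (B \<inter> D)"
      using fin_sub[OF block_sub[OF B(1)]] by (intro card_mono) auto
    then show "real (card {u \<in> D. \<tau> u = B'}) \<le> 16 * K / \<mu>"
      using light[OF B(1)] by (simp add: H_def)
  qed
  have finD: "finite D" and finV: "finite V" using DU fin_sub finU by (auto simp: V_def)
  \<comment> \<open>Apart from the hearts and the placement that \<open>P\<close> itself induces,
    everything is linear in \<open>s\<close>.\<close>
  have upper: "score w P \<le> cut w A1 A1 + cut w A2 A2 + 2 * placement_value w D Q \<tau> + 2 * K * (2 * ?s) + 2 * H * (2 * ?s)"
  proof -
    have e: "cut w B B = cut w (B \<inter> A) (B \<inter> A) + 2 * cut w (B \<inter> A) (B - A)
        + (cut w (B \<inter> V) (B \<inter> V) + 2 * cut w (B \<inter> D) (B \<inter> V) + cut w (B \<inter> D) (B \<inter> D))" if B: "B \<in> P" for B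
    proof -
      have fB: "finite B" using fin_sub[OF block_sub[OF B]] .
      have 1: "cut w (B \<inter> A \<union> (B - A)) (B \<inter> A \<union> (B - A)) = cut w (B \<inter> A) (B \<inter> A) + 2 * cut w (B \<inter> A) (B - A) + cut w (B - A) (B - A)"
        using fB by (intro cut_Un_self) auto
      have 2: "B \<inter> A \<union> (B - A) = B" by auto
      have 3: "B - A = B \<inter> D \<union> B \<inter> V" using part[OF B] by (auto simp: V_def D_def A_def A1_def A2_def C_def)
      have 4: "cut w (B \<inter> D \<union> B \<inter> V) (B \<inter> D \<union> B \<inter> V) = cut w (B \<inter> D) (B \<inter> D) + 2 * cut w (B \<inter> D) (B \<inter> V) + cut w (B \<inter> V) (B \<inter> V)"
        using fB by (intro cut_Un_self) (auto simp: V_def D_def)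
      show ?thesis using 1[unfolded 2] 4[folded 3] by linarith
    qed
    have "score w P = (\<Sum>B\<in>P. cut w (B \<inter> A) (B \<inter> A) + 2 * cut w (B \<inter> A) (B - A))
        + (\<Sum>B\<in>P. cut w (B \<inter> V) (B \<inter> V)) + 2 * (\<Sum>B\<in>P. cut w (B \<inter> D) (B \<inter> V)) + (\<Sum>B\<in>P. cut w (B \<inter> D) (B \<inter> D))"
      unfolding score_def using e by (simp add: sum.distrib sum_distrib_left)
    moreover have "(\<Sum>B\<in>P. cut w (B \<inter> V) (B \<inter> V)) = score w Q"
      unfolding score_def Q_def using sum_image_nonempty[OF finP djV, of "\<lambda>B. cut w B B"] by simp
    moreover have "(\<Sum>B\<in>P. cut w (B \<inter> D) (B \<inter> V)) = (\<Sum>u\<in>D. cut w {u} (\<tau> u))"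
    proof -
      have "(\<Sum>u\<in>D. cut w {u} (\<tau> u)) = (\<Sum>B\<in>P. \<Sum>u\<in>{u \<in> D. blk u = B}. cut w {u} (\<tau> u))"
        using blkP finP finD by (intro sum.group[symmetric]) auto
      also have "\<dots> = (\<Sum>B\<in>P. cut w (B \<inter> D) (B \<inter> V))"
      proof (intro sum.cong refl)
        fix B assume "B \<in> P"
        then have "{u \<in> D. blk u = B} = B \<inter> D" using blk blkP by auto
        then show "(\<Sum>u\<in>{u \<in> D. blk u = B}. cut w {u} (\<tau> u)) = cut w (B \<inter> D) (B \<inter> V)"
          using blk[OF \<open>B \<in> P\<close>] by (simp add: cut_def \<tau>_def)
      qed
      finally show ?thesis ..
    qed
    moreover have "(\<Sum>B\<in>P. cut w (B \<inter> D) (B \<inter> D)) \<le> 2 * H * (2 * ?s)"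
    proof -
      have "(\<Sum>B\<in>P. cut w (B \<inter> D) (B \<inter> D)) \<le> (\<Sum>B\<in>P. 2 * H * real (card (B \<inter> D)))"
      proof (rule sum_mono)
        fix B assume B: "B \<in> P"
        have "\<bar>cut w (B \<inter> D) (B \<inter> D)\<bar> \<le> real (card (B \<inter> D)) * real (card (B \<inter> D))"
          using block_sub[OF B] by (intro cut_le_cards) auto
        also have "\<dots> \<le> 2 * H * real (card (B \<inter> D))"
          using light[OF B] by (intro mult_right_mono) auto
        finally show "cut w (B \<inter> D) (B \<inter> D) \<le> 2 * H * real (card (B \<inter> D))" by simp
      qed
      also have "\<dots> = 2 * H * real (card D)"
        using partition_on_sum_card[OF finU partP DU] by (simp flip: of_nat_sum sum_distrib_left)
      also have "real (card D) \<le> 2 * ?s"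
      proof -
        have "card D \<le> card C" using fin by (intro card_mono) (auto simp: D_def C_def)
        also have "\<dots> \<le> card S1 + card S2" unfolding C_def by (rule card_Un_le)
        finally show ?thesis using s by simp
      qed
      finally show ?thesis using Hpos by simp
    qed
    moreover have "(\<Sum>B\<in>P. cut w (B \<inter> A) (B \<inter> A) + 2 * cut w (B \<inter> A) (B - A)) \<le> cut w A1 A1 + cut w A2 A2 + 2 * K * (2 * ?s)"
    proof -
      have "(\<Sum>B\<in>P. cut w (B \<inter> A) (B \<inter> A) + 2 * cut w (B \<inter> A) (B - A))
        = (\<Sum>B\<in>{B1, B2}. cut w (B \<inter> A) (B \<inter> A) + 2 * cut w (B \<inter> A) (B - A))"
        using finP P BA by (intro sum.mono_neutral_right) auto
      also have "\<dots> = cut w A1 A1 + 2 * cut w A1 (B1 - A) + (cut w A2 A2 + 2 * cut w A2 (B2 - A))"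
        using BA[OF P(1)] BA[OF P(2)] Bdj block_ne P by (subst sum.insert) auto
      also have "\<dots> \<le> cut w A1 A1 + 2 * (K * ?s) + (cut w A2 A2 + 2 * (K * ?s))"
      proof -
        have "cut w A0 (B0 - A) \<le> K * ?s" if "B0 \<in> P" "S0 \<in> Cl" "H \<le> card A0" "A0 = B0 \<inter> S0" "B0 - A = B0 - S0" "card S0 \<le> s" for A0 B0 S0
        proof -
          have "real (card (B0 - S0)) < K" using that H_ge K by (intro remainder_small) auto
          moreover have "card A0 \<le> card S0" using fin_sub[OF cluster_sub[OF that(2)]] that by (auto intro: card_mono)
          ultimately have "real (card A0) * real (card (B0 - A)) \<le> ?s * K"
            using that by (intro mult_mono) auto
          moreover have "\<bar>cut w A0 (B0 - A)\<bar> \<le> real (card A0) * real (card (B0 - A))"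
            using block_sub[OF that(1)] that(4) by (intro cut_le_cards) auto
          ultimately show ?thesis by (simp add: mult.commute)
        qed
        moreover have "B1 - A = B1 - S1" "B2 - A = B2 - S2" using Bdj by (auto simp: A_def A1_def A2_def)
        ultimately have "cut w A1 (B1 - A) \<le> K * ?s" "cut w A2 (B2 - A) \<le> K * ?s"
          using P s A1_def A2_def by blast+
        then show ?thesis by linarith
      qed
      finally show ?thesis by (simp add: algebra_simps)
    qed
    ultimately show ?thesis unfolding placement_value_def by argo
  qed
  \<comment> \<open>At most half of the strays that \<open>S1\<close> has at least,
    \<open>\<mu> / 2 * (\<mu> / 32 * s)\<close>, and at most a quarter of the smaller heart. Being
    linear in \<open>s\<close>, it makes the gain quadratic.\<close>
  define x where "x = nat \<lfloor>\<mu>\<^sup>2 * ?s / 128\<rfloor>"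
  have x_le: "real x \<le> \<mu>\<^sup>2 * ?s / 128" unfolding x_def by (rule of_nat_floor) simp
  have x_ge: "\<mu>\<^sup>2 * ?s / 256 \<le> real x"
  proof -
    have "\<mu>\<^sup>2 * ?s / 128 - 1 \<le> real x" unfolding x_def by linarith
    moreover have "1 \<le> \<mu>\<^sup>2 * ?s / 256" using sK2 K by simp
    ultimately show ?thesis by linarith
  qed
  have cA: "\<mu> / 32 * ?s \<le> card A1" "\<mu> / 32 * ?s \<le> card A2" "card A2 \<le> card A1"
    using hearts le by (auto simp: A1_def A2_def)
  have "\<mu>\<^sup>2 * ?s \<le> \<mu> * ?s" using \<mu> power_decreasing[of 1 2 \<mu>] by (intro mult_right_mono) auto
  then have x_A2: "real x \<le> \<mu> / 128 * ?s" using x_le by simp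
  have "x \<le> card (S1 - B1)"
  proof -
    have "card A1 \<le> card S1" using fin by (auto simp: A1_def intro: card_mono)
    then have "\<mu> / 32 * ?s \<le> card S1" using cA by linarith
    then have "\<mu> / 2 * (\<mu> / 32 * ?s) \<le> \<mu> / 2 * real (card S1)" using \<mu> by (intro mult_left_mono) auto
    also have "\<dots> \<le> card (S1 - B1)" using b1 by (simp add: broken_def)
    finally have "\<mu>\<^sup>2 * ?s / 64 \<le> card (S1 - B1)" by (simp add: power2_eq_square)
    moreover have "\<mu>\<^sup>2 * ?s / 128 \<le> \<mu>\<^sup>2 * ?s / 64" by simp
    ultimately have "real x \<le> real (card (S1 - B1))" using x_le by linarith
    then show ?thesis by simp
  qed
  then obtain X where X: "X \<subseteq> S1 - B1" "card X = x" by (meson obtain_subset_with_card_n)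
  have "real x \<le> card A2" using x_A2 cA \<mu> sK1 K by linarith
  then obtain Y where Y: "Y \<subseteq> A2" "card Y = x" by (metis of_nat_le_iff obtain_subset_with_card_n)
  have fX: "finite X" "finite Y" "finite A1" "finite A2" using X Y fin finite_subset by (auto simp: A1_def A2_def)
  \<comment> \<open>The strays \<open>X\<close> join the larger heart while \<open>Y\<close> leaves
    the smaller one. The two sets outside have equal size, as the exchange property demands.\<close>
  define D' where "D' = (D - X) \<union> Y"
  have XD: "X \<subseteq> D" "Y \<inter> D = {}" using X Y Sdj by (auto simp: DS A2_def D_def A_def)
  have cD: "card D' = card D"
  proof -
    have "card D' = card (D - X) + card Y"
      unfolding D'_def using XD fX finD by (intro card_Un_disjoint) auto
    also have "card (D - X) = card D - x" using XD fX X by (simp add: card_Diff_subset)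
    finally show ?thesis using Y X XD finD card_mono[of D X] by simp
  qed
  have "D \<subseteq> S1 \<union> S2" "D' \<subseteq> S1 \<union> S2" using X Y by (auto simp: D'_def DS A2_def)
  then obtain Q' \<tau>' where Q': "placement V D' (2 * ?s) (16 * K / \<mu>) Q' \<tau>'"
    "placement_value w D Q \<tau> - \<epsilon> * ?s ^ 2 \<le> placement_value w D' Q' \<tau>'"
    using exchange[OF P(3,4) ne s(1,2) _ sU, of D D' Q \<tau>] pl cD sK0 K by (auto simp: V_def C_def)
  have cA2: "real (card (A2 - Y)) = real (card A2) - real x"
    using Y fX card_mono[of A2 Y] by (simp add: card_Diff_subset of_nat_diff)
  have cA1: "real (card (A1 \<union> X)) = real (card A1) + real x"
    using X fX by (subst card_Un_disjoint) (auto simp: A1_def)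
  have A2Y: "K \<le> card (A2 - Y)" using cA2 cA x_A2 sK1 K by simp
  have lower: "cut w (A1 \<union> X) (A1 \<union> X) + cut w (A2 - Y) (A2 - Y) + 2 * placement_value w D' Q' \<tau>' - 16 * K / \<mu> * real (card D') \<le> score w P"
  proof (rule score_ge_placement[OF Q'(1)])
    show "U = V \<union> D' \<union> (A1 \<union> X) \<union> (A2 - Y)"
      using CU X Y by (auto simp: V_def C_def D'_def D_def A_def A1_def A2_def)
    show "V \<inter> D' = {}" using \<open>D' \<subseteq> S1 \<union> S2\<close> by (auto simp: V_def C_def)
    show "(V \<union> D') \<inter> (A1 \<union> X \<union> (A2 - Y)) = {}"
      using X Y Sdj by (auto simp: V_def C_def D'_def D_def A_def A1_def A2_def)
    show "(A1 \<union> X) \<inter> (A2 - Y) = {}" using X Sdj Adj by (auto simp: A2_def)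
    show "A1 \<union> X \<noteq> {}" using ne12 by auto
    show "A2 - Y \<noteq> {}" using A2Y K by (metis card.empty not_one_le_zero of_nat_0 order_trans zero_less_one_class.zero_le_one order.trans of_nat_le_0_iff of_nat_1)
    show "0 \<le> 16 * K / \<mu>" using K \<mu> by simp
  qed
  have D's: "16 * K / \<mu> * real (card D') \<le> 2 * H * (2 * ?s)"
  proof -
    have "card D \<le> card C" using fin by (intro card_mono) (auto simp: D_def C_def)
    also have "\<dots> \<le> card S1 + card S2" unfolding C_def by (rule card_Un_le)
    finally have "real (card D') \<le> 2 * ?s" using s cD by simp
    then have "2 * H * real (card D') \<le> 2 * H * (2 * ?s)" using Hpos by (intro mult_left_mono) auto
    then show ?thesis by (simp add: H_def)
  qed
  have ineq: "cut w (A1 \<union> X) (A1 \<union> X) + cut w (A2 - Y) (A2 - Y) - cut w A1 A1 - cut w A2 A2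
     \<le> 2 * (\<epsilon> * ?s ^ 2) + 4 * K * ?s + 8 * H * ?s"
    using upper lower D's Q'(2) by (simp add: algebra_simps)
  have cs: "card (A1 \<union> X) \<le> s" "card (A2 - Y) \<le> s" "card A1 \<le> s" "card A2 \<le> s"
  proof -
    have "card (A1 \<union> X) \<le> card S1" "card (A2 - Y) \<le> card S2" "card A1 \<le> card S1" "card A2 \<le> card S2"
      using fin X by (auto simp: A1_def A2_def intro!: card_mono)
    then show "card (A1 \<union> X) \<le> s" "card (A2 - Y) \<le> s" "card A1 \<le> s" "card A2 \<le> s" using s by auto
  qed
  have inn: "\<bar>cut w Z Z - \<mu> * real (card Z) ^ 2\<bar> \<le> \<epsilon> * ?s ^ 2" if "S \<in> Cl" "Z \<subseteq> S" "K \<le> card Z" "card Z \<le> s" for S Z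
  proof -
    have "\<epsilon> * real (card Z) ^ 2 \<le> \<epsilon> * ?s ^ 2" using that(4) eps by (intro mult_left_mono power_mono) auto
    then show ?thesis using inner[OF that(1-3)] by linarith
  qed
  have KA: "K \<le> card A1" "K \<le> card A2" using P H_ge K by linarith+
  have 1: "\<bar>cut w (A1 \<union> X) (A1 \<union> X) - \<mu> * (real (card A1) + real x) ^ 2\<bar> \<le> \<epsilon> * ?s ^ 2"
    using inn[OF P(3), of "A1 \<union> X"] X cs cA1 KA by (auto simp: A1_def)
  have 2: "\<bar>cut w (A2 - Y) (A2 - Y) - \<mu> * (real (card A2) - real x) ^ 2\<bar> \<le> \<epsilon> * ?s ^ 2"
    using inn[OF P(4), of "A2 - Y"] Y cs cA2 A2Y by (auto simp: A2_def)
  have 3: "\<bar>cut w A1 A1 - \<mu> * real (card A1) ^ 2\<bar> \<le> \<epsilon> * ?s ^ 2" "\<bar>cut w A2 A2 - \<mu> * real (card A2) ^ 2\<bar> \<le> \<epsilon> * ?s ^ 2"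
    using inn[OF P(3), of A1] inn[OF P(4), of A2] cs KA by (auto simp: A1_def A2_def)
  \<comment> \<open>Moving \<open>x\<close> units from the smaller to the larger number raises the
    sum of squares by at least \<open>2 * x ^ 2\<close>; this is where the order of the hearts is
    needed.\<close>
  have "\<mu> * (2 * real x ^ 2) \<le> \<mu> * ((real (card A1) + real x) ^ 2 + (real (card A2) - real x) ^ 2 - real (card A1) ^ 2 - real (card A2) ^ 2)"
  proof (intro mult_left_mono)
    have "0 \<le> 2 * real x * (real (card A1) - real (card A2))" using cA by simp
    then show "2 * real x ^ 2 \<le> (real (card A1) + real x) ^ 2 + (real (card A2) - real x) ^ 2 - real (card A1) ^ 2 - real (card A2) ^ 2"
      by (simp add: power2_eq_square algebra_simps)
  qed (use \<mu> in simp)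
  \<comment> \<open>Six errors: four from \<open>inner\<close>, and the exchange loss counted twice
    because \<open>score\<close> counts pairs twice.\<close>
  then have "\<mu> * (2 * real x ^ 2) \<le> 6 * (\<epsilon> * ?s ^ 2) + 4 * K * ?s + 8 * H * ?s"
    using 1 2 3 ineq by (simp add: algebra_simps)
  moreover have "\<mu> * (2 * (\<mu>\<^sup>2 * ?s / 256) ^ 2) \<le> \<mu> * (2 * real x ^ 2)"
    using x_ge \<mu> by (intro mult_left_mono power_mono) auto
  moreover have "\<mu> * (2 * (\<mu>\<^sup>2 * ?s / 256) ^ 2) = \<mu> ^ 5 * ?s ^ 2 / 32768"
    by (simp add: power_divide power_mult_distrib flip: power_mult power_Suc)
  ultimately have fin1: "\<mu> ^ 5 * ?s ^ 2 / 32768 \<le> 6 * (\<epsilon> * ?s ^ 2) + 4 * K * ?s + 8 * H * ?s" by linarith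
  have 4: "6 * (\<epsilon> * ?s ^ 2) \<le> \<mu> ^ 5 * ?s ^ 2 / 66000"
  proof -
    have "\<epsilon> * ?s ^ 2 \<le> \<mu> ^ 5 / 400000 * ?s ^ 2" using eps by (intro mult_right_mono) auto
    moreover have "0 \<le> \<mu> ^ 5 * ?s ^ 2" using \<mu> by simp
    ultimately show ?thesis by simp
  qed
  have 5: "4 * K * ?s + 8 * H * ?s \<le> \<mu> ^ 5 * ?s ^ 2 / 130000"
  proof -
    have "(4 * K + 8 * H) * \<mu> \<le> 68 * K" using \<mu> K unfolding H_def by (simp add: field_simps mult_left_le)
    also have "\<dots> \<le> \<mu> ^ 6 * ?s / 130000" using sK K by simp
    finally have "(4 * K + 8 * H) * \<mu> \<le> (\<mu> ^ 5 * ?s / 130000) * \<mu>" by (simp add: power_Suc2 eval_nat_numeral mult_ac)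
    then have "4 * K + 8 * H \<le> \<mu> ^ 5 * ?s / 130000" using \<mu> by simp
    then have "(4 * K + 8 * H) * ?s \<le> \<mu> ^ 5 * ?s / 130000 * ?s" by (intro mult_right_mono) auto
    then show ?thesis by (simp add: algebra_simps power2_eq_square)
  qed
  have "0 < \<mu> ^ 5 * ?s ^ 2" using \<mu> sK0 K by simp
  then show False using fin1 4 5 by linarith
qed

text \<open>Strays need hosts with big hearts. For a broken cluster of maximal size \<open>m\<close>
  the strays are at least a fixed proportion of \<open>m\<close>, while each host takes fewer than
  \<open>K\<close> of them. So at least two hosts have hearts comparable to \<open>m\<close>, which
  \<open>no_two_broken\<close> excludes. The factor \<open>16 / \<mu>\<close> beyond the size needed
  there guarantees that some broken cluster is large enough.\<close>

lemma large_cluster_is_block: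
  assumes S: "S \<in> Cl" and big: "16 * 10 ^ 7 * K / \<mu> ^ 7 \<le> card S"
  shows "S \<in> P"
proof (rule ccontr)
  assume "S \<notin> P"
  have \<mu>7: "0 < \<mu> ^ 7" "\<mu> ^ 7 \<le> \<mu>\<^sup>2" "\<mu> ^ 6 \<le> \<mu>\<^sup>2" "0 < \<mu> ^ 6"
    using \<mu> power_decreasing[of 2 7 \<mu>] power_decreasing[of 2 6 \<mu>] by auto
  have HK: "64 * (2 * H + K) / \<mu> \<le> 10 ^ 7 * K / \<mu> ^ 6"
  proof -
    have "64 * (2 * H + K) / \<mu> \<le> 64 * (17 * K / \<mu>) / \<mu>"
      using \<mu> K unfolding H_def by (intro divide_right_mono mult_left_mono) (auto simp: field_simps mult_left_le)
    also have "\<dots> = 1088 * K / \<mu>\<^sup>2" by (simp add: power2_eq_square)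
    also have "\<dots> \<le> 10 ^ 7 * K / \<mu> ^ 6" using \<mu>7 K by (intro frac_le) auto
    finally show ?thesis .
  qed
  have step: "\<exists>D. D \<subseteq> S \<and> D \<noteq> {} \<and> (\<forall>B. B \<in> P \<longrightarrow> H \<le> card (B \<inter> S) \<longrightarrow> D = S - B) \<and>
    \<mu> / 16 * real (card D) * real (card S)
      \<le> (\<Sum>B\<in>{B \<in> P. \<exists>S'. S' \<noteq> S \<and> broken S' B}. real (card (B \<inter> D)) * real (card (B \<inter> (THE S'. broken S' B)))) \<and>
    (\<forall>B\<in>{B \<in> P. \<exists>S'. S' \<noteq> S \<and> broken S' B}. real (card (B \<inter> D)) < K)"
    if "S \<in> Cl" "S \<notin> P" "64 * (2 * H + K) / \<mu> \<le> card S" for S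
  proof (rule stray_hosts[OF that])
    fix D assume D: "D \<subseteq> S" "D \<noteq> {}" "\<And>B. B \<in> P \<Longrightarrow> H \<le> card (B \<inter> S) \<Longrightarrow> D = S - B"
      "\<mu> / 16 * real (card D) * real (card S)
        \<le> (\<Sum>B\<in>{B \<in> P. \<exists>S'. S' \<noteq> S \<and> broken S' B}. real (card (B \<inter> D)) * real (card (B \<inter> (THE S'. broken S' B))))"
      "\<And>B. B \<in> {B \<in> P. \<exists>S'. S' \<noteq> S \<and> broken S' B} \<Longrightarrow> real (card (B \<inter> D)) < K"
    show ?thesis
      by (intro exI[of _ D] conjI allI impI ballI) (fact D(1), fact D(2), erule (1) D(3), fact D(4), erule D(5))
  qed
  have the: "(THE S'. broken S' B) = S'" if "broken S' B" for S' B
    using that broken_unique[of _ B S' B] by (intro the_equality) (auto simp: broken_def dest: block_ne)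
  have sums: "(\<Sum>B\<in>\<B>. real (card (B \<inter> D))) \<le> real (card D)" if "D \<subseteq> U" "\<B> \<subseteq> P" for D \<B>
  proof -
    have "(\<Sum>B\<in>\<B>. card (B \<inter> D)) \<le> (\<Sum>B\<in>P. card (B \<inter> D))" using finP that by (intro sum_mono2) auto
    then show ?thesis using partition_on_sum_card[OF finU partP that(1)] by (simp flip: of_nat_sum)
  qed
  \<comment> \<open>Otherwise all hearts of hosts would be smaller than
    \<open>\<mu> / 16 * card S\<close>, and the strays of \<open>S\<close> could not gain what
    \<open>stray_hosts\<close> claims.\<close>
  have "\<exists>S' B. broken S' B \<and> 10 ^ 7 * K / \<mu> ^ 6 \<le> card S'"
  proof (rule ccontr)
    assume "\<not> ?thesis"
    then have small: "\<And>S' B. broken S' B \<Longrightarrow> real (card S') < 10 ^ 7 * K / \<mu> ^ 6" by force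
    have c: "16 / \<mu> * (10 ^ 7 * K / \<mu> ^ 6) \<le> card S"
      using big by (simp add: field_simps flip: power_Suc)
    moreover have "1 * (10 ^ 7 * K / \<mu> ^ 6) \<le> 16 / \<mu> * (10 ^ 7 * K / \<mu> ^ 6)"
      using \<mu> K by (intro mult_right_mono) (auto simp: field_simps)
    ultimately have "64 * (2 * H + K) / \<mu> \<le> card S" using HK by linarith
    from step[OF S \<open>S \<notin> P\<close> this] obtain D where D: "D \<subseteq> S" "D \<noteq> {}"
      and le: "\<mu> / 16 * real (card D) * real (card S)
        \<le> (\<Sum>B\<in>{B \<in> P. \<exists>S'. S' \<noteq> S \<and> broken S' B}. real (card (B \<inter> D)) * real (card (B \<inter> (THE S'. broken S' B))))"
      by blast
    let ?Hs = "{B \<in> P. \<exists>S'. S' \<noteq> S \<and> broken S' B}"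
    have DU: "D \<subseteq> U" using D cluster_sub[OF S] by auto
    then have cD: "0 < real (card D)" using D fin_sub by (simp add: card_gt_0_iff)
    let ?c = "real (card D)" and ?v = "\<lambda>B. real (card (B \<inter> (THE S'. broken S' B)))"
    have v: "?v B < \<mu> / 16 * real (card S)" if "B \<in> ?Hs" for B
    proof -
      from that obtain S' where b: "broken S' B" by auto
      have "card (B \<inter> S') \<le> card S'" using b fin_sub[OF cluster_sub] by (intro card_mono) (auto simp: broken_def)
      moreover have "10 ^ 7 * K / \<mu> ^ 6 \<le> \<mu> / 16 * real (card S)" using c \<mu> by (simp add: field_simps)
      ultimately show ?thesis using small[OF b] the[OF b] by simp
    qed
    have "?Hs \<noteq> {}"
    proof
      assume "?Hs = {}"
      then have "\<mu> / 16 * ?c * real (card S) \<le> 0" using le by (simp only: sum.empty)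
      moreover have "0 < real (card S)" using cD D card_mono[of S D] fin_sub[OF cluster_sub[OF S]] by simp
      ultimately show False using \<mu> cD by (simp add: mult_le_0_iff)
    qed
    have "\<exists>B\<in>?Hs. 0 < real (card (B \<inter> D))"
    proof (rule ccontr)
      assume "\<not> ?thesis"
      then have "(\<Sum>B\<in>?Hs. real (card (B \<inter> D)) * ?v B) = 0" by (intro sum.neutral) auto
      moreover have "0 < real (card S)" using cD D card_mono[of S D] fin_sub[OF cluster_sub[OF S]] by simp
      ultimately show False using \<mu> cD le by (simp add: mult_le_0_iff)
    qed
    then obtain B0 where B0: "B0 \<in> ?Hs" "0 < real (card (B0 \<inter> D))" by blast
    have "(\<Sum>B\<in>?Hs. real (card (B \<inter> D)) * ?v B) < (\<Sum>B\<in>?Hs. real (card (B \<inter> D)) * (\<mu> / 16 * real (card S)))"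
    proof (rule sum_strict_mono_ex1)
      show "finite ?Hs" using finP by auto
      show "\<forall>B\<in>?Hs. real (card (B \<inter> D)) * ?v B \<le> real (card (B \<inter> D)) * (\<mu> / 16 * real (card S))"
        by (rule ballI, rule mult_left_mono[OF less_imp_le[OF v]]) simp_all
      show "\<exists>B\<in>?Hs. real (card (B \<inter> D)) * ?v B < real (card (B \<inter> D)) * (\<mu> / 16 * real (card S))"
        using mult_strict_left_mono[OF v[OF B0(1)] B0(2)] B0(1) by (rule bexI[of _ B0])
    qed
    also have "\<dots> = (\<Sum>B\<in>?Hs. real (card (B \<inter> D))) * (\<mu> / 16 * real (card S))" by (simp add: sum_distrib_right)
    also have "\<dots> \<le> ?c * (\<mu> / 16 * real (card S))" using sums[OF DU, of ?Hs] \<mu> by (intro mult_right_mono) auto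
    finally show False using le by (simp add: mult_ac)
  qed
  then obtain S0 B0 where b0: "broken S0 B0" and big0: "10 ^ 7 * K / \<mu> ^ 6 \<le> card S0" by blast
  define m where "m = Max (card ` {S \<in> Cl. \<exists>B. broken S B})"
  have fB: "finite {S \<in> Cl. \<exists>B. broken S B}" using finC by auto
  have "m \<in> card ` {S \<in> Cl. \<exists>B. broken S B}"
    unfolding m_def
  proof (rule Max_in)
    show "finite (card ` {S \<in> Cl. \<exists>B. broken S B})" using fB by (rule finite_imageI)
    have "S0 \<in> Cl" using b0 by (simp add: broken_def)
    then show "card ` {S \<in> Cl. \<exists>B. broken S B} \<noteq> {}" using b0 by blast
  qed
  then obtain S1 B1 where b1: "broken S1 B1" "card S1 = m" by auto
  have max: "card S' \<le> m" if "broken S' B'" for S' B'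
  proof -
    have "S' \<in> Cl" using that by (simp add: broken_def)
    then show ?thesis unfolding m_def using fB that by (intro Max_ge finite_imageI) blast+
  qed
  have m_big: "10 ^ 7 * K / \<mu> ^ 6 \<le> m" using big0 max[OF b0] by linarith
  have mU: "m \<le> card U" using b1 cluster_sub finU by (auto simp: broken_def intro: card_mono)
  have m0: "0 < real m" using m_big \<mu>7 K by (smt (verit) divide_pos_pos mult_pos_pos zero_less_power)
  have S1: "S1 \<in> Cl" "B1 \<in> P" "H \<le> card (B1 \<inter> S1)" "\<mu> / 2 * real m \<le> card (S1 - B1)" using b1 by (auto simp: broken_def)
  have "S1 \<notin> P"
  proof
    assume "S1 \<in> P"
    have "S1 \<inter> B1 \<noteq> {}" using S1 H_ge K by (auto simp: Int_commute)
    then have "S1 = B1" using block_disj \<open>S1 \<in> P\<close> S1 by blast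
    then have "\<mu> / 2 * real m \<le> 0" using S1(4) by simp
    then show False using \<mu> m0 by (simp add: mult_le_0_iff)
  qed
  moreover have "64 * (2 * H + K) / \<mu> \<le> card S1" using HK m_big b1 by linarith
  ultimately obtain D where D: "D \<subseteq> S1" "D \<noteq> {}" "\<And>B. B \<in> P \<Longrightarrow> H \<le> card (B \<inter> S1) \<Longrightarrow> D = S1 - B"
    and le: "\<mu> / 16 * real (card D) * real m
        \<le> (\<Sum>B\<in>{B \<in> P. \<exists>S'. S' \<noteq> S1 \<and> broken S' B}. real (card (B \<inter> D)) * real (card (B \<inter> (THE S'. broken S' B))))"
    and guest: "\<And>B. B\<in>{B \<in> P. \<exists>S'. S' \<noteq> S1 \<and> broken S' B} \<Longrightarrow> real (card (B \<inter> D)) < K"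
    using step[OF S1(1)] b1(2) by blast
  let ?Hs = "{B \<in> P. \<exists>S'. S' \<noteq> S1 \<and> broken S' B}"
  let ?v = "\<lambda>B. real (card (B \<inter> (THE S'. broken S' B)))"
  \<comment> \<open>Hosts with smaller hearts provide at most half of the gain
    \<open>\<mu> / 16 * card D * m\<close>; each of the others provides at most
    \<open>K * m\<close>.\<close>
  define Big where "Big = {B \<in> ?Hs. \<mu> / 32 * real m \<le> ?v B}"
  have DU: "D \<subseteq> U" using D cluster_sub[OF S1(1)] by auto
  have cD: "\<mu> / 2 * real m \<le> card D" using D(3)[OF S1(2,3)] S1(4) by simp
  have vm: "?v B \<le> m" if "B \<in> ?Hs" for B
  proof -
    from that obtain S' where b: "broken S' B" by auto
    have "card (B \<inter> S') \<le> card S'" using b fin_sub[OF cluster_sub] by (intro card_mono) (auto simp: broken_def)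
    then show ?thesis using max[OF b] the[OF b] by simp
  qed
  have finHs: "finite ?Hs" using finP by auto
  have "(\<Sum>B\<in>?Hs. real (card (B \<inter> D)) * ?v B) \<le> (\<Sum>B\<in>?Hs. real (card (B \<inter> D)) * (\<mu> / 32 * real m) + (if B \<in> Big then K * real m else 0))"
  proof (rule sum_mono)
    fix B assume B: "B \<in> ?Hs"
    show "real (card (B \<inter> D)) * ?v B \<le> real (card (B \<inter> D)) * (\<mu> / 32 * real m) + (if B \<in> Big then K * real m else 0)"
    proof (cases "B \<in> Big")
      case True
      have "real (card (B \<inter> D)) * ?v B \<le> K * real m"
        using guest[OF B] vm[OF B] K by (intro mult_mono) auto
      moreover have "0 \<le> real (card (B \<inter> D)) * (\<mu> / 32 * real m)" using \<mu> by simp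
      ultimately show ?thesis using True by simp
    next
      case False
      then have "\<not> \<mu> / 32 * real m \<le> ?v B" using B unfolding Big_def by blast
      then have "?v B \<le> \<mu> / 32 * real m" by linarith
      then have "real (card (B \<inter> D)) * ?v B \<le> real (card (B \<inter> D)) * (\<mu> / 32 * real m)" by (rule mult_left_mono) simp
      then show ?thesis using False by simp
    qed
  qed
  also have "\<dots> = (\<Sum>B\<in>?Hs. real (card (B \<inter> D))) * (\<mu> / 32 * real m) + real (card Big) * (K * real m)"
  proof -
    have "?Hs \<inter> {B. B \<in> Big} = Big" by (auto simp: Big_def)
    then show ?thesis using finHs by (simp add: sum.distrib sum.If_cases sum_distrib_right)
  qed
  also have "\<dots> \<le> real (card D) * (\<mu> / 32 * real m) + real (card Big) * (K * real m)"
    using sums[OF DU, of ?Hs] \<mu> by (intro add_right_mono mult_right_mono) auto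
  finally have "real (card D) * (\<mu> / 32 * real m) \<le> real (card Big) * (K * real m)"
    using le by (simp add: algebra_simps)
  then have "(real (card D) * (\<mu> / 32)) * real m \<le> (real (card Big) * K) * real m" by (simp add: mult_ac)
  then have "real (card D) * (\<mu> / 32) \<le> real (card Big) * K" using m0 by simp
  moreover have "\<mu> / 2 * real m * (\<mu> / 32) \<le> real (card D) * (\<mu> / 32)" using cD \<mu> by (intro mult_right_mono) auto
  moreover have "\<mu> / 2 * real m * (\<mu> / 32) = \<mu>\<^sup>2 * real m / 64" by (simp add: power2_eq_square)
  moreover have "128 * K \<le> \<mu>\<^sup>2 * real m"
  proof -
    have "128 * K \<le> 10 ^ 7 * K" using K by simp
    also have "10 ^ 7 * K \<le> \<mu> ^ 6 * real m" using m_big \<mu>7 by (simp add: field_simps)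
    also have "\<dots> \<le> \<mu>\<^sup>2 * real m" using \<mu>7 by (intro mult_right_mono) auto
    finally show ?thesis .
  qed
  ultimately have "2 * K \<le> real (card Big) * K" using K by linarith
  then have "2 \<le> card Big" using K by simp
  then obtain B2 B3 where B23: "B2 \<in> Big" "B3 \<in> Big" "B2 \<noteq> B3"
    by (metis card_2_iff' ex_card subset_iff)
  obtain S2 S3 where b23: "broken S2 B2" "broken S3 B3" using B23 by (auto simp: Big_def)
  have ne: "S2 \<noteq> S3" using broken_unique[OF b23] B23 by auto
  have h: "\<mu> / 32 * real m \<le> card (B2 \<inter> S2)" "\<mu> / 32 * real m \<le> card (B3 \<inter> S3)"
    using B23 the[OF b23(1)] the[OF b23(2)] by (auto simp: Big_def)
  show False
  proof (cases "card (B3 \<inter> S3) \<le> card (B2 \<inter> S2)")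
    case True
    then show False using no_two_broken[OF b23 ne max[OF b23(1)] max[OF b23(2)] _ h] max m_big mU by blast
  next
    case False
    then show False using no_two_broken[OF b23(2,1) ne[symmetric] max[OF b23(2)] max[OF b23(1)] _ h(2,1)] max m_big mU by simp
  qed
qed

text \<open>The converse, needed to trust a large block. Without its fewer than \<open>K\<close>
  foreign vertices it still shows that the cluster is large enough to be a block, and blocks that
  meet coincide.\<close>

lemma large_block_is_cluster:
  assumes B: "B \<in> P" and big: "2 * (16 * 10 ^ 7 * K / \<mu> ^ 7) \<le> card B"
  shows "B \<in> Cl"
proof -
  let ?L = "16 * 10 ^ 7 * K / \<mu> ^ 7"
  have "8 * K / \<mu> \<le> 8 * K / \<mu> ^ 7"
    using \<mu> K power_decreasing[of 1 7 \<mu>] by (intro divide_left_mono) auto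
  moreover have "8 * K \<le> 8 * K / \<mu>" using H_ge by (simp add: H_def)
  ultimately have L: "H + K \<le> ?L" "K \<le> ?L" using K by (auto simp: H_def)
  then obtain S where S: "S \<in> Cl" "H \<le> card (B \<inter> S)" using big_block_heavy[OF B] big K by auto
  have "real (card (B - S)) < K" using S B H_ge K by (intro remainder_small) auto
  then have "?L \<le> card (B \<inter> S)" using card_split[OF block_sub[OF B], of S] big L by linarith
  moreover have "card (B \<inter> S) \<le> card S" using fin_sub[OF cluster_sub[OF S(1)]] by (intro card_mono) auto
  ultimately have "S \<in> P" using large_cluster_is_block[OF S(1)] by linarith
  moreover have "B \<inter> S \<noteq> {}" using S H_ge K by auto
  ultimately have "B = S" using block_disj B by blast
  then show ?thesis using S by simp
qed

end

section \<open>Concentration of convex functions of independent signs\<close>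

definition sign_pmf :: "real \<Rightarrow> int pmf" where
  "sign_pmf q = map_pmf (\<lambda>b. if b then 1 else -1) (bernoulli_pmf q)"

lemma set_sign_pmf: "set_pmf (sign_pmf q) \<subseteq> {-1, 1}"
  by (auto simp: sign_pmf_def)

lemma finite_Pi_sign: "finite I \<Longrightarrow> finite (set_pmf (Pi_pmf I 0 (\<lambda>_. sign_pmf q)))"
  by (rule finite_subset[OF set_Pi_pmf_subset'])
     (auto intro!: finite_PiE_dflt finite_subset[OF set_sign_pmf])

lemma expectation_Pi_sign_insert:
  fixes f :: "('i \<Rightarrow> int) \<Rightarrow> real"
  assumes "finite I" "j \<notin> I" "0 \<le> q" "q \<le> 1"
  shows "measure_pmf.expectation (Pi_pmf (insert j I) 0 (\<lambda>_. sign_pmf q)) f =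
    measure_pmf.expectation (Pi_pmf I 0 (\<lambda>_. sign_pmf q)) (\<lambda>x. q * f (x(j := 1)) + (1 - q) * f (x(j := -1)))"
proof -
  let ?I = "Pi_pmf I 0 (\<lambda>_. sign_pmf q)"
  have fin: "finite (set_pmf ?I)" by (rule finite_Pi_sign) fact
  have int: "integrable (measure_pmf ?I) g" for g :: "('i \<Rightarrow> int) \<Rightarrow> real"
    by (rule integrable_measure_pmf_finite[OF fin])
  have "Pi_pmf (insert j I) 0 (\<lambda>_. sign_pmf q) =
     bind_pmf (bernoulli_pmf q) (\<lambda>b. map_pmf (\<lambda>x. x(j := if b then 1 else -1)) ?I)"
    using assms by (simp add: Pi_pmf_insert' sign_pmf_def map_pmf_def bind_assoc_pmf bind_return_pmf)
  then have "measure_pmf.expectation (Pi_pmf (insert j I) 0 (\<lambda>_. sign_pmf q)) f =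
      measure_pmf.expectation (bind_pmf (bernoulli_pmf q) (\<lambda>b. map_pmf (\<lambda>x. x(j := if b then 1 else -1)) ?I)) f"
    by simp
  also have "\<dots> = measure_pmf.expectation (bernoulli_pmf q)
      (\<lambda>b. measure_pmf.expectation (map_pmf (\<lambda>x. x(j := if b then 1 else -1)) ?I) f)"
    using fin by (subst pmf_expectation_bind[where A = UNIV]) (auto simp: integral_measure_pmf[where A = UNIV])
  also have "\<dots> = q * measure_pmf.expectation ?I (\<lambda>x. f (x(j := 1)))
      + (1 - q) * measure_pmf.expectation ?I (\<lambda>x. f (x(j := -1)))"
    using assms by (simp add: integral_map_pmf)
  also have "\<dots> = measure_pmf.expectation ?I (\<lambda>x. q * f (x(j := 1)) + (1 - q) * f (x(j := -1)))"
    using int by simp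
  finally show ?thesis .
qed

text \<open>Convexity of a function on \<open>'i \<Rightarrow> real\<close>, which is not a \<open>real_vector\<close> type.\<close>

definition cvx :: "(('i \<Rightarrow> real) \<Rightarrow> real) \<Rightarrow> bool" where
  "cvx f \<longleftrightarrow> (\<forall>x y t. 0 \<le> t \<longrightarrow> t \<le> 1 \<longrightarrow> f (\<lambda>i. t * x i + (1 - t) * y i) \<le> t * f x + (1 - t) * f y)"

lemma cvxD: "cvx f \<Longrightarrow> 0 \<le> t \<Longrightarrow> t \<le> 1 \<Longrightarrow> f (\<lambda>i. t * x i + (1 - t) * y i) \<le> t * f x + (1 - t) * f y"
  by (simp add: cvx_def)

section \<open>Exponential means over one sign and the two-point inequality\<close>

lemma exp_convex:
  fixes a b t :: real
  assumes "0 \<le> t" "t \<le> 1"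
  shows "exp (t * a + (1 - t) * b) \<le> t * exp a + (1 - t) * exp b"
  using convex_onD[OF convex_on_exp[of 1], of t b a] assms by (simp add: algebra_simps)

text \<open>The exponential mean over one sign, brought back to the exponent. With it, integrating
  out a coordinate leads from exponentials of convex functions to exponentials of convex
  functions.\<close>

definition lse :: "real \<Rightarrow> real \<Rightarrow> real \<Rightarrow> real" where
  "lse q a b = ln (q * exp a + (1 - q) * exp b)"

lemma lse_pos: "0 \<le> q \<Longrightarrow> q \<le> 1 \<Longrightarrow> 0 < q * exp a + (1 - q) * exp (b :: real)"
  by (cases "q = 0") (auto intro!: add_pos_nonneg)

lemma exp_lse: "0 \<le> q \<Longrightarrow> q \<le> 1 \<Longrightarrow> exp (lse q a b) = q * exp a + (1 - q) * exp b"
  unfolding lse_def using lse_pos by (simp add: exp_ln)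

lemma lse_mono: "0 \<le> q \<Longrightarrow> q \<le> 1 \<Longrightarrow> a \<le> a' \<Longrightarrow> b \<le> b' \<Longrightarrow> lse q a b \<le> lse q a' b'"
  unfolding lse_def using lse_pos by (intro ln_mono add_mono mult_left_mono) auto

lemma lse_add: "0 \<le> q \<Longrightarrow> q \<le> 1 \<Longrightarrow> lse q (a + c) (b + c) = lse q a b + c"
proof -
  assume q: "0 \<le> q" "q \<le> 1"
  have "q * exp (a + c) + (1 - q) * exp (b + c) = (q * exp a + (1 - q) * exp b) * exp c"
    by (simp add: exp_add algebra_simps)
  then show ?thesis unfolding lse_def using lse_pos[OF q, of a b] by (simp add: ln_mult_pos)
qed

text \<open>Shifting by the two \<open>lse\<close> values normalizes both exponential means to
  \<open>1\<close>; then convexity of \<open>exp\<close> suffices.\<close>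

lemma lse_convex:
  assumes q: "0 \<le> q" "q \<le> 1" and t: "0 \<le> t" "t \<le> 1"
  shows "lse q (t * a + (1 - t) * a') (t * b + (1 - t) * b') \<le> t * lse q a b + (1 - t) * lse q a' b'"
proof -
  let ?A = "lse q a b" and ?A' = "lse q a' b'"
  let ?c = "t * ?A + (1 - t) * ?A'"
  have "q * exp (t * (a - ?A) + (1 - t) * (a' - ?A')) + (1 - q) * exp (t * (b - ?A) + (1 - t) * (b' - ?A'))
     \<le> q * (t * exp (a - ?A) + (1 - t) * exp (a' - ?A')) + (1 - q) * (t * exp (b - ?A) + (1 - t) * exp (b' - ?A'))"
    using q t by (intro add_mono mult_left_mono exp_convex) auto
  also have "\<dots> = t * exp (lse q (a - ?A) (b - ?A)) + (1 - t) * exp (lse q (a' - ?A') (b' - ?A'))"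
    using q by (simp add: exp_lse algebra_simps)
  also have "lse q (a - ?A) (b - ?A) = 0" using lse_add[OF q, of a "- ?A" b] by simp
  also have "lse q (a' - ?A') (b' - ?A') = 0" using lse_add[OF q, of a' "- ?A'" b'] by simp
  finally have "exp (lse q (t * (a - ?A) + (1 - t) * (a' - ?A')) (t * (b - ?A) + (1 - t) * (b' - ?A'))) \<le> 1"
    using q by (simp add: exp_lse)
  then have "lse q (t * (a - ?A) + (1 - t) * (a' - ?A')) (t * (b - ?A) + (1 - t) * (b' - ?A')) \<le> 0"
    by simp
  moreover have "t * (a - ?A) + (1 - t) * (a' - ?A') = (t * a + (1 - t) * a') + (- ?c)"
    "t * (b - ?A) + (1 - t) * (b' - ?A') = (t * b + (1 - t) * b') + (- ?c)" by (simp_all add: algebra_simps)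
  ultimately show ?thesis using lse_add[OF q, of "t * a + (1 - t) * a'" "- ?c" "t * b + (1 - t) * b'"] by simp
qed

text \<open>Hoeffding's lemma for a fair sign.\<close>

lemma cosh_le_exp_square: "cosh (y :: real) \<le> exp (y\<^sup>2 / 2)"
proof -
  have pos: "cosh y \<le> exp (y\<^sup>2 / 2)" if "0 \<le> y" for y :: real
  proof -
    have "- (2 * y) * (1 / 2) + ln (1 + 1 / 2 * (exp (2 * y) - 1)) \<le> (2 * y)\<^sup>2 / 8"
      by (rule Hoeffdings_lemma_aux) (use that in auto)
    moreover have "1 + 1 / 2 * (exp (2 * y) - 1) = exp y * cosh y"
      by (simp add: cosh_def field_simps flip: exp_add)
    ultimately have "ln (cosh y) \<le> y\<^sup>2 / 2" by (simp add: ln_mult_pos cosh_real_pos)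
    then have "exp (ln (cosh y)) \<le> exp (y\<^sup>2 / 2)" by (simp only: exp_le_cancel_iff)
    then show ?thesis by (simp add: cosh_real_pos)
  qed
  show ?thesis using pos[of y] pos[of "-y"] by (cases "0 \<le> y") auto
qed

text \<open>Here the smaller of two values is normalized to \<open>0\<close>, the larger is
  \<open>\<delta>\<close>, and \<open>r\<close> is the infimal convolution at the point of the
  larger one. After expansion only the mixed term \<open>exp r + exp (- \<delta>)\<close> is
  delicate, and it is free of \<open>q\<close>.\<close>

lemma two_point_aux:
  fixes \<delta> q r :: real
  assumes "0 \<le> \<delta>" and q: "0 \<le> q" "q \<le> 1" and A: "\<And>t. 0 \<le> t \<Longrightarrow> t \<le> 1 \<Longrightarrow> r \<le> \<delta> - t * \<delta> + t\<^sup>2 / 4"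
  shows "(q * exp r + (1 - q)) * (q * exp (- \<delta>) + (1 - q)) \<le> 1"
proof -
  have r0: "r - \<delta> \<le> 0" using A[of 0] by simp
  have cross: "exp r + exp (- \<delta>) \<le> 2"
  \<comment> \<open>The bound on \<open>r\<close> is smallest at \<open>t = 2 * \<delta>\<close>, or
    at \<open>t = 1\<close> if this exceeds \<open>1\<close>.\<close>
  proof (cases "\<delta> \<le> 1 / 2")
    case True
    have "r \<le> \<delta> - \<delta>\<^sup>2" using A[of "2 * \<delta>"] True assms by (simp add: power2_eq_square)
    then have "exp r + exp (- \<delta>) \<le> exp (\<delta> - \<delta>\<^sup>2) + exp (- \<delta>)" by simp
    also have "\<dots> = 2 * (exp (- \<delta>\<^sup>2 / 2) * cosh (\<delta> - \<delta>\<^sup>2 / 2))"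
      by (simp add: cosh_def field_simps flip: exp_add)
    also have "\<dots> \<le> 2 * (exp (- \<delta>\<^sup>2 / 2) * exp ((\<delta> - \<delta>\<^sup>2 / 2)\<^sup>2 / 2))"
      by (intro mult_left_mono cosh_le_exp_square) auto
    also have "\<dots> = 2 * exp (((\<delta> - \<delta>\<^sup>2 / 2)\<^sup>2 - \<delta>\<^sup>2) / 2)"
      by (simp add: field_simps flip: exp_add)
    also have "(\<delta> - \<delta>\<^sup>2 / 2)\<^sup>2 \<le> \<delta>\<^sup>2"
    proof (rule power_mono)
      have "\<delta>\<^sup>2 \<le> 1 * \<delta>" unfolding power2_eq_square using True assms by (intro mult_right_mono) auto
      then show "0 \<le> \<delta> - \<delta>\<^sup>2 / 2" using assms by linarith
    qed simp
    then have "2 * exp (((\<delta> - \<delta>\<^sup>2 / 2)\<^sup>2 - \<delta>\<^sup>2) / 2) \<le> 2" by simp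
    finally show ?thesis .
  next
    case False
    have "r \<le> 1 / 4" using A[of 1] by simp
    then have "exp r \<le> exp (1 / 4)" by simp
    also have "\<dots> \<le> 1 + 1 / 4 + (1 / 4)\<^sup>2" by (rule exp_bound) auto
    finally have 1: "exp r \<le> 21 / 16" by (simp add: power2_eq_square)
    have "exp (- \<delta>) \<le> exp (- (1 / 2))" using False by simp
    also have "\<dots> = 1 / exp (1 / 2)" by (simp add: exp_minus inverse_eq_divide)
    also have "\<dots> \<le> 1 / (1 + 1 / 2)" using exp_ge_add_one_self[of "1 / 2 :: real"] by (intro divide_left_mono) auto
    finally show ?thesis using 1 by simp
  qed
  have "(q * exp r + (1 - q)) * (q * exp (- \<delta>) + (1 - q)) =
      q\<^sup>2 * exp (r - \<delta>) + q * (1 - q) * (exp r + exp (- \<delta>)) + (1 - q)\<^sup>2"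
    by (simp add: power2_eq_square algebra_simps exp_diff exp_minus field_simps)
  also have "\<dots> \<le> q\<^sup>2 * 1 + q * (1 - q) * 2 + (1 - q)\<^sup>2"
    using q r0 cross by (intro add_mono mult_left_mono order_refl) auto
  also have "\<dots> = 1" by (simp add: power2_eq_square algebra_simps)
  finally show ?thesis .
qed

text \<open>Property (tau) for one sign: \<open>u\<close> and \<open>v\<close> are the values of a
  convex function at \<open>1\<close> and \<open>-1\<close>, \<open>a\<close> and \<open>b\<close>
  those of its infimal convolution. Going a fraction \<open>t\<close> of the way to the other sign
  covers a distance \<open>2 * t\<close> and costs \<open>(2 * t)\<^sup>2 / 16\<close>.\<close>

lemma two_point:
  fixes u v a b q :: real
  assumes q: "0 \<le> q" "q \<le> 1"
    and a: "\<And>t. 0 \<le> t \<Longrightarrow> t \<le> 1 \<Longrightarrow> a \<le> (1 - t) * u + t * v + t\<^sup>2 / 4"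
    and b: "\<And>t. 0 \<le> t \<Longrightarrow> t \<le> 1 \<Longrightarrow> b \<le> (1 - t) * v + t * u + t\<^sup>2 / 4"
  shows "(q * exp a + (1 - q) * exp b) * (q * exp (- u) + (1 - q) * exp (- v)) \<le> 1"
proof (cases "v \<le> u")
  case True
  have "b \<le> v" using b[of 0] by simp
  have "(q * exp a + (1 - q) * exp b) * (q * exp (- u) + (1 - q) * exp (- v))
     \<le> (q * exp a + (1 - q) * exp v) * (q * exp (- u) + (1 - q) * exp (- v))"
    using q \<open>b \<le> v\<close> by (intro mult_right_mono add_mono mult_left_mono) auto
  also have "\<dots> = (q * exp (a - v) + (1 - q)) * (q * exp (- (u - v)) + (1 - q))"
    by (simp add: exp_diff exp_minus field_simps)
  also have "\<dots> \<le> 1"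
  proof (rule two_point_aux)
    fix t :: real assume "0 \<le> t" "t \<le> 1"
    then show "a - v \<le> u - v - t * (u - v) + t\<^sup>2 / 4" using a[of t] by (simp add: algebra_simps)
  qed (use True q in auto)
  finally show ?thesis .
next
  case False
  have "a \<le> u" using a[of 0] by simp
  have "(q * exp a + (1 - q) * exp b) * (q * exp (- u) + (1 - q) * exp (- v))
     \<le> (q * exp u + (1 - q) * exp b) * (q * exp (- u) + (1 - q) * exp (- v))"
    using q \<open>a \<le> u\<close> by (intro mult_right_mono add_mono mult_left_mono) auto
  also have "\<dots> = ((1 - q) * exp (b - u) + (1 - (1 - q))) * ((1 - q) * exp (- (v - u)) + (1 - (1 - q)))"
    by (simp add: exp_diff exp_minus field_simps)
  also have "\<dots> \<le> 1"
  proof (rule two_point_aux)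
    fix t :: real assume "0 \<le> t" "t \<le> 1"
    then show "b - u \<le> v - u - t * (v - u) + t\<^sup>2 / 4" using b[of t] by (simp add: algebra_simps)
  qed (use False q in auto)
  finally show ?thesis .
qed

text \<open>\<open>y\<close> runs through the whole interval rather than the two signs: the
  two-point inequality needs arbitrarily short moves, whose effect convexity controls.\<close>

definition infconv :: "'i \<Rightarrow> real \<Rightarrow> (('i \<Rightarrow> real) \<Rightarrow> real) \<Rightarrow> ('i \<Rightarrow> real) \<Rightarrow> real" where
  "infconv j s f x = (INF y\<in>{-1..1}. f (x(j := y)) + (s - y)\<^sup>2 / 16)"

text \<open>A value at \<open>y\<close> far below the value at the centre would force the value at
  \<open>- y\<close> above what the endpoints allow.\<close>

lemma cvx_bdd_below:
  assumes "cvx f"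
  shows "bdd_below ((\<lambda>y. f (x(j := y)) + (s - y)\<^sup>2 / 16) ` {-1..1 :: real})"
proof (rule bdd_belowI2)
  fix y :: real assume y: "y \<in> {-1..1}"
  have e0: "(\<lambda>i. 1 / 2 * (x(j := y)) i + (1 - 1 / 2) * (x(j := - y)) i) = x(j := 0)" by (auto simp: fun_eq_iff)
  have 1: "f (x(j := 0)) \<le> 1 / 2 * f (x(j := y)) + 1 / 2 * f (x(j := - y))"
    using cvxD[OF assms, of "1 / 2" "x(j := y)" "x(j := - y)"] unfolding e0 by simp
  have e1: "(\<lambda>i. ((1 - y) / 2) * (x(j := 1)) i + (1 - (1 - y) / 2) * (x(j := -1)) i) = x(j := - y)"
    by (auto simp: fun_eq_iff field_simps)
  have "f (x(j := - y)) \<le> ((1 - y) / 2) * f (x(j := 1)) + (1 - (1 - y) / 2) * f (x(j := -1))"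
    using cvxD[OF assms, of "(1 - y) / 2" "x(j := 1)" "x(j := -1)"] y unfolding e1 by auto
  also have "\<dots> \<le> ((1 - y) / 2) * \<bar>f (x(j := 1))\<bar> + (1 - (1 - y) / 2) * \<bar>f (x(j := -1))\<bar>"
    using y by (intro add_mono mult_left_mono) auto
  also have "\<dots> \<le> 1 * \<bar>f (x(j := 1))\<bar> + 1 * \<bar>f (x(j := -1))\<bar>"
    using y by (intro add_mono mult_right_mono) auto
  finally have "2 * f (x(j := 0)) - \<bar>f (x(j := 1))\<bar> - \<bar>f (x(j := -1))\<bar> \<le> f (x(j := y))" using 1 by simp
  then show "2 * f (x(j := 0)) - \<bar>f (x(j := 1))\<bar> - \<bar>f (x(j := -1))\<bar> \<le> f (x(j := y)) + (s - y)\<^sup>2 / 16"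
    by (simp add: add_increasing2)
qed

lemma infconv_le:
  assumes "cvx f" "y \<in> {-1..1}"
  shows "infconv j s f x \<le> f (x(j := y)) + (s - y)\<^sup>2 / 16"
  unfolding infconv_def using cvx_bdd_below[OF assms(1)] assms(2) by (rule cINF_lower)

lemma le_infconv:
  assumes "\<And>y. y \<in> {-1..1} \<Longrightarrow> c \<le> f (x(j := y)) + (s - y)\<^sup>2 / 16"
  shows "c \<le> infconv j s f x"
  unfolding infconv_def using assms by (intro cINF_greatest) auto

text \<open>Partial minimization preserves joint convexity. No minimizer is used; the infima for
  \<open>x\<close> and for \<open>x'\<close> are taken one after the other, and the endpoints of
  \<open>t\<close> are treated apart to allow division.\<close>

lemma cvx_infconv:
  assumes f: "cvx f"
  shows "cvx (infconv j s f)"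
  unfolding cvx_def
proof (intro allI impI)
  fix x x' :: "'a \<Rightarrow> real" and t :: real assume t: "0 \<le> t" "t \<le> 1"
  let ?z = "\<lambda>i. t * x i + (1 - t) * x' i"
  have step: "infconv j s f ?z \<le> t * (f (x(j := y)) + (s - y)\<^sup>2 / 16) + (1 - t) * (f (x'(j := y')) + (s - y')\<^sup>2 / 16)"
    if y: "y \<in> {-1..1}" "y' \<in> {-1..1}" for y y'
  proof -
    let ?y = "t * y + (1 - t) * y'"
    have "?y \<in> {-1..1}" using convexD_alt[OF convex_real_interval(5)[of "-1" 1], of y' y t] y t
      by (simp add: algebra_simps)
    then have A: "infconv j s f ?z \<le> f (?z(j := ?y)) + (s - ?y)\<^sup>2 / 16" by (rule infconv_le[OF f])
    have e: "?z(j := ?y) = (\<lambda>i. t * (x(j := y)) i + (1 - t) * (x'(j := y')) i)" by auto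
    have B: "f (\<lambda>i. t * (x(j := y)) i + (1 - t) * (x'(j := y')) i) \<le> t * f (x(j := y)) + (1 - t) * f (x'(j := y'))"
      using cvxD[OF f t] .
    have C: "(s - ?y)\<^sup>2 \<le> t * (s - y)\<^sup>2 + (1 - t) * (s - y')\<^sup>2"
    proof -
      have "t * (s - y)\<^sup>2 + (1 - t) * (s - y')\<^sup>2 - (s - ?y)\<^sup>2 = t * (1 - t) * (y - y')\<^sup>2"
        by (simp add: power2_eq_square algebra_simps)
      moreover have "0 \<le> t * (1 - t) * (y - y')\<^sup>2" using t by simp
      ultimately show ?thesis by linarith
    qed
    have "infconv j s f ?z \<le> t * f (x(j := y)) + (1 - t) * f (x'(j := y')) + (t * (s - y)\<^sup>2 + (1 - t) * (s - y')\<^sup>2) / 16"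
      by (rule order_trans[OF A[unfolded e] add_mono[OF B divide_right_mono[OF C zero_le_numeral]]])
    also have "\<dots> = t * (f (x(j := y)) + (s - y)\<^sup>2 / 16) + (1 - t) * (f (x'(j := y')) + (s - y')\<^sup>2 / 16)"
      by (simp add: distrib_left add_divide_distrib del: fun_upd_apply)
    finally show ?thesis .
  qed
  show "infconv j s f ?z \<le> t * infconv j s f x + (1 - t) * infconv j s f x'"
  proof -
    have 1: "infconv j s f ?z - (1 - t) * (f (x'(j := y')) + (s - y')\<^sup>2 / 16) \<le> t * infconv j s f x"
      if y': "y' \<in> {-1..1}" for y'
    proof (cases "t = 0")
      case True
      then show ?thesis using step[of 0 y'] y' by simp
    next
      case False
      then have "(infconv j s f ?z - (1 - t) * (f (x'(j := y')) + (s - y')\<^sup>2 / 16)) / t \<le> infconv j s f x"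
        using step y' t by (intro le_infconv) (simp add: field_simps)
      then show ?thesis using False t by (simp add: field_simps)
    qed
    show ?thesis
    proof (cases "t = 1")
      case True
      then show ?thesis using 1[of 0] by simp
    next
      case False
      then have "(infconv j s f ?z - t * infconv j s f x) / (1 - t) \<le> infconv j s f x'"
        using 1 t by (intro le_infconv) (simp add: field_simps)
      then show ?thesis using False t by (simp add: field_simps)
    qed
  qed
qed

text \<open>Maurey's property (tau) for signs, with the infimal convolution of \<open>f\<close> replaced by an arbitrary
  minorant \<open>g\<close>.\<close>

lemma property_tau:
  fixes f g :: "('i \<Rightarrow> real) \<Rightarrow> real"
  assumes "finite I" and q: "0 \<le> q" "q \<le> 1" and "cvx f"
    and "\<And>x y. (\<And>i. i \<notin> I \<Longrightarrow> x i = y i) \<Longrightarrow> g x \<le> f y + (\<Sum>i\<in>I. (x i - y i)\<^sup>2) / 16"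
  shows "measure_pmf.expectation (Pi_pmf I 0 (\<lambda>_. sign_pmf q)) (\<lambda>x. exp (g (\<lambda>i. real_of_int (x i))))
    * measure_pmf.expectation (Pi_pmf I 0 (\<lambda>_. sign_pmf q)) (\<lambda>x. exp (- f (\<lambda>i. real_of_int (x i)))) \<le> 1"
  using assms(1,4,5)
proof (induction I arbitrary: f g rule: finite_induct)
  case empty
  then have "g (\<lambda>_. 0) \<le> f (\<lambda>_. 0)" by (metis add_0_right div_0 sum.empty)
  then show ?case by (simp flip: exp_add)
next
  case (insert j I)
  let ?E = "\<lambda>h :: ('i \<Rightarrow> int) \<Rightarrow> real. measure_pmf.expectation (Pi_pmf I 0 (\<lambda>_. sign_pmf q)) h"
  let ?r = "\<lambda>x :: 'i \<Rightarrow> int. \<lambda>i. real_of_int (x i)"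
  have fin: "finite (set_pmf (Pi_pmf I 0 (\<lambda>_. sign_pmf q)))" by (rule finite_Pi_sign) fact
  have int: "integrable (measure_pmf (Pi_pmf I 0 (\<lambda>_. sign_pmf q))) h" for h :: "('i \<Rightarrow> int) \<Rightarrow> real"
    by (rule integrable_measure_pmf_finite[OF fin])
  \<comment> \<open>Coordinate \<open>j\<close> is integrated out on both sides, on the side of
    \<open>f\<close> after the infimal convolution in \<open>j\<close>. The induction hypothesis is
    applied to \<open>\<psi>\<close> and \<open>G\<close>.\<close>
  define \<psi> where "\<psi> x = lse q (infconv j 1 f x) (infconv j (-1) f x)" for x
  define G where "G x = lse q (g (x(j := 1))) (g (x(j := -1)))" for x
  have "cvx \<psi>"
    unfolding cvx_def
  proof (intro allI impI)
    fix x y :: "'i \<Rightarrow> real" and t :: real assume t: "0 \<le> t" "t \<le> 1"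
    have "\<psi> (\<lambda>i. t * x i + (1 - t) * y i)
      \<le> lse q (t * infconv j 1 f x + (1 - t) * infconv j 1 f y) (t * infconv j (-1) f x + (1 - t) * infconv j (-1) f y)"
      unfolding \<psi>_def using q t by (intro lse_mono cvxD cvx_infconv insert) auto
    also have "\<dots> \<le> t * \<psi> x + (1 - t) * \<psi> y" unfolding \<psi>_def using q t by (rule lse_convex)
    finally show "\<psi> (\<lambda>i. t * x i + (1 - t) * y i) \<le> t * \<psi> x + (1 - t) * \<psi> y" .
  qed
  moreover have "G x \<le> \<psi> y + (\<Sum>i\<in>I. (x i - y i)\<^sup>2) / 16" if xy: "\<And>i. i \<notin> I \<Longrightarrow> x i = y i" for x y
  proof -
    have "g (x(j := s)) - (\<Sum>i\<in>I. (x i - y i)\<^sup>2) / 16 \<le> infconv j s f y" for s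
    proof (rule le_infconv)
      fix z :: real
      have "g (x(j := s)) \<le> f (y(j := z)) + (\<Sum>i\<in>insert j I. ((x(j := s)) i - (y(j := z)) i)\<^sup>2) / 16"
        using xy by (intro insert.prems(2)) auto
      also have "(\<Sum>i\<in>insert j I. ((x(j := s)) i - (y(j := z)) i)\<^sup>2) = (s - z)\<^sup>2 + (\<Sum>i\<in>I. (x i - y i)\<^sup>2)"
        using insert.hyps by (subst sum.insert) (auto intro!: sum.cong)
      finally show "g (x(j := s)) - (\<Sum>i\<in>I. (x i - y i)\<^sup>2) / 16 \<le> f (y(j := z)) + (s - z)\<^sup>2 / 16"
        by argo
    qed
    then have "G x \<le> lse q (infconv j 1 f y + (\<Sum>i\<in>I. (x i - y i)\<^sup>2) / 16) (infconv j (-1) f y + (\<Sum>i\<in>I. (x i - y i)\<^sup>2) / 16)"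
      unfolding G_def using q by (intro lse_mono) (auto simp: algebra_simps)
    also have "\<dots> = \<psi> y + (\<Sum>i\<in>I. (x i - y i)\<^sup>2) / 16" unfolding \<psi>_def using q by (rule lse_add)
    finally show ?thesis .
  qed
  ultimately have IH: "?E (\<lambda>x. exp (G (?r x))) * ?E (\<lambda>x. exp (- \<psi> (?r x))) \<le> 1"
    by (rule insert.IH)
  have upd: "?r (x(j := s)) = (?r x)(j := real_of_int s)" for x s by auto
  have 1: "measure_pmf.expectation (Pi_pmf (insert j I) 0 (\<lambda>_. sign_pmf q)) (\<lambda>x. exp (g (?r x))) = ?E (\<lambda>x. exp (G (?r x)))"
    unfolding expectation_Pi_sign_insert[OF insert.hyps q, of "\<lambda>x. exp (g (?r x))"] upd G_def exp_lse[OF q] by simp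
  have "measure_pmf.expectation (Pi_pmf (insert j I) 0 (\<lambda>_. sign_pmf q)) (\<lambda>x. exp (- f (?r x))) =
     ?E (\<lambda>x. q * exp (- f ((?r x)(j := 1))) + (1 - q) * exp (- f ((?r x)(j := -1))))"
    unfolding expectation_Pi_sign_insert[OF insert.hyps q, of "\<lambda>x. exp (- f (?r x))"] upd by simp
  also have "\<dots> \<le> ?E (\<lambda>x. exp (- \<psi> (?r x)))"
  proof (rule integral_mono[OF int int])
    fix x
    let ?x = "?r x"
    \<comment> \<open>Candidate: the point at the fraction \<open>t\<close> of the way from
      \<open>s\<close> to \<open>- s\<close>.\<close>
    have c: "infconv j s f ?x \<le> (1 - t) * f (?x(j := s)) + t * f (?x(j := - s)) + t\<^sup>2 / 4"
      if t: "0 \<le> t" "t \<le> 1" and s: "s = 1 \<or> s = -1" for t s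
    proof -
      let ?y = "(1 - t) * s + t * (- s)"
      have "?y \<in> {-1..1}" using t s by auto
      then have "infconv j s f ?x \<le> f (?x(j := ?y)) + (s - ?y)\<^sup>2 / 16" by (rule infconv_le[OF insert.prems(1)])
      also have "?x(j := ?y) = (\<lambda>i. (1 - t) * (?x(j := s)) i + (1 - (1 - t)) * (?x(j := - s)) i)"
        by (auto simp: fun_eq_iff algebra_simps)
      also have "(s - ?y)\<^sup>2 / 16 = t\<^sup>2 / 4" using s by (auto simp: power2_eq_square algebra_simps)
      finally have "infconv j s f ?x \<le> f (\<lambda>i. (1 - t) * (?x(j := s)) i + (1 - (1 - t)) * (?x(j := - s)) i) + t\<^sup>2 / 4" .
      moreover have "f (\<lambda>i. (1 - t) * (?x(j := s)) i + (1 - (1 - t)) * (?x(j := - s)) i)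
          \<le> (1 - t) * f (?x(j := s)) + (1 - (1 - t)) * f (?x(j := - s))"
        using t by (intro cvxD insert.prems(1)) auto
      ultimately show ?thesis by (simp del: fun_upd_apply)
    qed
    have "exp (\<psi> ?x) * (q * exp (- f (?x(j := 1))) + (1 - q) * exp (- f (?x(j := -1)))) \<le> 1"
      unfolding \<psi>_def exp_lse[OF q]
    proof (rule two_point[OF q])
      fix t :: real assume t: "0 \<le> t" "t \<le> 1"
      show "infconv j 1 f ?x \<le> (1 - t) * f (?x(j := 1)) + t * f (?x(j := -1)) + t\<^sup>2 / 4"
        using c[OF t, of 1] by simp
      show "infconv j (-1) f ?x \<le> (1 - t) * f (?x(j := -1)) + t * f (?x(j := 1)) + t\<^sup>2 / 4"
        using c[OF t, of "-1"] by simp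
    qed
    then show "q * exp (- f (?x(j := 1))) + (1 - q) * exp (- f (?x(j := -1))) \<le> exp (- \<psi> ?x)"
      by (simp add: exp_minus field_simps)
  qed
  finally have 2: "measure_pmf.expectation (Pi_pmf (insert j I) 0 (\<lambda>_. sign_pmf q)) (\<lambda>x. exp (- f (?r x)))
     \<le> ?E (\<lambda>x. exp (- \<psi> (?r x)))" .
  have "0 \<le> ?E (\<lambda>x. exp (G (?r x)))" by (intro Bochner_Integration.integral_nonneg) auto
  then show ?case using mult_left_mono[OF 2] IH unfolding 1 by (meson order_trans)
qed

text \<open>A maximum of sums over at most \<open>N\<close> coordinates each concentrates at scale \<open>sqrt N\<close>,
  no matter how many coordinates and sums there are.\<close>

theorem max_of_sums_concentration:
  fixes c :: "'t \<Rightarrow> real" and T :: "'t \<Rightarrow> 'i set" and N t :: real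
  assumes I: "finite I" and q: "0 \<le> q" "q \<le> 1" and TT: "finite TT" "TT \<noteq> {}"
    and sub: "\<And>\<theta>. \<theta> \<in> TT \<Longrightarrow> T \<theta> \<subseteq> I" and card: "\<And>\<theta>. \<theta> \<in> TT \<Longrightarrow> real (card (T \<theta>)) \<le> N"
    and N: "N > 0" and t: "t > 0"
  defines "F \<equiv> \<lambda>x :: 'i \<Rightarrow> int. Max ((\<lambda>\<theta>. c \<theta> + (\<Sum>i\<in>T \<theta>. real_of_int (x i))) ` TT)"
  defines "m \<equiv> ln (measure_pmf.expectation (Pi_pmf I 0 (\<lambda>_. sign_pmf q)) (\<lambda>x. exp (t / (8 * N) * F x))) / (t / (8 * N))"
  shows "measure_pmf.prob (Pi_pmf I 0 (\<lambda>_. sign_pmf q)) {x. \<bar>F x - m\<bar> \<ge> t} \<le> 2 * exp (- t\<^sup>2 / (16 * N))"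
proof -
  let ?M = "Pi_pmf I 0 (\<lambda>_. sign_pmf q)"
  let ?r = "\<lambda>x :: 'i \<Rightarrow> int. \<lambda>i. real_of_int (x i)"
  \<comment> \<open>This \<open>l\<close> minimizes \<open>4 * l\<^sup>2 * N - l * t\<close>, the
    exponent of the lower tail. Since \<open>m\<close> is an exponential mean at the same
    \<open>l\<close>, the upper tail is plain Markov, and \<open>m\<close> depends on the law of
    \<open>F\<close> only.\<close>
  define l where "l = t / (8 * N)"
  have l: "l > 0" using N t by (simp add: l_def)
  define S where "S \<theta> x = c \<theta> + (\<Sum>i\<in>T \<theta>. x i)" for \<theta> and x :: "'i \<Rightarrow> real"
  define f where "f x = l * Max ((\<lambda>\<theta>. S \<theta> x) ` TT)" for x
  define g where "g x = f x - 4 * l\<^sup>2 * N" for x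
  have F: "l * F x = f (?r x)" for x by (simp add: F_def f_def S_def)
  have Max_ge': "S \<theta> x \<le> Max ((\<lambda>\<theta>. S \<theta> x) ` TT)" if "\<theta> \<in> TT" for \<theta> x using TT that by simp
  have Max_in': "\<exists>\<theta>\<in>TT. Max ((\<lambda>\<theta>. S \<theta> x) ` TT) = S \<theta> x" for x
  proof -
    have "Max ((\<lambda>\<theta>. S \<theta> x) ` TT) \<in> (\<lambda>\<theta>. S \<theta> x) ` TT" using TT by (intro Max_in) auto
    then show ?thesis by auto
  qed
  have "cvx f"
    unfolding cvx_def
  proof (intro allI impI)
    fix x y :: "'i \<Rightarrow> real" and s :: real assume s: "0 \<le> s" "s \<le> 1"
    let ?z = "\<lambda>i. s * x i + (1 - s) * y i"
    obtain \<theta> where \<theta>: "\<theta> \<in> TT" "Max ((\<lambda>\<theta>. S \<theta> ?z) ` TT) = S \<theta> ?z" using Max_in' by blast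
    have "S \<theta> ?z = s * S \<theta> x + (1 - s) * S \<theta> y"
    proof -
      have "(\<Sum>i\<in>T \<theta>. ?z i) = s * (\<Sum>i\<in>T \<theta>. x i) + (1 - s) * (\<Sum>i\<in>T \<theta>. y i)"
        by (simp add: sum.distrib sum_distrib_left)
      then show ?thesis by (simp add: S_def algebra_simps)
    qed
    also have "\<dots> \<le> s * Max ((\<lambda>\<theta>. S \<theta> x) ` TT) + (1 - s) * Max ((\<lambda>\<theta>. S \<theta> y) ` TT)"
      using s \<theta> Max_ge' by (intro add_mono mult_left_mono) auto
    finally have "l * S \<theta> ?z \<le> l * (s * Max ((\<lambda>\<theta>. S \<theta> x) ` TT) + (1 - s) * Max ((\<lambda>\<theta>. S \<theta> y) ` TT))"
      using l by (intro mult_left_mono) auto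
    then show "f ?z \<le> s * f x + (1 - s) * f y" unfolding f_def \<theta>(2) by (simp add: algebra_simps)
  qed
  moreover have "g x \<le> f y + (\<Sum>i\<in>I. (x i - y i)\<^sup>2) / 16" for x y
  proof -
    \<comment> \<open>Only the coordinates of one sum that is maximal at \<open>x\<close> count,
      hence \<open>N\<close> instead of the number of all coordinates.\<close>
    obtain \<theta> where \<theta>: "\<theta> \<in> TT" "Max ((\<lambda>\<theta>. S \<theta> x) ` TT) = S \<theta> x" using Max_in' by blast
    have "f x - f y \<le> l * S \<theta> x - l * S \<theta> y"
      unfolding f_def \<theta>(2) using Max_ge'[OF \<theta>(1), of y] l by simp
    also have "\<dots> = (\<Sum>i\<in>T \<theta>. l * (x i - y i))"
      by (simp add: S_def sum_subtractf algebra_simps sum_distrib_left)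
    also have "\<dots> \<le> (\<Sum>i\<in>T \<theta>. 4 * l\<^sup>2 + (x i - y i)\<^sup>2 / 16)"
    proof (rule sum_mono)
      fix i
      have "0 \<le> (2 * l - (x i - y i) / 4)\<^sup>2" by simp
      then show "l * (x i - y i) \<le> 4 * l\<^sup>2 + (x i - y i)\<^sup>2 / 16"
        by (simp add: power2_eq_square field_simps)
    qed
    also have "\<dots> = real (card (T \<theta>)) * (4 * l\<^sup>2) + (\<Sum>i\<in>T \<theta>. (x i - y i)\<^sup>2) / 16"
      by (simp add: sum.distrib sum_divide_distrib)
    also have "\<dots> \<le> N * (4 * l\<^sup>2) + (\<Sum>i\<in>I. (x i - y i)\<^sup>2) / 16"
      using card[OF \<theta>(1)] sub[OF \<theta>(1)] I by (intro add_mono mult_right_mono divide_right_mono sum_mono2) auto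
    finally show ?thesis unfolding g_def by (simp add: mult_ac)
  qed
  ultimately have tau: "measure_pmf.expectation ?M (\<lambda>x. exp (g (?r x))) * measure_pmf.expectation ?M (\<lambda>x. exp (- f (?r x))) \<le> 1"
    using property_tau[OF I q] by blast
  have fin: "finite (set_pmf ?M)" by (rule finite_Pi_sign[OF I])
  have int: "integrable (measure_pmf ?M) h" for h :: "('i \<Rightarrow> int) \<Rightarrow> real"
    by (rule integrable_measure_pmf_finite[OF fin])
  define E where "E = measure_pmf.expectation ?M (\<lambda>x. exp (l * F x))"
  define E' where "E' = measure_pmf.expectation ?M (\<lambda>x. exp (- (l * F x)))"
  have "E > 0"
  proof -
    have "E \<noteq> 0"
    proof
      assume "E = 0"
      then have "AE x in measure_pmf ?M. exp (l * F x) = 0"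
        unfolding E_def by (subst integral_nonneg_eq_0_iff_AE[symmetric]) (auto simp: int)
      then show False by (auto simp: AE_measure_pmf_iff set_pmf_not_empty)
    qed
    moreover have "E \<ge> 0" unfolding E_def by (intro Bochner_Integration.integral_nonneg) auto
    ultimately show ?thesis by linarith
  qed
  have em: "exp (l * m) = E"
    using l \<open>E > 0\<close> unfolding m_def E_def l_def[symmetric] by simp
  have E'le: "E' \<le> exp (4 * l\<^sup>2 * N) / E"
  proof -
    have "exp (- (4 * l\<^sup>2 * N)) * E * E' \<le> 1"
      using tau unfolding g_def E_def E'_def F by (simp add: exp_diff exp_minus divide_inverse mult_ac)
    then show ?thesis using \<open>E > 0\<close> by (simp add: exp_minus field_simps)
  qed
  have lt: "l * t = t\<^sup>2 / (8 * N)" "4 * l\<^sup>2 * N = t\<^sup>2 / (16 * N)"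
    using N by (simp_all add: l_def power2_eq_square field_simps)
  have markov: "measure_pmf.prob ?M {x. a \<le> h x} \<le> measure_pmf.expectation ?M (\<lambda>x. exp (h x)) / exp a" for h :: "('i \<Rightarrow> int) \<Rightarrow> real" and a
  proof -
    have "measure_pmf.prob ?M {x \<in> space (measure_pmf ?M). exp a \<le> exp (h x)} \<le> measure_pmf.expectation ?M (\<lambda>x. exp (h x)) / exp a"
      by (rule integral_Markov_inequality_measure[OF int]) auto
    then show ?thesis by simp
  qed
  have up: "measure_pmf.prob ?M {x. m + t \<le> F x} \<le> exp (- t\<^sup>2 / (16 * N))"
  proof -
    have "measure_pmf.prob ?M {x. m + t \<le> F x} = measure_pmf.prob ?M {x. l * (m + t) \<le> l * F x}" using l by simp
    also have "\<dots> \<le> E / exp (l * (m + t))" unfolding E_def by (rule markov)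
    also have "\<dots> = exp (- (l * t))" using \<open>E > 0\<close> by (simp add: distrib_left exp_add em exp_minus field_simps)
    also have "\<dots> \<le> exp (- t\<^sup>2 / (16 * N))" unfolding lt using N by (simp add: field_simps)
    finally show ?thesis .
  qed
  \<comment> \<open>Here property (tau) is essential: it bounds the negative exponential moment by
    the positive one.\<close>
  have down: "measure_pmf.prob ?M {x. F x \<le> m - t} \<le> exp (- t\<^sup>2 / (16 * N))"
  proof -
    have "{x. F x \<le> m - t} = {x. - (l * (m - t)) \<le> - (l * F x)}" using l by simp
    then have "measure_pmf.prob ?M {x. F x \<le> m - t} \<le> E' / exp (- (l * (m - t)))"
      unfolding E'_def using markov[of "- (l * (m - t))" "\<lambda>x. - (l * F x)"] by simp
    also have "\<dots> = E' * (E / exp (l * t))" by (simp add: exp_minus right_diff_distrib exp_diff em field_simps)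
    also have "\<dots> \<le> exp (4 * l\<^sup>2 * N) / E * (E / exp (l * t))" using E'le \<open>E > 0\<close> by (intro mult_right_mono) auto
    also have "\<dots> = exp (4 * l\<^sup>2 * N - l * t)" using \<open>E > 0\<close> by (simp add: exp_diff)
    also have "4 * l\<^sup>2 * N - l * t = - t\<^sup>2 / (16 * N)" unfolding lt using N by (simp add: field_simps)
    finally show ?thesis .
  qed
  have "{x. \<bar>F x - m\<bar> \<ge> t} = {x. m + t \<le> F x} \<union> {x. F x \<le> m - t}" by auto
  then have "measure_pmf.prob ?M {x. \<bar>F x - m\<bar> \<ge> t} \<le> measure_pmf.prob ?M {x. m + t \<le> F x} + measure_pmf.prob ?M {x. F x \<le> m - t}"
    by (simp add: measure_Un_le)
  then show ?thesis using up down by linarith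
qed

section \<open>Random answer tables\<close>

definition wt :: "(nat set \<Rightarrow> int) \<Rightarrow> nat set \<Rightarrow> real" where
  "wt w e = real_of_int (w e)"

lemma finite_all_pairs [simp]: "finite (all_pairs n)"
  by (rule finite_subset[of _ "Pow {1..n}"]) (auto simp: all_pairs_def)

lemma pair_in_all_pairs: "a \<in> {1..n} \<Longrightarrow> b \<in> {1..n} \<Longrightarrow> a \<noteq> b \<Longrightarrow> {a, b} \<in> all_pairs n"
  by (auto simp: all_pairs_def)

lemma all_pairsE:
  assumes "e \<in> all_pairs n"
  obtains a b where "a \<in> {1..n}" "b \<in> {1..n}" "a \<noteq> b" "e = {a, b}"
  using assms by (auto simp: all_pairs_def card_2_iff)

lemma correct_answer_pm: "correct_answer G e \<in> {-1, 1}"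
  by (simp add: correct_answer_def)

lemma set_noisy_answer: "set_pmf (noisy_answer p G e) \<subseteq> {-1, 1}"
  using correct_answer_pm[of G e] by (auto simp: noisy_answer_def)

lemma set_answer_table:
  assumes "w \<in> set_pmf (answer_table n p G)"
  shows "e \<in> all_pairs n \<Longrightarrow> w e \<in> {-1, 1}" "e \<notin> all_pairs n \<Longrightarrow> w e = 0"
  using assms set_noisy_answer[of p G e] unfolding answer_table_def
  by (auto simp: set_Pi_pmf PiE_dflt_def)

section \<open>Hoeffding bounds for sums of answers\<close>

lemma expectation_noisy_answer:
  assumes "0 \<le> p" "p \<le> 1"
  shows "measure_pmf.expectation (noisy_answer p G e) real_of_int = (1 - 2 * p) * correct_answer G e"
  unfolding noisy_answer_def using assms by (simp add: integral_map_pmf algebra_simps)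

lemma answer_table_hoeffding:
  assumes p: "0 \<le> p" "p \<le> 1" and F: "F \<subseteq> all_pairs n" and t: "t > 0"
  shows "measure_pmf.prob (answer_table n p G)
      {w. \<bar>(\<Sum>e\<in>F. wt w e) - (1 - 2 * p) * (\<Sum>e\<in>F. real_of_int (correct_answer G e))\<bar> \<ge> t} \<le> 2 * exp (- t\<^sup>2 / (2 * real (card F)))"
proof (cases "F = {}")
  case True
  then show ?thesis by (simp add: order_trans[OF measure_pmf.prob_le_1])
next
  case False
  let ?T = "answer_table n p G"
  have finF: "finite F" using F finite_subset finite_all_pairs by blast
  interpret H: Hoeffding_ineq "measure_pmf ?T" F "\<lambda>e w. wt w e" "\<lambda>_. -1" "\<lambda>_. 1"
    "\<Sum>e\<in>F. measure_pmf.expectation ?T (\<lambda>w. wt w e)"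
  proof unfold_locales
    show "finite F" by fact
    have "prob_space.indep_vars (measure_pmf ?T) (\<lambda>_. count_space UNIV) (\<lambda>x f. f x) (all_pairs n)"
      unfolding answer_table_def by (rule indep_vars_Pi_pmf) simp
    then have "prob_space.indep_vars (measure_pmf ?T) (\<lambda>_. count_space UNIV) (\<lambda>x f. f x) F"
      by (rule prob_space.indep_vars_subset[OF measure_pmf.prob_space_axioms _ F])
    then have "prob_space.indep_vars (measure_pmf ?T) (\<lambda>_. borel) (\<lambda>x. real_of_int \<circ> (\<lambda>f. f x)) F"
      by (intro prob_space.indep_vars_compose[OF measure_pmf.prob_space_axioms, where M' = "\<lambda>_. count_space UNIV"]) auto
    then show "prob_space.indep_vars (measure_pmf ?T) (\<lambda>_. borel) (\<lambda>e w. wt w e) F"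
      by (simp add: comp_def wt_def)
    fix e assume "e \<in> F"
    then show "AE w in measure_pmf ?T. wt w e \<in> {-1..1}"
      using set_answer_table(1)[of _ n p G e] F by (force simp: AE_measure_pmf_iff wt_def)
  qed
  have comp: "measure_pmf.expectation ?T (\<lambda>w. wt w e) = (1 - 2 * p) * correct_answer G e" if "e \<in> F" for e
  proof -
    have "map_pmf (\<lambda>w. w e) ?T = noisy_answer p G e"
      unfolding answer_table_def using that F by (subst Pi_pmf_component) auto
    then have "measure_pmf.expectation (noisy_answer p G e) real_of_int = measure_pmf.expectation ?T (\<lambda>w. real_of_int (w e))"
      by (metis integral_map_pmf)
    then show ?thesis using expectation_noisy_answer[OF p] by (simp add: wt_def)
  qed
  have mean: "(\<Sum>e\<in>F. measure_pmf.expectation ?T (\<lambda>w. wt w e)) = (1 - 2 * p) * (\<Sum>e\<in>F. real_of_int (correct_answer G e))"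
    using comp by (simp add: sum_distrib_left)
  have "measure_pmf.prob ?T {x \<in> space (measure_pmf ?T). t \<le> \<bar>(\<Sum>e\<in>F. wt x e) - (\<Sum>e\<in>F. measure_pmf.expectation ?T (\<lambda>w. wt w e))\<bar>}
      \<le> 2 * exp (- 2 * t\<^sup>2 / (\<Sum>e\<in>F. (1 - (-1))\<^sup>2))"
    using t finF False by (intro H.Hoeffding_ineq_abs_ge) (auto intro!: sum_pos)
  moreover have "- 2 * t\<^sup>2 / (\<Sum>e\<in>F. (1 - (-1))\<^sup>2) = - t\<^sup>2 / (2 * real (card F))" by simp
  ultimately show ?thesis unfolding mean by simp
qed

lemma sum_pairs_hoeffding:
  assumes p: "0 \<le> p" "p \<le> 1" and J: "finite J" "inj_on h J" "h ` J \<subseteq> all_pairs n" and t: "t > 0"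
    and c: "\<And>x. x \<in> J \<Longrightarrow> correct_answer G (h x) = c"
  shows "measure_pmf.prob (answer_table n p G) {w. \<bar>(\<Sum>x\<in>J. wt w (h x)) - (1 - 2 * p) * real_of_int c * card J\<bar> \<ge> t}
    \<le> 2 * exp (- t\<^sup>2 / (2 * real (card J)))"
proof -
  have "(\<Sum>e\<in>h ` J. real_of_int (correct_answer G e)) = real_of_int c * card J"
    using c by (simp add: sum.reindex[OF J(2)])
  moreover have "(\<Sum>e\<in>h ` J. wt w e) = (\<Sum>x\<in>J. wt w (h x))" for w
    by (simp add: sum.reindex[OF J(2)])
  ultimately show ?thesis
    using answer_table_hoeffding[OF p J(3) t, of G] by (simp add: card_image[OF J(2)] mult.assoc)
qed

lemma cut_hoeffding:
  assumes p: "0 \<le> p" "p \<le> 1" and XY: "X \<subseteq> {1..n}" "Y \<subseteq> {1..n}" "X \<inter> Y = {}" and t: "t > 0"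
    and c: "\<And>x y. x \<in> X \<Longrightarrow> y \<in> Y \<Longrightarrow> correct_answer G {x, y} = c"
  shows "measure_pmf.prob (answer_table n p G)
      {w. \<bar>cut (wt w) X Y - (1 - 2 * p) * real_of_int c * (real (card X) * real (card Y))\<bar> \<ge> t}
    \<le> 2 * exp (- t\<^sup>2 / (2 * (real (card X) * real (card Y))))"
proof -
  have fin: "finite X" "finite Y" using XY finite_subset by blast+
  have inj: "inj_on (\<lambda>(x, y). {x, y}) (X \<times> Y)"
    using XY(3) by (auto simp: inj_on_def doubleton_eq_iff)
  have "cut (wt w) X Y = (\<Sum>(x, y)\<in>X \<times> Y. wt w {x, y})" for w
    unfolding cut_def sum.cartesian_product using XY(3) by (intro sum.cong) auto
  moreover have "measure_pmf.prob (answer_table n p G)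
      {w. \<bar>(\<Sum>z\<in>X \<times> Y. wt w (case z of (x, y) \<Rightarrow> {x, y})) - (1 - 2 * p) * real_of_int c * card (X \<times> Y)\<bar> \<ge> t}
    \<le> 2 * exp (- t\<^sup>2 / (2 * real (card (X \<times> Y))))"
    using fin inj XY t c by (intro sum_pairs_hoeffding p) (auto intro!: pair_in_all_pairs)
  ultimately show ?thesis by (simp add: card_cartesian_product case_prod_beta' mult.assoc)
qed

lemma cut_self_eq:
  fixes w :: "nat set \<Rightarrow> real"
  assumes "finite X"
  shows "cut w X X = 2 * (\<Sum>j\<in>X. \<Sum>i\<in>{i \<in> X. i < j}. w {i, j})"
proof -
  have "cut w X X = (\<Sum>j\<in>X. (\<Sum>i\<in>X. if i < j then w {i, j} else 0) + (\<Sum>i\<in>X. if j < i then w {j, i} else 0))"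
    unfolding cut_def sum.distrib[symmetric] by (intro sum.cong refl) (auto simp: insert_commute)
  also have "\<dots> = (\<Sum>j\<in>X. \<Sum>i\<in>X. if i < j then w {i, j} else 0) + (\<Sum>j\<in>X. \<Sum>i\<in>X. if j < i then w {j, i} else 0)"
    by (simp add: sum.distrib)
  also have "(\<Sum>j\<in>X. \<Sum>i\<in>X. if j < i then w {j, i} else 0) = (\<Sum>j\<in>X. \<Sum>i\<in>X. if i < j then w {i, j} else 0)"
    by (subst sum.swap) simp
  also have "(\<Sum>j\<in>X. \<Sum>i\<in>X. if i < j then w {i, j} else 0) = (\<Sum>j\<in>X. \<Sum>i\<in>{i \<in> X. i < j}. w {i, j})"
    using assms by (intro sum.cong[OF refl] sum.inter_filter[symmetric])
  finally show ?thesis by simp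
qed

lemma cut_self_hoeffding:
  assumes p: "0 \<le> p" "p \<le> 1" and X: "X \<subseteq> {1..n}" and t: "t > 0"
    and c: "\<And>x y. x \<in> X \<Longrightarrow> y \<in> X \<Longrightarrow> correct_answer G {x, y} = 1"
  shows "measure_pmf.prob (answer_table n p G)
      {w. \<bar>cut (wt w) X X - (1 - 2 * p) * (real (card X) * (real (card X) - 1))\<bar> \<ge> t}
    \<le> 2 * exp (- t\<^sup>2 / (4 * real (card X) ^ 2))"
proof -
  have fin: "finite X" using X finite_subset by blast
  define J where "J = Sigma X (\<lambda>j. {i \<in> X. i < j})"
  have finJ: "finite J" using fin by (simp add: J_def)
  have inj: "inj_on (\<lambda>(j, i). {i, j}) J"
    by (auto simp: inj_on_def J_def doubleton_eq_iff)
  have e: "cut (wt w) X X = 2 * (\<Sum>(j, i)\<in>J. wt w {i, j})" for w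
    unfolding cut_self_eq[OF fin] J_def using fin by (subst sum.Sigma) auto
  have cJ: "2 * real (card J) = real (card X) * (real (card X) - 1)"
  proof -
    have "2 * real (card J) = 2 * (\<Sum>(j, i)\<in>J. 1)" by simp
    also have "\<dots> = cut (\<lambda>_. 1) X X"
      unfolding cut_self_eq[OF fin] J_def using fin by (subst sum.Sigma) auto
    also have "\<dots> = (\<Sum>a\<in>X. real (card X) - 1)"
    proof (unfold cut_def, intro sum.cong refl)
      fix a assume a: "a \<in> X"
      have "(\<Sum>b\<in>X. if a = b then 0 else 1) = (\<Sum>b\<in>X. (1::real)) - (\<Sum>b\<in>X. if a = b then 1 else 0)"
        unfolding sum_subtractf[symmetric] by (intro sum.cong) auto
      then show "(\<Sum>b\<in>X. if a = b then 0 else 1) = real (card X) - 1" using a fin by simp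
    qed
    finally show ?thesis by simp
  qed
  \<comment> \<open>Each pair occurs twice in \<open>cut\<close>, so the sum over unordered pairs
    deviates by \<open>t / 2\<close>.\<close>
  have ev: "{w. \<bar>cut (wt w) X X - (1 - 2 * p) * (real (card X) * (real (card X) - 1))\<bar> \<ge> t} =
     {w. \<bar>(\<Sum>z\<in>J. wt w (case z of (j, i) \<Rightarrow> {i, j})) - (1 - 2 * p) * real_of_int 1 * card J\<bar> \<ge> t / 2}"
    unfolding e cJ[symmetric] by (auto simp: case_prod_beta' abs_if algebra_simps split: if_splits)
  show ?thesis
  proof (cases "J = {}")
    case True
    then show ?thesis unfolding ev using t by simp
  next
    case False
    have "measure_pmf.prob (answer_table n p G) {w. \<bar>(\<Sum>z\<in>J. wt w (case z of (j, i) \<Rightarrow> {i, j})) - (1 - 2 * p) * real_of_int 1 * card J\<bar> \<ge> t / 2}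
      \<le> 2 * exp (- (t / 2)\<^sup>2 / (2 * real (card J)))"
      using t c X finJ inj by (intro sum_pairs_hoeffding p) (auto simp: J_def intro!: pair_in_all_pairs)
    also have "\<dots> \<le> 2 * exp (- t\<^sup>2 / (4 * real (card X) ^ 2))"
    proof -
      have "0 < real (card J)" using finJ False by (simp add: card_gt_0_iff)
      moreover have "2 * real (card J) \<le> real (card X) ^ 2" unfolding cJ by (simp add: power2_eq_square algebra_simps)
      moreover have "X \<noteq> {}" using False by (auto simp: J_def)
      then have "0 < real (card X) ^ 2" using fin by (simp add: card_gt_0_iff)
      ultimately have "t\<^sup>2 / (4 * real (card X) ^ 2) \<le> t\<^sup>2 / (4 * (2 * real (card J)))"
        by (intro divide_left_mono mult_left_mono mult_pos_pos) auto
      then show ?thesis by (simp add: power_divide)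
    qed
    finally show ?thesis unfolding ev .
  qed
qed

section \<open>Union bounds over vertex sets\<close>

lemma sum_Pow_power:
  fixes q :: real
  assumes "finite A"
  shows "(\<Sum>X\<in>Pow A. q ^ card X) = (1 + q) ^ card A"
  using assms
proof (induction A rule: finite_induct)
  case (insert x A)
  have "(\<Sum>X\<in>Pow (insert x A). q ^ card X) = (\<Sum>X\<in>Pow A. q ^ card X) + (\<Sum>X\<in>insert x ` Pow A. q ^ card X)"
    unfolding Pow_insert using insert.hyps by (intro sum.union_disjoint) auto
  also have "(\<Sum>X\<in>insert x ` Pow A. q ^ card X) = (\<Sum>X\<in>Pow A. q ^ card (insert x X))"
    using insert.hyps by (subst sum.reindex) (auto simp: inj_on_def)
  also have "\<dots> = (\<Sum>X\<in>Pow A. q * q ^ card X)"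
  proof (intro sum.cong refl)
    fix X assume "X \<in> Pow A"
    then have "x \<notin> X" "finite X" using insert.hyps finite_subset by auto
    then show "q ^ card (insert x X) = q * q ^ card X" by simp
  qed
  finally show ?case using insert by (simp add: algebra_simps flip: sum_distrib_left)
qed simp

text \<open>A union bound over all nonempty sets is affordable if each vertex of a set contributes a
  factor \<open>q\<close> well below \<open>1 / n\<close>.\<close>

lemma sum_nonempty_subsets:
  fixes q :: real
  assumes "0 \<le> q" "real n * q \<le> 1"
  shows "(\<Sum>X\<in>Pow {1..n} - {{}}. q ^ card X) \<le> 2 * real n * q"
proof -
  have "(\<Sum>X\<in>Pow {1..n} - {{}}. q ^ card X) = (1 + q) ^ n - 1"
    using sum_Pow_power[of "{1..n}" q] by (simp add: sum_diff1)
  also have "(1 + q) ^ n \<le> exp q ^ n"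
    using assms by (intro power_mono exp_ge_add_one_self) auto
  also have "exp q ^ n = exp (real n * q)" by (simp add: exp_of_nat_mult)
  also have "exp (real n * q) \<le> 1 + real n * q + (real n * q)\<^sup>2"
    using assms by (intro exp_bound) auto
  also have "(real n * q)\<^sup>2 \<le> real n * q"
    using assms unfolding power2_eq_square by (intro mult_left_le) auto
  finally show ?thesis by (simp add: mult_ac)
qed

lemma prob_pair_le:
  assumes "\<And>y. measure_pmf.prob A {x. P x y} \<le> \<beta>"
  shows "measure_pmf.prob (pair_pmf A B) {z. P (fst z) (snd z)} \<le> \<beta>"
proof -
  have "pair_pmf A B = bind_pmf B (\<lambda>y. map_pmf (\<lambda>x. (x, y)) A)"
    unfolding pair_pmf_def map_pmf_def by (subst bind_commute_pmf) simp
  then have "ennreal (measure_pmf.prob (pair_pmf A B) {z. P (fst z) (snd z)}) =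
      (\<integral>\<^sup>+ y. ennreal (measure_pmf.prob A {x. P x y}) \<partial>measure_pmf B)"
    by (simp add: measure_pmf.emeasure_eq_measure[symmetric] vimage_def)
  also have "\<dots> \<le> (\<integral>\<^sup>+ y. ennreal \<beta> \<partial>measure_pmf B)"
    using assms by (intro nn_integral_mono ennreal_leI)
  also have "\<dots> = ennreal \<beta>" by simp
  finally show ?thesis
    using order_trans[OF measure_nonneg assms] by (simp add: ennreal_le_iff)
qed

lemma prob_Union_le:
  assumes "finite I" "\<And>i. i \<in> I \<Longrightarrow> measure_pmf.prob M (A i) \<le> g i"
  shows "measure_pmf.prob M (\<Union>i\<in>I. A i) \<le> sum g I"
  using measure_UNION_le[OF assms(1), of A "measure_pmf M"] sum_mono[of I _ g, OF assms(2)] by auto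

section \<open>The exchange property\<close>

text \<open>Extensional maps make the set finite, so that a maximum exists.\<close>

definition placements :: "'a set \<Rightarrow> 'a set \<Rightarrow> real \<Rightarrow> real \<Rightarrow> ('a set set \<times> ('a \<Rightarrow> 'a set)) set" where
  "placements V D \<beta> h = {(Q, \<tau>). placement V D \<beta> h Q \<tau> \<and> \<tau> \<in> extensional D}"

definition best_placement :: "('a set \<Rightarrow> real) \<Rightarrow> 'a set \<Rightarrow> 'a set \<Rightarrow> real \<Rightarrow> real \<Rightarrow> real" where
  "best_placement w V D \<beta> h = Max ((\<lambda>(Q, \<tau>). placement_value w D Q \<tau>) ` placements V D \<beta> h)"

section \<open>Best placements and permutations of the placed vertices\<close>

lemma finite_placements:
  assumes "finite V" "finite D"
  shows "finite (placements V D \<beta> h)"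
proof (rule finite_subset)
  show "placements V D \<beta> h \<subseteq> Pow (Pow V) \<times> (D \<rightarrow>\<^sub>E Pow V)"
    by (auto simp: placements_def placement_def partition_on_def PiE_def)
  show "finite (Pow (Pow V) \<times> (D \<rightarrow>\<^sub>E Pow V))" using assms by (auto intro: finite_PiE)
qed

lemma placements_nonempty:
  assumes "0 \<le> \<beta>" "0 \<le> h"
  shows "placements V D \<beta> h \<noteq> {}"
proof -
  have "partition_on V ((\<lambda>v. {v}) ` V)" by (auto simp: partition_on_def disjoint_def)
  moreover have "card {u \<in> D. restrict (\<lambda>_. {}) D u = B} = 0" if "B \<in> (\<lambda>v. {v}) ` V" for B
  proof -
    have "{u \<in> D. restrict (\<lambda>_. {}) D u = B} = {}" using that by auto
    then show ?thesis by (metis card.empty)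
  qed
  ultimately have "((\<lambda>v. {v}) ` V, restrict (\<lambda>_. {}) D) \<in> placements V D \<beta> h"
    using assms unfolding placements_def placement_def by simp
  then show ?thesis by blast
qed

lemma placement_restrict:
  assumes "placement V D \<beta> h Q \<tau>"
  shows "(Q, restrict \<tau> D) \<in> placements V D \<beta> h" "placement_value w D Q (restrict \<tau> D) = placement_value w D Q \<tau>"
proof -
  have "{u \<in> D. restrict \<tau> D u = B} = {u \<in> D. \<tau> u = B}" for B by auto
  then show "(Q, restrict \<tau> D) \<in> placements V D \<beta> h"
    using assms by (simp add: placements_def placement_def)
qed (simp add: placement_value_def)

lemma best_placement_ge:
  assumes "finite V" "finite D" "placement V D \<beta> h Q \<tau>"
  shows "placement_value w D Q \<tau> \<le> best_placement w V D \<beta> h"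
  unfolding best_placement_def placement_restrict(2)[OF assms(3), symmetric]
  using placement_restrict(1)[OF assms(3)] finite_placements[OF assms(1,2)] by (intro Max_ge) force+

lemma best_placement_attained:
  assumes "finite V" "finite D" "0 \<le> \<beta>" "0 \<le> h"
  obtains Q \<tau> where "placement V D \<beta> h Q \<tau>" "best_placement w V D \<beta> h = placement_value w D Q \<tau>"
proof -
  have "best_placement w V D \<beta> h \<in> (\<lambda>(Q, \<tau>). placement_value w D Q \<tau>) ` placements V D \<beta> h"
    unfolding best_placement_def using finite_placements[OF assms(1,2)] placements_nonempty[OF assms(3,4)] by (intro Max_in) auto
  then show ?thesis using that by (auto simp: placements_def)
qed

text \<open>The restrictions on a placement concern sizes of hosts and numbers of guests, and the
  value involves no pair inside \<open>C\<close>. So a permutation of \<open>C\<close> carries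
  placements over if the answers between \<open>C\<close> and \<open>V\<close> are permuted
  along.\<close>

lemma best_placement_permute:
  assumes fin: "finite V" "finite C" and dj: "C \<inter> V = {}" and D: "D \<subseteq> C"
    and \<pi>: "bij_betw \<pi> C C" "\<And>v. v \<in> V \<Longrightarrow> \<pi> v = v" and nn: "0 \<le> \<beta>" "0 \<le> h"
    and w: "\<And>u v. u \<in> C \<Longrightarrow> v \<in> V \<Longrightarrow> w {u, v} = w' {\<pi> u, v}"
    and w0: "\<And>u v. u \<in> V \<Longrightarrow> v \<in> V \<Longrightarrow> w {u, v} = w' {u, v}"
  shows "best_placement w V D \<beta> h \<le> best_placement w' V (\<pi> ` D) \<beta> h"
proof -
  have finD: "finite D" using D fin finite_subset by blast
  obtain Q \<tau> where Q: "placement V D \<beta> h Q \<tau>" "best_placement w V D \<beta> h = placement_value w D Q \<tau>"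
    using best_placement_attained[OF fin(1) finD nn] by blast
  have inj: "inj_on \<pi> D" using \<pi>(1) D by (auto simp: bij_betw_def inj_on_def)
  define \<rho> where "\<rho> = inv_into D \<pi>"
  have \<rho>: "\<rho> (\<pi> u) = u" if "u \<in> D" for u using inj that by (simp add: \<rho>_def)
  have Qp: "partition_on V Q" and \<tau>: "\<And>u. u \<in> D \<Longrightarrow> \<tau> u \<in> insert {} Q \<and> real (card (\<tau> u)) \<le> \<beta>"
    and hb: "\<And>B. B \<in> Q \<Longrightarrow> real (card {u \<in> D. \<tau> u = B}) \<le> h"
    using Q(1) by (auto simp: placement_def)
  have \<tau>V: "\<tau> u \<subseteq> V" if "u \<in> D" for u using \<tau>[OF that] Qp by (auto simp: partition_on_def)
  have "placement V (\<pi> ` D) \<beta> h Q (\<tau> \<circ> \<rho>)"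
    unfolding placement_def
  proof (intro conjI ballI)
    fix B assume "B \<in> Q"
    have "{u \<in> \<pi> ` D. (\<tau> \<circ> \<rho>) u = B} = \<pi> ` {u \<in> D. \<tau> u = B}" using \<rho> by auto
    moreover have "card (\<pi> ` {u \<in> D. \<tau> u = B}) = card {u \<in> D. \<tau> u = B}"
      using inj by (intro card_image) (auto simp: inj_on_def)
    ultimately show "real (card {u \<in> \<pi> ` D. (\<tau> \<circ> \<rho>) u = B}) \<le> h" using hb[OF \<open>B \<in> Q\<close>] by simp
  next
    fix u assume "u \<in> \<pi> ` D"
    then obtain u0 where "u0 \<in> D" "u = \<pi> u0" by auto
    then show "(\<tau> \<circ> \<rho>) u \<in> insert {} Q" "real (card ((\<tau> \<circ> \<rho>) u)) \<le> \<beta>"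
      using \<tau>[of u0] \<rho> by simp_all
  qed (use Qp in auto)
  moreover have "placement_value w' (\<pi> ` D) Q (\<tau> \<circ> \<rho>) = placement_value w D Q \<tau>"
  proof -
    have "cut w' B B = cut w B B" if "B \<in> Q" for B
      unfolding cut_def
    proof (intro sum.cong refl)
      fix a b assume "a \<in> B" "b \<in> B"
      then have "a \<in> V" "b \<in> V" using that Qp by (auto simp: partition_on_def)
      then show "(if a = b then 0 else w' {a, b}) = (if a = b then 0 else w {a, b})" using w0 by simp
    qed
    moreover have "(\<Sum>u\<in>\<pi> ` D. cut w' {u} ((\<tau> \<circ> \<rho>) u)) = (\<Sum>u\<in>D. cut w' {\<pi> u} (\<tau> u))"
      using \<rho> by (simp add: sum.reindex[OF inj])
    moreover have "cut w' {\<pi> u} (\<tau> u) = cut w {u} (\<tau> u)" if "u \<in> D" for u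
    proof -
      have "\<pi> u \<in> C" "u \<in> C" using that D \<pi>(1) by (auto simp: bij_betw_def)
      then have "w' {\<pi> u, v} = w {u, v} \<and> \<pi> u \<noteq> v \<and> u \<noteq> v" if "v \<in> \<tau> u" for v
        using \<tau>V[OF \<open>u \<in> D\<close>] dj w that by auto
      then show ?thesis unfolding cut_def by (auto intro!: sum.cong)
    qed
    ultimately show ?thesis by (simp add: placement_value_def score_def)
  qed
  ultimately show ?thesis
    using best_placement_ge[of V "\<pi> ` D" \<beta> h Q "\<tau> \<circ> \<rho>" w'] fin(1) finD Q(2) by simp
qed

definition splice :: "'e set \<Rightarrow> ('e \<Rightarrow> int) \<Rightarrow> ('e \<Rightarrow> int) \<Rightarrow> 'e \<Rightarrow> int" where
  "splice R f g e = (if e \<in> R then f e else g e)"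

lemma ex_bij_extending:
  assumes "finite C" "D \<subseteq> C" "D' \<subseteq> C" "card D = card D'"
  obtains \<pi> where "bij_betw \<pi> C C" "\<pi> ` D = D'" "\<And>v. v \<notin> C \<Longrightarrow> \<pi> v = v"
proof -
  have fin: "finite D" "finite D'" using assms finite_subset by auto
  obtain f where f: "bij_betw f D D'" using finite_same_card_bij[OF fin assms(4)] by blast
  have "card (C - D) = card (C - D')" using assms fin by (simp add: card_Diff_subset)
  then obtain g where g: "bij_betw g (C - D) (C - D')"
    using finite_same_card_bij[of "C - D" "C - D'"] assms by auto
  define \<pi> where "\<pi> v = (if v \<in> D then f v else if v \<in> C then g v else v)" for v
  have "bij_betw \<pi> D D'" using f by (rule iffD1[OF bij_betw_cong, rotated]) (simp add: \<pi>_def)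
  moreover have "bij_betw \<pi> (C - D) (C - D')" using g by (rule iffD1[OF bij_betw_cong, rotated]) (simp add: \<pi>_def)
  ultimately have "bij_betw \<pi> (D \<union> (C - D)) (D' \<union> (C - D'))" by (rule bij_betw_combine) auto
  moreover have "D \<union> (C - D) = C" "D' \<union> (C - D') = C" using assms by auto
  moreover have "\<pi> ` D = D'" using \<open>bij_betw \<pi> D D'\<close> by (simp add: bij_betw_def)
  moreover have "\<pi> v = v" if "v \<notin> C" for v using that assms(2) by (auto simp: \<pi>_def)
  ultimately show ?thesis using that[of \<pi>] by simp
qed

text \<open>To be used with two clusters united in \<open>C\<close> and all other vertices in
  \<open>V\<close>. Every correct answer between them is negative, so the noisy answers there are
  independent signs with one common law.\<close>

locale exchange_setting =
  fixes n :: nat and p :: real and G :: "nat set set" and C V :: "nat set" and s :: nat and h \<epsilon> :: real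
  assumes p: "0 \<le> p" "p \<le> 1" and CV: "C \<subseteq> {1..n}" "V \<subseteq> {1..n}" "C \<inter> V = {}"
    and foreign: "\<And>u v. u \<in> C \<Longrightarrow> v \<in> V \<Longrightarrow> correct_answer G {u, v} = -1"
    and s: "0 < s" "card C \<le> 2 * s" and h: "0 \<le> h" and \<epsilon>: "0 < \<epsilon>"
begin

definition R :: "nat set set" where "R = {{u, v} | u v. u \<in> C \<and> v \<in> V}"

lemma R_sub: "R \<subseteq> all_pairs n"
  using CV by (auto simp: R_def intro!: pair_in_all_pairs)

lemma finR: "finite R" using R_sub finite_subset finite_all_pairs by blast

lemma finC: "finite C" and finV: "finite V"
  using CV finite_subset by blast+

text \<open>\<open>f\<close> carries the answers between \<open>C\<close> and \<open>V\<close>; all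
  others are frozen in \<open>g\<close>.\<close>

definition F :: "(nat set \<Rightarrow> int) \<Rightarrow> nat set \<Rightarrow> (nat set \<Rightarrow> int) \<Rightarrow> real" where
  "F g D f = best_placement (wt (splice R f g)) V D (2 * real s) h"

text \<open>The number \<open>m\<close> of \<open>max_of_sums_concentration\<close> for the
  deviation \<open>\<epsilon> * s ^ 2 / 2\<close> and \<open>N = 4 * s ^ 2\<close>.\<close>

definition center :: "(nat set \<Rightarrow> int) \<Rightarrow> nat set \<Rightarrow> real" where
  "center g D = ln (measure_pmf.expectation (Pi_pmf R 0 (\<lambda>_. sign_pmf p))
     (\<lambda>f. exp (\<epsilon> * real s ^ 2 / 2 / (8 * (4 * real s ^ 2)) * F g D f))) / (\<epsilon> * real s ^ 2 / 2 / (8 * (4 * real s ^ 2)))"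

text \<open>At most \<open>2 * s\<close> vertices meet hosts of size at most \<open>2 * s\<close>,
  so each placement is a constant plus a sum over at most \<open>4 * s ^ 2\<close> signs,
  independently of \<open>n\<close>.\<close>

lemma F_concentration:
  assumes D: "D \<subseteq> C"
  shows "measure_pmf.prob (Pi_pmf R 0 (\<lambda>_. sign_pmf p)) {f. \<bar>F g D f - center g D\<bar> \<ge> \<epsilon> * real s ^ 2 / 2}
    \<le> 2 * exp (- (\<epsilon>\<^sup>2 * real s ^ 2 / 256))"
proof -
  let ?TT = "placements V D (2 * real s) h"
  define T where "T \<theta> = (\<lambda>(u, v). {u, v}) ` (SIGMA u:D. snd \<theta> u)" for \<theta> :: "nat set set \<times> (nat \<Rightarrow> nat set)"
  define c where "c \<theta> = score (wt g) (fst \<theta>) / 2" for \<theta> :: "nat set set \<times> (nat \<Rightarrow> nat set)"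
  have finD: "finite D" using D finC finite_subset by blast
  have \<theta>: "partition_on V (fst \<theta>)" "\<And>u. u \<in> D \<Longrightarrow> snd \<theta> u \<subseteq> V" "\<And>u. u \<in> D \<Longrightarrow> real (card (snd \<theta> u)) \<le> 2 * real s"
    if "\<theta> \<in> ?TT" for \<theta>
    using that by (fastforce simp: placements_def placement_def partition_on_def)+
  have inj: "inj_on (\<lambda>(u, v). {u, v}) (SIGMA u:D. snd \<theta> u)" if "\<theta> \<in> ?TT" for \<theta>
    unfolding inj_on_def
  proof clarify
    fix u v u' v' assume a: "u \<in> D" "v \<in> snd \<theta> u" "u' \<in> D" "v' \<in> snd \<theta> u'" "{u, v} = {u', v'}"
    then have "u \<in> C" "u' \<in> C" "v \<in> V" "v' \<in> V" using D \<theta>(2)[OF that] by auto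
    then show "u = u' \<and> v = v'" using a(5) CV(3) by (auto simp: doubleton_eq_iff)
  qed
  have val: "placement_value (wt (splice R f g)) D (fst \<theta>) (snd \<theta>) = c \<theta> + (\<Sum>e\<in>T \<theta>. real_of_int (f e))"
    if "\<theta> \<in> ?TT" for \<theta> f
  proof -
    have "score (wt (splice R f g)) (fst \<theta>) = score (wt g) (fst \<theta>)"
      unfolding score_def cut_def
    proof (intro sum.cong refl)
      fix B a b assume "B \<in> fst \<theta>" "a \<in> B" "b \<in> B"
      then have "{a, b} \<notin> R" using \<theta>(1)[OF that] CV(3) by (auto simp: R_def partition_on_def doubleton_eq_iff)
      then show "(if a = b then 0 else wt (splice R f g) {a, b}) = (if a = b then 0 else wt g {a, b})"
        by (simp add: wt_def splice_def)
    qed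
    moreover have "(\<Sum>u\<in>D. cut (wt (splice R f g)) {u} (snd \<theta> u)) = (\<Sum>e\<in>T \<theta>. real_of_int (f e))"
    proof -
      have "(\<Sum>u\<in>D. cut (wt (splice R f g)) {u} (snd \<theta> u)) = (\<Sum>u\<in>D. \<Sum>v\<in>snd \<theta> u. real_of_int (f {u, v}))"
        unfolding cut_def
      proof (rule sum.cong[OF refl])
        fix u assume u: "u \<in> D"
        have "(\<Sum>v\<in>snd \<theta> u. if u = v then 0 else wt (splice R f g) {u, v}) = (\<Sum>v\<in>snd \<theta> u. real_of_int (f {u, v}))"
        proof (rule sum.cong[OF refl])
          fix v assume "v \<in> snd \<theta> u"
          then have "u \<in> C" "v \<in> V" using \<theta>(2)[OF that u] u D by auto
          moreover from this have "{u, v} \<in> R" "u \<noteq> v" using CV(3) by (auto simp: R_def)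
          ultimately show "(if u = v then 0 else wt (splice R f g) {u, v}) = real_of_int (f {u, v})"
            by (simp add: wt_def splice_def)
        qed
        then show "(\<Sum>a\<in>{u}. \<Sum>v\<in>snd \<theta> u. if a = v then 0 else wt (splice R f g) {a, v}) = (\<Sum>v\<in>snd \<theta> u. real_of_int (f {u, v}))"
          by simp
      qed
      also have "\<dots> = (\<Sum>z\<in>(SIGMA u:D. snd \<theta> u). real_of_int (f (case z of (u, v) \<Rightarrow> {u, v})))"
        using finD \<theta>(2)[OF that] finV by (subst sum.Sigma) (auto intro: finite_subset simp: case_prod_beta')
      also have "\<dots> = (\<Sum>e\<in>T \<theta>. real_of_int (f e))"
        unfolding T_def by (subst sum.reindex[OF inj[OF that]]) simp
      finally show ?thesis .
    qed
    ultimately show ?thesis by (simp add: placement_value_def c_def)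
  qed
  have F_eq: "F g D = (\<lambda>x. Max ((\<lambda>\<theta>. c \<theta> + (\<Sum>i\<in>T \<theta>. real_of_int (x i))) ` ?TT))"
    unfolding F_def best_placement_def using val by (intro ext arg_cong[of _ _ Max] image_cong refl) (auto simp: case_prod_beta')
  have cT: "real (card (T \<theta>)) \<le> 4 * real s ^ 2" if "\<theta> \<in> ?TT" for \<theta>
  proof -
    have "real (card (T \<theta>)) = (\<Sum>u\<in>D. real (card (snd \<theta> u)))"
      unfolding T_def card_image[OF inj[OF that]] using finD \<theta>(2)[OF that] finV
      by (subst card_SigmaI) (auto intro: finite_subset)
    also have "\<dots> \<le> (\<Sum>u\<in>D. 2 * real s)" using \<theta>(3)[OF that] by (rule sum_mono)
    also have "\<dots> = real (card D) * (2 * real s)" by simp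
    also have "\<dots> \<le> (2 * real s) * (2 * real s)"
      using card_mono[OF finC D] s by (intro mult_right_mono) auto
    finally show ?thesis by (simp add: power2_eq_square)
  qed
  have conc: "measure_pmf.prob (Pi_pmf R 0 (\<lambda>_. sign_pmf p)) {x. \<epsilon> * real s ^ 2 / 2 \<le>
      \<bar>Max ((\<lambda>\<theta>. c \<theta> + (\<Sum>i\<in>T \<theta>. real_of_int (x i))) ` ?TT) -
        ln (measure_pmf.expectation (Pi_pmf R 0 (\<lambda>_. sign_pmf p)) (\<lambda>x. exp (\<epsilon> * real s ^ 2 / 2 / (8 * (4 * real s ^ 2)) * Max ((\<lambda>\<theta>. c \<theta> + (\<Sum>i\<in>T \<theta>. real_of_int (x i))) ` ?TT))))
           / (\<epsilon> * real s ^ 2 / 2 / (8 * (4 * real s ^ 2)))\<bar>}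
     \<le> 2 * exp (- (\<epsilon> * real s ^ 2 / 2)\<^sup>2 / (16 * (4 * real s ^ 2)))"
  proof (rule max_of_sums_concentration[OF finR p])
    show "finite ?TT" using finite_placements finV finD by blast
    show "?TT \<noteq> {}" by (rule placements_nonempty[OF _ h]) simp
    fix \<theta> assume t: "\<theta> \<in> ?TT"
    show "T \<theta> \<subseteq> R" using \<theta>(2)[OF t] D by (fastforce simp: T_def R_def)
    show "real (card (T \<theta>)) \<le> 4 * real s ^ 2" using cT[OF t] .
  qed (use s \<epsilon> in auto)
  have "- (\<epsilon> * real s ^ 2 / 2)\<^sup>2 / (16 * (4 * real s ^ 2)) = - (\<epsilon>\<^sup>2 * real s ^ 2 / 256)"
    using s by (simp add: power2_eq_square field_simps)
  from conc[unfolded this] show ?thesis unfolding center_def F_eq .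
qed

text \<open>Some permutation of \<open>C\<close> takes \<open>D\<close> to \<open>D'\<close>. It
  permutes identically distributed answers, so \<open>F\<close> has the same law for both
  sets.\<close>

lemma center_eq:
  assumes "D \<subseteq> C" "D' \<subseteq> C" "card D = card D'"
  shows "center g D = center g D'"
proof -
  obtain \<pi> where \<pi>: "bij_betw \<pi> C C" "\<pi> ` D = D'" "\<And>v. v \<notin> C \<Longrightarrow> \<pi> v = v"
    using ex_bij_extending[OF finC assms] by blast
  have \<pi>V: "\<pi> v = v" if "v \<in> V" for v using \<pi>(3) CV(3) that by auto
  let ?\<sigma> = "\<lambda>e. \<pi> ` e"
  have injpi: "inj \<pi>"
  proof (rule injI)
    fix x y assume "\<pi> x = \<pi> y"
    then show "x = y" using \<pi>(1,3) unfolding bij_betw_def inj_on_def by (metis imageI)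
  qed
  have img: "?\<sigma> {u, v} \<in> R" if "u \<in> C" "v \<in> V" for u v
  proof -
    have "\<pi> u \<in> C" using that(1) \<pi>(1) by (auto simp: bij_betw_def)
    moreover have "?\<sigma> {u, v} = {\<pi> u, v}" using \<pi>V[OF that(2)] by simp
    ultimately show ?thesis using that(2) unfolding R_def by blast
  qed
  have R_iff: "?\<sigma> e \<in> R \<longleftrightarrow> e \<in> R" for e
  proof
    assume "?\<sigma> e \<in> R"
    then obtain u v where uv: "u \<in> C" "v \<in> V" "\<pi> ` e = {u, v}" by (auto simp: R_def)
    have "u \<in> \<pi> ` C" using uv \<pi>(1) by (simp add: bij_betw_def)
    then obtain u' where u': "u' \<in> C" "\<pi> u' = u" by blast
    have "\<pi> ` e = \<pi> ` {u', v}" using uv u' \<pi>V by auto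
    then have "e = {u', v}" by (simp only: inj_image_eq_iff[OF injpi])
    then show "e \<in> R" using u' uv by (auto simp: R_def)
  next
    assume "e \<in> R"
    then obtain u v where "u \<in> C" "v \<in> V" "e = {u, v}" by (auto simp: R_def)
    then show "?\<sigma> e \<in> R" using img by blast
  qed
  have bij: "bij_betw ?\<sigma> R R"
  proof (rule bij_betwI')
    fix e e' show "(?\<sigma> e = ?\<sigma> e') = (e = e')" using injpi by (simp add: inj_image_eq_iff)
  next
    fix e assume "e \<in> R" then show "?\<sigma> e \<in> R" using R_iff by simp
  next
    fix e assume "e \<in> R"
    then obtain u v where uv: "u \<in> C" "v \<in> V" "e = {u, v}" by (auto simp: R_def)
    have "u \<in> \<pi> ` C" using uv \<pi>(1) by (simp add: bij_betw_def)
    then obtain u' where u': "u' \<in> C" "\<pi> u' = u" by blast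
    have "e = ?\<sigma> {u', v}" using uv u' \<pi>V by auto
    moreover have "{u', v} \<in> R" using u' uv by (auto simp: R_def)
    ultimately show "\<exists>e'\<in>R. e = ?\<sigma> e'" by blast
  qed
  have inv: "Pi_pmf R 0 (\<lambda>_. sign_pmf p) = map_pmf (\<lambda>f. f \<circ> ?\<sigma>) (Pi_pmf R 0 (\<lambda>_. sign_pmf p))"
    using finR bij R_iff by (intro Pi_pmf_bij_betw) auto
  have F_eq: "F g D (f \<circ> ?\<sigma>) = F g D' f" for f
  proof (rule antisym)
    let ?w = "wt (splice R (f \<circ> ?\<sigma>) g)" and ?w' = "wt (splice R f g)"
    have w: "?w {u, v} = ?w' {\<pi> u, v}" if "u \<in> C" "v \<in> V" for u v
    proof -
      have "{\<pi> u, v} = ?\<sigma> {u, v}" using \<pi>V that by auto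
      moreover have "{u, v} \<in> R" "?\<sigma> {u, v} \<in> R" using img that by (auto simp: R_def)
      ultimately show ?thesis by (simp add: wt_def splice_def)
    qed
    have w0: "?w {u, v} = ?w' {u, v}" if "u \<in> V" "v \<in> V" for u v
    proof -
      have "{u, v} \<notin> R" using that CV(3) by (auto simp: R_def doubleton_eq_iff)
      then show ?thesis by (simp add: wt_def splice_def)
    qed
    show "F g D (f \<circ> ?\<sigma>) \<le> F g D' f"
      unfolding F_def \<pi>(2)[symmetric] using w w0 assms \<pi> \<pi>V CV(3) h
      by (intro best_placement_permute[OF finV finC]) auto
    \<comment> \<open>The other inequality is the same argument for the inverse permutation.\<close>
    define \<rho> where "\<rho> = inv \<pi>"
    have surjpi: "\<pi> (\<rho> x) = x" for x
    proof -
      have "x \<in> \<pi> ` C \<or> \<pi> x = x" using \<pi>(1,3) by (auto simp: bij_betw_def)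
      then have "x \<in> range \<pi>" by (metis imageE rangeI)
      then show ?thesis by (simp add: \<rho>_def f_inv_into_f)
    qed
    have \<rho>pi: "\<rho> (\<pi> x) = x" for x using injpi by (simp add: \<rho>_def)
    have \<rho>C: "bij_betw \<rho> C C"
    proof (rule bij_betw_byWitness[where f' = \<pi>])
      have "\<rho> ` C = \<rho> ` \<pi> ` C" using \<pi>(1) by (simp add: bij_betw_def)
      then show "\<rho> ` C \<subseteq> C" by (simp add: image_image \<rho>pi)
      show "\<pi> ` C \<subseteq> C" using \<pi>(1) by (simp add: bij_betw_def)
    qed (simp_all add: \<rho>pi surjpi)
    have \<rho>V: "\<rho> v = v" if "v \<in> V" for v using \<rho>pi[of v] \<pi>V[OF that] by simp
    have \<rho>D: "\<rho> ` D' = D" unfolding \<pi>(2)[symmetric] by (auto simp: \<rho>pi image_image)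
    show "F g D' f \<le> F g D (f \<circ> ?\<sigma>)"
      unfolding F_def \<rho>D[symmetric]
    proof (rule best_placement_permute[OF finV finC CV(3) assms(2) \<rho>C \<rho>V])
      fix u v assume uv: "u \<in> C" "v \<in> V"
      then have "\<rho> u \<in> C" using \<rho>C by (auto simp: bij_betw_def)
      then show "?w' {u, v} = ?w {\<rho> u, v}" using w[of "\<rho> u" v] uv surjpi by simp
    qed (use w0 h in auto)
  qed
  have "measure_pmf.expectation (Pi_pmf R 0 (\<lambda>_. sign_pmf p)) (\<lambda>f. exp (l * F g D f)) =
     measure_pmf.expectation (Pi_pmf R 0 (\<lambda>_. sign_pmf p)) (\<lambda>f. exp (l * F g D' f))" for l
    by (subst inv) (simp add: integral_map_pmf F_eq)
  then show ?thesis by (simp add: center_def)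
qed

text \<open>For sets of equal size both maxima lie near the same centre. At most
  \<open>4 ^ s\<close> sets have to be controlled at once, against an exponent quadratic in
  \<open>s\<close>.\<close>

lemma exchange_prob:
  shows "measure_pmf.prob (answer_table n p G)
    {w. \<exists>D D'. D \<subseteq> C \<and> D' \<subseteq> C \<and> card D = card D' \<and>
       best_placement (wt w) V D (2 * real s) h > best_placement (wt w) V D' (2 * real s) h + \<epsilon> * real s ^ 2}
    \<le> 4 ^ s * (2 * exp (- (\<epsilon>\<^sup>2 * real s ^ 2 / 256)))"
proof -
  let ?rest = "all_pairs n - R"
  let ?A = "Pi_pmf R 0 (\<lambda>_. sign_pmf p)" and ?B = "Pi_pmf ?rest 0 (noisy_answer p G)"
  let ?bad = "\<lambda>w. \<exists>D D'. D \<subseteq> C \<and> D' \<subseteq> C \<and> card D = card D' \<and>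
       best_placement (wt w) V D (2 * real s) h > best_placement (wt w) V D' (2 * real s) h + \<epsilon> * real s ^ 2"
  have "noisy_answer p G e = sign_pmf p" if "e \<in> R" for e
  proof -
    have "correct_answer G e = -1" using that foreign by (auto simp: R_def)
    then show ?thesis unfolding noisy_answer_def sign_pmf_def by (intro map_pmf_cong) auto
  qed
  then have A: "Pi_pmf R 0 (noisy_answer p G) = ?A" by (intro Pi_pmf_cong) auto
  have "all_pairs n = R \<union> ?rest" using R_sub by auto
  then have "answer_table n p G = map_pmf (\<lambda>(f, g) x. if x \<in> R then f x else g x) (pair_pmf ?A ?B)"
    unfolding answer_table_def using Pi_pmf_union[of R ?rest 0 "noisy_answer p G"] finR A by simp
  also have "(\<lambda>(f, g) x. if x \<in> R then f x else g x) = (\<lambda>(f, g). splice R f g)"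
    by (auto simp: splice_def fun_eq_iff)
  finally have "measure_pmf.prob (answer_table n p G) {w. ?bad w} =
     measure_pmf.prob (pair_pmf ?A ?B) {z. ?bad (splice R (fst z) (snd z))}"
    by (simp add: vimage_def case_prod_beta')
  also have "\<dots> \<le> 4 ^ s * (2 * exp (- (\<epsilon>\<^sup>2 * real s ^ 2 / 256)))"
  proof (rule prob_pair_le)
    fix g
    have "{f. ?bad (splice R f g)} \<subseteq> (\<Union>D\<in>Pow C. {f. \<bar>F g D f - center g D\<bar> \<ge> \<epsilon> * real s ^ 2 / 2})"
    proof
      fix f assume "f \<in> {f. ?bad (splice R f g)}"
      then obtain D D' where D: "D \<subseteq> C" "D' \<subseteq> C" "card D = card D'" "F g D f > F g D' f + \<epsilon> * real s ^ 2"
        by (auto simp: F_def)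
      then have "\<bar>F g D f - center g D\<bar> \<ge> \<epsilon> * real s ^ 2 / 2 \<or> \<bar>F g D' f - center g D'\<bar> \<ge> \<epsilon> * real s ^ 2 / 2"
        using center_eq[OF D(1-3), of g] by linarith
      then show "f \<in> (\<Union>D\<in>Pow C. {f. \<bar>F g D f - center g D\<bar> \<ge> \<epsilon> * real s ^ 2 / 2})" using D by auto
    qed
    then have "measure_pmf.prob ?A {f. ?bad (splice R f g)} \<le>
      measure_pmf.prob ?A (\<Union>D\<in>Pow C. {f. \<bar>F g D f - center g D\<bar> \<ge> \<epsilon> * real s ^ 2 / 2})"
      by (intro measure_pmf.finite_measure_mono) auto
    also have "\<dots> \<le> (\<Sum>D\<in>Pow C. 2 * exp (- (\<epsilon>\<^sup>2 * real s ^ 2 / 256)))"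
      using finC F_concentration by (intro prob_Union_le) auto
    also have "\<dots> = 2 ^ card C * (2 * exp (- (\<epsilon>\<^sup>2 * real s ^ 2 / 256)))"
      using finC by (simp add: card_Pow)
    also have "\<dots> \<le> 2 ^ (2 * s) * (2 * exp (- (\<epsilon>\<^sup>2 * real s ^ 2 / 256)))"
      using s by (intro mult_right_mono power_increasing) auto
    finally show "measure_pmf.prob ?A {f. ?bad (splice R f g)} \<le> 4 ^ s * (2 * exp (- (\<epsilon>\<^sup>2 * real s ^ 2 / 256)))"
      by (simp add: power_mult)
  qed
  finally show ?thesis .
qed

end

section \<open>Typical answer tables have high probability\<close>

text \<open>Traces on \<open>U\<close>, the set of treated vertices: they act as the clusters of the
  subgraph on \<open>U\<close>, to which the structural theorem is applied as well.\<close>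

definition clusters :: "nat set set \<Rightarrow> nat set \<Rightarrow> nat set set" where
  "clusters G U = (\<lambda>S. S \<inter> U) ` G - {{}}"

lemma partition_on_clusters:
  assumes "partition_on {1..n} G" "U \<subseteq> {1..n}"
  shows "partition_on U (clusters G U)"
  unfolding clusters_def
proof (rule partition_on_image)
  show "disjoint_family_on (\<lambda>S. S \<inter> U) G"
    unfolding disjoint_family_on_def using disjointD[OF partition_onD2[OF assms(1)]] by blast
  show "(\<Union>S\<in>G. S \<inter> U) = U" using assms partition_onD1[OF assms(1)] by blast
qed

lemma correct_answer_eq:
  assumes "partition_on {1..n} G" "S \<in> G" "x \<in> S"
  shows "correct_answer G {x, y} = (if y \<in> S then 1 else -1)"
proof -
  have "S' = S" if "S' \<in> G" "x \<in> S'" for S'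
    using disjointD[OF partition_onD2[OF assms(1)] that(1) assms(2)] that(2) assms(3) by blast
  then have "(\<exists>S'\<in>G. {x, y} \<subseteq> S') \<longleftrightarrow> y \<in> S" using assms(2,3) by blast
  then show ?thesis by (simp add: correct_answer_def)
qed

lemma correct_answer_neg:
  assumes "\<And>S. S \<in> G \<Longrightarrow> x \<notin> S \<or> y \<notin> S"
  shows "correct_answer G {x, y} = -1"
proof -
  have "\<not> (\<exists>S\<in>G. {x, y} \<subseteq> S)" using assms by blast
  then show ?thesis by (simp add: correct_answer_def)
qed

text \<open>The second part also covers vertices outside \<open>U\<close>: the votes of a large
  trace decide which vertices belong to its cluster. Removing \<open>v\<close> is necessary because
  it has no answer with itself.\<close>

definition good :: "nat \<Rightarrow> nat set set \<Rightarrow> nat set \<Rightarrow> real \<Rightarrow> real \<Rightarrow> real \<Rightarrow> (nat set \<Rightarrow> int) \<Rightarrow> bool" where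
  "good n G U \<mu> \<epsilon> K w \<longleftrightarrow> typical_weights (wt w) U (clusters G U) \<mu> \<epsilon> K \<and>
     (\<forall>S\<in>G. \<forall>v\<in>{1..n}. K \<le> card (S \<inter> U - {v}) \<longrightarrow>
        (v \<in> S \<longrightarrow> 0 < cut (wt w) {v} (S \<inter> U - {v})) \<and> (v \<notin> S \<longrightarrow> cut (wt w) {v} (S \<inter> U - {v}) < 0))"

locale answer_setting =
  fixes n :: nat and \<mu> \<epsilon> K p :: real and G :: "nat set set" and U :: "nat set"
  assumes n_pos: "0 < n" and G: "partition_on {1..n} G" and U: "U \<subseteq> {1..n}" and \<mu>: "0 < \<mu>" "\<mu> \<le> 1"
    and \<epsilon>: "0 < \<epsilon>" "\<epsilon> \<le> \<mu> ^ 5 / 400000" and K: "1024 / \<epsilon>\<^sup>2 \<le> K" and p: "0 \<le> p" "p \<le> 1" "1 - 2 * p = \<mu>"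
begin

text \<open>The price per vertex in the union bounds. With \<open>K\<close> of order log n it is a
  negative power of \<open>n\<close>.\<close>

definition q where "q = exp (- (\<epsilon>\<^sup>2 / 512 * K))"
definition Ne where "Ne = Pow {1..n} - {{}}"
text \<open>The index sets \<open>I1\<close> to \<open>I5\<close> and the bad events
  \<open>B1\<close> to \<open>B5\<close> belong to the conditions of \<open>good\<close>; the sets
  are finite and independent of the answers.\<close>

definition I1 where "I1 c = {(X, Y). X \<in> Ne \<and> Y \<in> Ne \<and> X \<inter> Y = {} \<and> K \<le> card X \<and> K \<le> card Y \<and>
   (\<forall>x\<in>X. \<forall>y\<in>Y. correct_answer G {x, y} = c)}"
definition B1 where "B1 c z w \<longleftrightarrow> (case z of (X, Y) \<Rightarrow>
   \<mu> / 2 * (real (card X) * real (card Y)) \<le> \<bar>cut (wt w) X Y - \<mu> * real_of_int c * (real (card X) * real (card Y))\<bar>)"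
definition I2 where "I2 = {X \<in> Ne. K \<le> card X \<and> (\<forall>x\<in>X. \<forall>y\<in>X. correct_answer G {x, y} = 1)}"
definition B2 where "B2 X w \<longleftrightarrow> \<epsilon> / 2 * real (card X) ^ 2 \<le> \<bar>cut (wt w) X X - \<mu> * (real (card X) * (real (card X) - 1))\<bar>"
definition I3 where "I3 = {(S, A). S \<in> clusters G U \<and> A \<in> Ne \<and> A \<subseteq> S \<and> K \<le> card (S - A)}"
definition B3 where "B3 z w \<longleftrightarrow> (case z of (S, A) \<Rightarrow> \<mu> / 2 * (real (card A) * real (card (S - A)))
   \<le> \<bar>cut (wt w) A (S - A) - \<mu> * (real (card A) * real (card (S - A)))\<bar>)"
definition I4 where "I4 = {(S, v). S \<in> G \<and> v \<in> {1..n} \<and> K \<le> card (S \<inter> U - {v})}"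
definition B4 where "B4 z w \<longleftrightarrow> (case z of (S, v) \<Rightarrow> \<mu> / 2 * real (card (S \<inter> U - {v}))
   \<le> \<bar>cut (wt w) {v} (S \<inter> U - {v}) - \<mu> * (if v \<in> S then 1 else -1) * real (card (S \<inter> U - {v}))\<bar>)"
definition I5 where "I5 = {(S1, S2, s). S1 \<in> clusters G U \<and> S2 \<in> clusters G U \<and> s \<in> {1..n} \<and> S1 \<noteq> S2 \<and>
   card S1 \<le> s \<and> card S2 \<le> s \<and> K \<le> real s}"
definition B5 where "B5 z w \<longleftrightarrow> (case z of (S1, S2, s) \<Rightarrow> \<exists>D D'. D \<subseteq> S1 \<union> S2 \<and> D' \<subseteq> S1 \<union> S2 \<and> card D = card D' \<and>
   best_placement (wt w) (U - (S1 \<union> S2)) D (2 * real s) (16 * K / \<mu>)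
     > best_placement (wt w) (U - (S1 \<union> S2)) D' (2 * real s) (16 * K / \<mu>) + \<epsilon> * real s ^ 2)"

section \<open>Probabilities of the bad events\<close>

lemma \<mu>5: "\<mu> ^ 5 \<le> \<mu>" "\<mu> ^ 5 \<le> 1"
  using \<mu> power_decreasing[of 1 5 \<mu>] power_le_one[of \<mu> 5] by auto

lemma \<epsilon>_le: "\<epsilon> \<le> \<mu>" "\<epsilon> \<le> 1"
  using \<epsilon> \<mu>5 \<mu> by linarith+

lemma \<epsilon>2: "0 < \<epsilon>\<^sup>2" "\<epsilon>\<^sup>2 \<le> \<mu>\<^sup>2" "\<epsilon>\<^sup>2 \<le> 1" "\<epsilon>\<^sup>2 \<le> \<epsilon>"
  using \<epsilon> \<epsilon>_le power_mono[of \<epsilon> \<mu> 2] power_le_one[of \<epsilon> 2] power_decreasing[of 1 2 \<epsilon>] by auto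

lemma \<epsilon>2': "\<epsilon>\<^sup>2 \<le> \<mu>\<^sup>2 * 32" "\<epsilon>\<^sup>2 \<le> \<mu>\<^sup>2 * 64"
  using \<epsilon>2(2) zero_le_power2[of \<mu>] by linarith+

lemma K_ge: "1024 \<le> K" "2 / \<epsilon> \<le> K" "1024 \<le> \<epsilon>\<^sup>2 * K"
proof -
  show 1: "1024 \<le> \<epsilon>\<^sup>2 * K" using K \<epsilon>2(1) by (simp add: field_simps)
  have "2 / \<epsilon> \<le> 1024 / \<epsilon>\<^sup>2" using \<epsilon>2 \<epsilon> by (intro frac_le) auto
  then show "2 / \<epsilon> \<le> K" using K by linarith
  have "1024 / 1 \<le> 1024 / \<epsilon>\<^sup>2" using \<epsilon>2 by (intro frac_le) auto
  then show "1024 \<le> K" using K by linarith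
qed

lemma q_power: "q ^ m = exp (- (\<epsilon>\<^sup>2 / 512 * K * real m))"
  unfolding q_def by (simp add: mult_ac flip: exp_of_nat_mult)

lemma q_pos: "0 < q" by (simp add: q_def)

lemma finNe: "finite Ne" by (simp add: Ne_def)

lemma sum_Ne: "real n * q \<le> 1 \<Longrightarrow> (\<Sum>X\<in>Ne. q ^ card X) \<le> 2 * real n * q"
  unfolding Ne_def using q_pos by (intro sum_nonempty_subsets) auto

lemma finG: "finite G" using finite_elements[OF _ G] by simp

lemma card_G: "card G \<le> n"
proof -
  have "card G \<le> card {1..n}"
  proof (rule surj_card_le)
    show "finite {1..n}" by simp
    have "\<exists>x\<in>{1..n}. S = (THE S. S \<in> G \<and> x \<in> S)" if S: "S \<in> G" for S
    proof -
      have "S \<noteq> {}" using S partition_onD3[OF G] by blast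
      then obtain x where x: "x \<in> S" by blast
      have "(THE S. S \<in> G \<and> x \<in> S) = S"
        using S x disjointD[OF partition_onD2[OF G] _ S] by (intro the_equality) blast+
      moreover have "x \<in> {1..n}" using G S x by (auto simp: partition_on_def)
      ultimately show ?thesis by metis
    qed
    then show "G \<subseteq> (\<lambda>x. THE S. S \<in> G \<and> x \<in> S) ` {1..n}" by blast
  qed
  then show ?thesis by simp
qed

lemma clusters_bound: "finite (clusters G U)" "card (clusters G U) \<le> n"
proof -
  show "finite (clusters G U)" using finG by (simp add: clusters_def)
  have "card (clusters G U) \<le> card ((\<lambda>S. S \<inter> U) ` G)" unfolding clusters_def using finG by (intro card_mono) auto
  also have "\<dots> \<le> card G" using finG by (rule card_image_le)
  finally show "card (clusters G U) \<le> n" using card_G by simp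
qed

abbreviation T where "T \<equiv> answer_table n p G"

lemma Ne_card: "X \<in> Ne \<Longrightarrow> 0 < card X" "X \<in> Ne \<Longrightarrow> X \<subseteq> {1..n}" "X \<in> Ne \<Longrightarrow> finite X"
  by (auto simp: Ne_def card_gt_0_iff intro: finite_subset)

lemma exp_bound_aux: "real m * K \<le> x \<Longrightarrow> exp (- (\<mu>\<^sup>2 * x / 8)) \<le> q ^ m"
proof -
  assume x: "real m * K \<le> x"
  have "\<epsilon>\<^sup>2 / 512 * (K * real m) \<le> \<mu>\<^sup>2 / 8 * (K * real m)" using \<epsilon>2' K_ge by (intro mult_right_mono) auto
  also have "\<dots> \<le> \<mu>\<^sup>2 / 8 * x" using x by (intro mult_left_mono) (auto simp: mult.commute)
  finally show ?thesis by (simp add: q_power)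
qed

lemma prob_cut: assumes nq: "real n * q \<le> 1"
  shows "measure_pmf.prob T (\<Union>z\<in>I1 c. {w. B1 c z w}) \<le> 8 * (real n * q)"
proof -
  have "measure_pmf.prob T (\<Union>z\<in>I1 c. {w. B1 c z w}) \<le> (\<Sum>z\<in>I1 c. 2 * (q ^ card (fst z) * q ^ card (snd z)))"
  proof (rule prob_Union_le)
    show "finite (I1 c)" by (rule finite_subset[of _ "Ne \<times> Ne"]) (auto simp: I1_def finNe)
    fix z assume z: "z \<in> I1 c"
    then obtain X Y where XY: "z = (X, Y)" "X \<in> Ne" "Y \<in> Ne" "X \<inter> Y = {}" "K \<le> card X" "K \<le> card Y"
      "\<And>x y. x \<in> X \<Longrightarrow> y \<in> Y \<Longrightarrow> correct_answer G {x, y} = c" by (auto simp: I1_def)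
    let ?m = "real (card X) * real (card Y)"
    have m: "0 < ?m" using Ne_card XY by simp
    have "measure_pmf.prob T {w. \<mu> / 2 * ?m \<le> \<bar>cut (wt w) X Y - (1 - 2 * p) * real_of_int c * ?m\<bar>} \<le> 2 * exp (- (\<mu> / 2 * ?m)\<^sup>2 / (2 * ?m))"
      using XY Ne_card m \<mu> by (intro cut_hoeffding p) auto
    also have "- (\<mu> / 2 * ?m)\<^sup>2 / (2 * ?m) = - (\<mu>\<^sup>2 * ?m / 8)" using m by (simp add: power2_eq_square field_simps)
    \<comment> \<open>As both sets have at least \<open>K\<close> vertices, one half of the exponent
      pays for the vertices of \<open>X\<close> and the other for those of \<open>Y\<close>.\<close>
    also have "exp (- (\<mu>\<^sup>2 * ?m / 8)) = exp (- (\<mu>\<^sup>2 * (?m / 2) / 8)) * exp (- (\<mu>\<^sup>2 * (?m / 2) / 8))"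
      by (simp flip: exp_add)
    also have "\<dots> \<le> q ^ card X * q ^ card Y" if a: True
    proof -
      have e: "\<epsilon>\<^sup>2 / 512 * K * real k \<le> \<mu>\<^sup>2 * (?m / 2) / 8" if "real k * K \<le> ?m" for k
      proof -
        have "\<epsilon>\<^sup>2 / 512 * (K * real k) \<le> \<mu>\<^sup>2 / 16 * (K * real k)" using \<epsilon>2' K_ge by (intro mult_right_mono) auto
        also have "\<dots> \<le> \<mu>\<^sup>2 / 16 * ?m" using that by (intro mult_left_mono) (auto simp: mult.commute)
        finally show ?thesis by simp
      qed
      have "real (card X) * K \<le> ?m" "real (card Y) * K \<le> ?m" using mult_left_mono[OF XY(6), of "real (card X)"] mult_right_mono[OF XY(5), of "real (card Y)"]
        by (simp_all add: mult.commute)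
      then show ?thesis unfolding q_power using e by (intro mult_mono) auto
    qed
    finally show "measure_pmf.prob T {w. B1 c z w} \<le> 2 * (q ^ card (fst z) * q ^ card (snd z))"
      using p(3) by (simp add: B1_def XY(1))
  qed
  also have "\<dots> \<le> (\<Sum>z\<in>Ne \<times> Ne. 2 * (q ^ card (fst z) * q ^ card (snd z)))"
    using q_pos finNe by (intro sum_mono2) (auto simp: I1_def)
  also have "\<dots> = 2 * ((\<Sum>X\<in>Ne. q ^ card X) * (\<Sum>Y\<in>Ne. q ^ card Y))"
  proof -
    have "(\<Sum>z\<in>Ne \<times> Ne. q ^ card (fst z) * q ^ card (snd z)) = (\<Sum>X\<in>Ne. q ^ card X) * (\<Sum>Y\<in>Ne. q ^ card Y)"
      unfolding sum_product sum.cartesian_product by (simp add: case_prod_beta')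
    then show ?thesis unfolding sum_distrib_left[symmetric] by simp
  qed
  also have "\<dots> \<le> 2 * ((2 * real n * q) * (2 * real n * q))"
    using sum_Ne[OF nq] q_pos by (intro mult_left_mono mult_mono sum_nonneg) auto
  also have "\<dots> = 8 * ((real n * q) * (real n * q))" by simp
  also have "\<dots> \<le> 8 * (1 * (real n * q))" using nq q_pos by (intro mult_left_mono mult_right_mono) auto
  finally show ?thesis by simp
qed

lemma prob_inner: assumes nq: "real n * q \<le> 1"
  shows "measure_pmf.prob T (\<Union>X\<in>I2. {w. B2 X w}) \<le> 4 * (real n * q)"
proof -
  have "measure_pmf.prob T (\<Union>X\<in>I2. {w. B2 X w}) \<le> (\<Sum>X\<in>I2. 2 * q ^ card X)"
  proof (rule prob_Union_le)
    show "finite I2" using finNe by (simp add: I2_def)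
    fix X assume "X \<in> I2"
    then have X: "X \<in> Ne" "K \<le> card X" "\<And>x y. x \<in> X \<Longrightarrow> y \<in> X \<Longrightarrow> correct_answer G {x, y} = 1" by (auto simp: I2_def)
    let ?m = "real (card X)"
    have m: "0 < ?m" using Ne_card X by simp
    have "measure_pmf.prob T {w. \<epsilon> / 2 * ?m\<^sup>2 \<le> \<bar>cut (wt w) X X - (1 - 2 * p) * (?m * (?m - 1))\<bar>}
        \<le> 2 * exp (- (\<epsilon> / 2 * ?m\<^sup>2)\<^sup>2 / (4 * ?m\<^sup>2))"
    proof (rule cut_self_hoeffding[OF p(1,2)])
      show "0 < \<epsilon> / 2 * ?m\<^sup>2" using m \<epsilon> by (intro mult_pos_pos) auto
    qed (use X Ne_card in auto)
    also have "- (\<epsilon> / 2 * ?m\<^sup>2)\<^sup>2 / (4 * ?m\<^sup>2) = - (\<epsilon>\<^sup>2 / 16 * (?m * ?m))" using m by (simp add: power2_eq_square field_simps)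
    also have "exp (- (\<epsilon>\<^sup>2 / 16 * (?m * ?m))) \<le> q ^ card X"
    proof -
      have "\<epsilon>\<^sup>2 / 512 * (K * ?m) \<le> \<epsilon>\<^sup>2 / 16 * (?m * ?m)"
        using X K_ge by (intro mult_mono mult_right_mono) auto
      then show ?thesis by (simp add: q_power)
    qed
    finally show "measure_pmf.prob T {w. B2 X w} \<le> 2 * q ^ card X" using p(3) by (simp add: B2_def)
  qed
  also have "\<dots> \<le> (\<Sum>X\<in>Ne. 2 * q ^ card X)" using q_pos finNe by (intro sum_mono2) (auto simp: I2_def)
  also have "\<dots> = 2 * (\<Sum>X\<in>Ne. q ^ card X)" by (simp add: sum_distrib_left)
  also have "\<dots> \<le> 4 * (real n * q)" using sum_Ne[OF nq] by simp
  finally show ?thesis .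
qed

text \<open>The large side of the cut supplies the factor \<open>K\<close>, so the exponent grows
  with \<open>card A\<close> and even single vertices are covered. One further factor
  \<open>n\<close> pays for the choice of the cluster.\<close>

lemma prob_small_cut: assumes nq: "real n * q \<le> 1"
  shows "measure_pmf.prob T (\<Union>z\<in>I3. {w. B3 z w}) \<le> 4 * (real n ^ 2 * q)"
proof -
  have "measure_pmf.prob T (\<Union>z\<in>I3. {w. B3 z w}) \<le> (\<Sum>z\<in>I3. 2 * q ^ card (snd z))"
  proof (rule prob_Union_le)
    show "finite I3" by (rule finite_subset[of _ "clusters G U \<times> Ne"]) (auto simp: I3_def finNe clusters_bound)
    fix z assume z: "z \<in> I3"
    then obtain S A where SA: "z = (S, A)" "S \<in> clusters G U" "A \<in> Ne" "A \<subseteq> S" "K \<le> card (S - A)" by (auto simp: I3_def)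
    obtain S0 where S0: "S0 \<in> G" "S = S0 \<inter> U" using SA by (auto simp: clusters_def)
    let ?m = "real (card A) * real (card (S - A))"
    have m: "0 < ?m" using Ne_card(1)[OF SA(3)] SA K_ge by auto
    have c: "correct_answer G {x, y} = 1" if "x \<in> A" "y \<in> S - A" for x y
      using correct_answer_eq[OF G S0(1), of x y] that SA S0 by auto
    have "measure_pmf.prob T {w. \<mu> / 2 * ?m \<le> \<bar>cut (wt w) A (S - A) - (1 - 2 * p) * real_of_int 1 * ?m\<bar>} \<le> 2 * exp (- (\<mu> / 2 * ?m)\<^sup>2 / (2 * ?m))"
      using SA S0 U Ne_card m \<mu> c by (intro cut_hoeffding p) auto
    also have "- (\<mu> / 2 * ?m)\<^sup>2 / (2 * ?m) = - (\<mu>\<^sup>2 * ?m / 8)" using m by (simp add: power2_eq_square field_simps)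
    also have "exp (- (\<mu>\<^sup>2 * ?m / 8)) \<le> q ^ card A" using SA by (intro exp_bound_aux mult_left_mono) auto
    finally show "measure_pmf.prob T {w. B3 z w} \<le> 2 * q ^ card (snd z)" using p(3) by (simp add: B3_def SA(1))
  qed
  also have "\<dots> \<le> (\<Sum>z\<in>clusters G U \<times> Ne. 2 * q ^ card (snd z))"
    using q_pos finNe clusters_bound by (intro sum_mono2) (auto simp: I3_def)
  also have "\<dots> = real (card (clusters G U)) * (2 * (\<Sum>X\<in>Ne. q ^ card X))"
    unfolding case_prod_beta'[symmetric] using sum.cartesian_product[of "\<lambda>_ X. 2 * q ^ card X" Ne "clusters G U"]
    by (simp add: sum_distrib_left case_prod_beta')
  also have "\<dots> \<le> real n * (2 * (2 * real n * q))"
    using sum_Ne[OF nq] clusters_bound q_pos by (intro mult_mono mult_left_mono) (auto intro!: sum_nonneg)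
  finally show ?thesis by (simp add: power2_eq_square)
qed

lemma prob_star: "measure_pmf.prob T (\<Union>z\<in>I4. {w. B4 z w}) \<le> 2 * (real n ^ 2 * q)"
proof -
  have "measure_pmf.prob T (\<Union>z\<in>I4. {w. B4 z w}) \<le> (\<Sum>z\<in>I4. 2 * q)"
  proof (rule prob_Union_le)
    show "finite I4" by (rule finite_subset[of _ "G \<times> {1..n}"]) (auto simp: I4_def finG)
    fix z assume z: "z \<in> I4"
    then obtain S v where Sv: "z = (S, v)" "S \<in> G" "v \<in> {1..n}" "K \<le> card (S \<inter> U - {v})" by (auto simp: I4_def)
    let ?m = "real (card (S \<inter> U - {v}))" and ?c = "if v \<in> S then 1 else -1 :: int"
    have m: "0 < ?m" using Sv K_ge by linarith
    have c: "correct_answer G {x, y} = ?c" if "x \<in> {v}" "y \<in> S \<inter> U - {v}" for x y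
      using correct_answer_eq[OF G Sv(2), of y x] that by (auto simp: insert_commute)
    have "measure_pmf.prob T {w. \<mu> / 2 * ?m \<le> \<bar>cut (wt w) {v} (S \<inter> U - {v}) - (1 - 2 * p) * real_of_int ?c * (real (card {v}) * ?m)\<bar>}
       \<le> 2 * exp (- (\<mu> / 2 * ?m)\<^sup>2 / (2 * (real (card {v}) * ?m)))"
      using Sv U m \<mu> c by (intro cut_hoeffding p) auto
    also have "- (\<mu> / 2 * ?m)\<^sup>2 / (2 * (real (card {v}) * ?m)) = - (\<mu>\<^sup>2 * ?m / 8)" using m by (simp add: power2_eq_square field_simps)
    also have "exp (- (\<mu>\<^sup>2 * ?m / 8)) \<le> q ^ 1" using Sv by (intro exp_bound_aux) auto
    finally show "measure_pmf.prob T {w. B4 z w} \<le> 2 * q" using p(3) by (cases "v \<in> S") (simp_all add: B4_def Sv(1))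
  qed
  also have "\<dots> \<le> (\<Sum>z\<in>G \<times> {1..n}. 2 * q)" using q_pos finG by (intro sum_mono2) (auto simp: I4_def)
  also have "\<dots> = real (card G) * real n * (2 * q)" by (simp add: card_cartesian_product)
  also have "\<dots> \<le> real n * real n * (2 * q)" using card_G q_pos by (intro mult_right_mono) auto
  finally show ?thesis by (simp add: power2_eq_square)
qed

text \<open>One half of the exponent \<open>\<epsilon>\<^sup>2 * s ^ 2 / 256\<close> cancels the
  \<open>4 ^ s\<close> sets because \<open>\<epsilon>\<^sup>2 * K \<ge> 1024\<close>; the other half
  is at least the exponent of \<open>q\<close>.\<close>

lemma prob_exchange: "measure_pmf.prob T (\<Union>z\<in>I5. {w. B5 z w}) \<le> 2 * (real n ^ 3 * q)"
proof -
  have "measure_pmf.prob T (\<Union>z\<in>I5. {w. B5 z w}) \<le> (\<Sum>z\<in>I5. 2 * q)"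
  proof (rule prob_Union_le)
    show "finite I5" by (rule finite_subset[of _ "clusters G U \<times> clusters G U \<times> {1..n}"]) (auto simp: I5_def clusters_bound)
    fix z assume z: "z \<in> I5"
    then obtain S1 S2 s where S: "z = (S1, S2, s)" "S1 \<in> clusters G U" "S2 \<in> clusters G U" "s \<in> {1..n}" "S1 \<noteq> S2"
      "card S1 \<le> s" "card S2 \<le> s" "K \<le> real s" by (auto simp: I5_def)
    obtain S1' S2' where S': "S1' \<in> G" "S1 = S1' \<inter> U" "S2' \<in> G" "S2 = S2' \<inter> U" using S by (auto simp: clusters_def)
    interpret exchange_setting n p G "S1 \<union> S2" "U - (S1 \<union> S2)" s "16 * K / \<mu>" \<epsilon>
    proof unfold_locales
      show "correct_answer G {u, v} = -1" if uv: "u \<in> S1 \<union> S2" "v \<in> U - (S1 \<union> S2)" for u v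
      proof -
        have "correct_answer G {u, v} = -1" if "u \<in> S0" "S0 \<in> G" "v \<notin> S0" for S0
          using correct_answer_eq[OF G that(2,1), of v] that by simp
        then show ?thesis using uv S' by blast
      qed
      show "card (S1 \<union> S2) \<le> 2 * s" using S card_Un_le[of S1 S2] by simp
    qed (use p S S' U \<mu> \<epsilon> K_ge in auto)
    have "measure_pmf.prob T {w. B5 z w} \<le> 4 ^ s * (2 * exp (- (\<epsilon>\<^sup>2 * real s ^ 2 / 256)))"
      using exchange_prob by (simp add: B5_def S(1))
    also have "\<dots> \<le> exp (2 * real s) * (2 * exp (- (\<epsilon>\<^sup>2 * real s ^ 2 / 256)))"
    proof (intro mult_right_mono)
      have "(4 :: real) \<le> exp 2"
      proof -
        have "(1 + 1) ^ 2 \<le> (exp 1 :: real) ^ 2" by (intro power_mono exp_ge_add_one_self) auto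
        then show ?thesis by (simp flip: exp_of_nat_mult)
      qed
      then have "4 ^ s \<le> (exp 2 :: real) ^ s" by (intro power_mono) auto
      then show "4 ^ s \<le> exp (2 * real s)" by (simp add: mult.commute flip: exp_of_nat_mult)
    qed auto
    also have "\<dots> = 2 * exp (2 * real s - \<epsilon>\<^sup>2 * real s ^ 2 / 256)" by (simp flip: exp_add)
    also have "\<dots> \<le> 2 * q"
    proof -
      have "\<epsilon>\<^sup>2 * K * real s \<le> \<epsilon>\<^sup>2 * real s * real s" using S \<epsilon>2 by (intro mult_right_mono mult_left_mono) auto
      then have 1: "\<epsilon>\<^sup>2 * K * real s \<le> \<epsilon>\<^sup>2 * real s ^ 2" by (simp add: power2_eq_square mult_ac)
      have 2: "1024 * real s \<le> \<epsilon>\<^sup>2 * K * real s" using K_ge by (intro mult_right_mono) auto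
      have "\<epsilon>\<^sup>2 * K * 1 \<le> \<epsilon>\<^sup>2 * K * real s" using S \<epsilon>2 K_ge by (intro mult_left_mono) auto
      then have "2 * real s - \<epsilon>\<^sup>2 * real s ^ 2 / 256 \<le> - (\<epsilon>\<^sup>2 / 512 * K)" using 1 2 by simp
      then show ?thesis by (simp add: q_def)
    qed
    finally show "measure_pmf.prob T {w. B5 z w} \<le> 2 * q" .
  qed
  also have "\<dots> \<le> (\<Sum>z\<in>clusters G U \<times> clusters G U \<times> {1..n}. 2 * q)"
    using q_pos clusters_bound by (intro sum_mono2) (auto simp: I5_def)
  also have "\<dots> = real (card (clusters G U)) * (real (card (clusters G U)) * real n) * (2 * q)" by (simp add: card_cartesian_product)
  also have "\<dots> \<le> real n * (real n * real n) * (2 * q)"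
    using clusters_bound q_pos by (intro mult_right_mono mult_mono) auto
  finally show ?thesis by (simp add: power3_eq_cube)
qed

lemma good_if:
  assumes w: "\<And>e. e \<in> all_pairs n \<Longrightarrow> w e \<in> {-1, 1}"
    and n1: "\<And>z c. c \<in> {-1, 1} \<Longrightarrow> z \<in> I1 c \<Longrightarrow> \<not> B1 c z w" and n2: "\<And>X. X \<in> I2 \<Longrightarrow> \<not> B2 X w"
    and n3: "\<And>z. z \<in> I3 \<Longrightarrow> \<not> B3 z w" and n4: "\<And>z. z \<in> I4 \<Longrightarrow> \<not> B4 z w" and n5: "\<And>z. z \<in> I5 \<Longrightarrow> \<not> B5 z w"
  shows "good n G U \<mu> \<epsilon> K w"
  unfolding good_def
proof (intro conjI ballI impI)
  have finU: "finite U" using U finite_subset by blast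
  have NeI: "X \<in> Ne" if "X \<subseteq> U" "K \<le> card X" for X
    using that U K_ge by (auto simp: Ne_def)
  have Cl: "\<exists>S0\<in>G. S = S0 \<inter> U" if "S \<in> clusters G U" for S using that by (auto simp: clusters_def)
  have same: "correct_answer G {x, y} = 1" if "S \<in> clusters G U" "x \<in> S" "y \<in> S" for S x y
    using Cl[OF that(1)] that correct_answer_eq[OF G] by auto
  show "typical_weights (wt w) U (clusters G U) \<mu> \<epsilon> K"
  proof
    show "partition_on U (clusters G U)" using partition_on_clusters[OF G U] .
    show "\<bar>wt w {a, b}\<bar> \<le> 1" if "a \<in> U" "b \<in> U" "a \<noteq> b" for a b
    proof -
      have "{a, b} \<in> all_pairs n" using that U by (intro pair_in_all_pairs) auto
      from w[OF this] show ?thesis by (auto simp: wt_def)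
    qed
    show "1 \<le> K" using K_ge by simp
  next
    fix X Y :: "nat set"
    assume XY: "X \<subseteq> U" "Y \<subseteq> U" "X \<inter> Y = {}" "K \<le> card X" "K \<le> card Y"
      and hom: "\<And>S. S \<in> clusters G U \<Longrightarrow> X \<inter> S = {} \<or> Y \<inter> S = {}"
    have "correct_answer G {x, y} = -1" if "x \<in> X" "y \<in> Y" for x y
    proof (rule correct_answer_neg)
      fix S assume S: "S \<in> G"
      show "x \<notin> S \<or> y \<notin> S"
      proof (rule ccontr)
        assume "\<not> ?thesis"
        moreover have "x \<in> U" "y \<in> U" using that XY by auto
        ultimately have "S \<inter> U \<in> clusters G U" "x \<in> S \<inter> U" "y \<in> S \<inter> U" using S by (auto simp: clusters_def)
        then show False using hom that by blast
      qed
    qed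
    then have "(X, Y) \<in> I1 (-1)" using XY NeI by (auto simp: I1_def)
    from n1[OF _ this] have "\<bar>cut (wt w) X Y + \<mu> * (real (card X) * real (card Y))\<bar> < \<mu> / 2 * (real (card X) * real (card Y))"
      by (simp add: B1_def not_le)
    moreover have "0 \<le> \<mu> * (real (card X) * real (card Y))" using \<mu> by simp
    ultimately show "cut (wt w) X Y < 0" by linarith
  next
    fix S X Y
    assume XY: "S \<in> clusters G U" "X \<subseteq> S" "Y \<subseteq> S" "X \<inter> Y = {}" "K \<le> card X" "K \<le> card Y"
    have "S \<subseteq> U" using Cl[OF XY(1)] by auto
    then have "(X, Y) \<in> I1 1" using XY NeI same[OF XY(1) subsetD[OF XY(2)] subsetD[OF XY(3)]] by (auto simp: I1_def)
    from n1[OF _ this] have "\<bar>cut (wt w) X Y - \<mu> * (real (card X) * real (card Y))\<bar> < \<mu> / 2 * (real (card X) * real (card Y))"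
      by (simp add: B1_def not_le)
    then show "\<mu> / 2 * real (card X) * real (card Y) \<le> cut (wt w) X Y"
      unfolding mult.assoc by linarith
  next
    fix S X assume X: "S \<in> clusters G U" "X \<subseteq> S" "K \<le> card X"
    have "S \<subseteq> U" using Cl[OF X(1)] by auto
    then have "X \<in> I2" using X NeI same[OF X(1) subsetD[OF X(2)] subsetD[OF X(2)]] by (auto simp: I2_def)
    from n2[OF this] have 1: "\<bar>cut (wt w) X X - \<mu> * (real (card X) * (real (card X) - 1))\<bar> < \<epsilon> / 2 * real (card X) ^ 2"
      by (simp add: B2_def not_le)
    \<comment> \<open>The pairs with equal entries, missing from the mean, amount to
      \<open>\<mu> * card X\<close> and are absorbed by half of the permitted error.\<close>
    have "2 / \<epsilon> \<le> card X" using K_ge X by linarith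
    then have "1 \<le> \<epsilon> / 2 * real (card X)" using \<epsilon> by (simp add: field_simps)
    then have "\<mu> * real (card X) \<le> (\<epsilon> / 2 * real (card X)) * real (card X)" using \<mu> by (intro mult_right_mono) auto
    then have 2: "\<mu> * real (card X) \<le> \<epsilon> / 2 * real (card X) ^ 2" by (simp add: power2_eq_square mult_ac)
    have 3: "0 \<le> \<mu> * real (card X)" using \<mu> by simp
    have "\<mu> * (real (card X) * (real (card X) - 1)) = \<mu> * real (card X) ^ 2 - \<mu> * real (card X)"
      by (simp add: power2_eq_square algebra_simps)
    then show "\<bar>cut (wt w) X X - \<mu> * real (card X) ^ 2\<bar> \<le> \<epsilon> * real (card X) ^ 2"
      using 1 2 3 by linarith
  next
    fix S A assume SA: "S \<in> clusters G U" "A \<subseteq> S" "K \<le> card (S - A)"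
    show "\<mu> / 2 * real (card A) * real (card (S - A)) \<le> cut (wt w) A (S - A)"
    proof (cases "A = {}")
      case False
      have "S \<subseteq> U" using Cl[OF SA(1)] by auto
      then have "(S, A) \<in> I3" using SA False U by (auto simp: I3_def Ne_def)
      from n3[OF this] have "\<bar>cut (wt w) A (S - A) - \<mu> * (real (card A) * real (card (S - A)))\<bar> < \<mu> / 2 * (real (card A) * real (card (S - A)))"
        by (simp add: B3_def not_le)
      then show ?thesis unfolding mult.assoc by linarith
    qed simp
  next
    fix S v assume S: "S \<in> clusters G U" "K \<le> card S" "v \<in> U - S"
    obtain S0 where S0: "S0 \<in> G" "S = S0 \<inter> U" using Cl[OF S(1)] by auto
    have e: "S0 \<inter> U - {v} = S" "v \<notin> S0" using S0 S by auto
    then have "(S0, v) \<in> I4" using S0 S U by (auto simp: I4_def)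
    from n4[OF this] have "\<bar>cut (wt w) {v} S + \<mu> * real (card S)\<bar> < \<mu> / 2 * real (card S)"
      by (simp add: B4_def e not_le)
    moreover have "\<mu> / 2 * real (card S) = \<mu> * real (card S) / 2" by simp
    ultimately show "cut (wt w) {v} S \<le> - (\<mu> / 2 * real (card S))" by linarith
  next
    fix S1 S2 s D D' Q \<tau>
    assume S: "S1 \<in> clusters G U" "S2 \<in> clusters G U" "S1 \<noteq> S2" "card S1 \<le> s" "card S2 \<le> s" "K \<le> real s" "s \<le> card U"
      and D: "D \<subseteq> S1 \<union> S2" "D' \<subseteq> S1 \<union> S2" "card D = card D'"
      and pl: "placement (U - (S1 \<union> S2)) D (2 * real s) (16 * K / \<mu>) Q \<tau>"
    have "card U \<le> n" using card_mono[OF _ U] by simp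
    then have "(S1, S2, s) \<in> I5" using S K_ge by (auto simp: I5_def)
    from n5[OF this] have le: "best_placement (wt w) (U - (S1 \<union> S2)) D (2 * real s) (16 * K / \<mu>)
      \<le> best_placement (wt w) (U - (S1 \<union> S2)) D' (2 * real s) (16 * K / \<mu>) + \<epsilon> * real s ^ 2"
      using D by (auto simp: B5_def not_less)
    have "S1 \<union> S2 \<subseteq> U" using Cl S by blast
    then have fin: "finite (U - (S1 \<union> S2))" "finite D" "finite D'" using finU D by (auto intro: finite_subset)
    obtain Q' \<tau>' where Q': "placement (U - (S1 \<union> S2)) D' (2 * real s) (16 * K / \<mu>) Q' \<tau>'"
      "best_placement (wt w) (U - (S1 \<union> S2)) D' (2 * real s) (16 * K / \<mu>) = placement_value (wt w) D' Q' \<tau>'"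
      using best_placement_attained[OF fin(1,3), of "2 * real s" "16 * K / \<mu>"] K_ge \<mu> by auto
    have "placement_value (wt w) D Q \<tau> \<le> best_placement (wt w) (U - (S1 \<union> S2)) D (2 * real s) (16 * K / \<mu>)"
      by (rule best_placement_ge[OF fin(1,2) pl])
    then show "\<exists>Q' \<tau>'. placement (U - (S1 \<union> S2)) D' (2 * real s) (16 * K / \<mu>) Q' \<tau>' \<and>
         placement_value (wt w) D Q \<tau> - \<epsilon> * real s ^ 2 \<le> placement_value (wt w) D' Q' \<tau>'"
      using le Q' by (intro exI[of _ Q'] exI[of _ \<tau>']) auto
  qed (use finU \<mu> \<epsilon> in auto)
next
  fix S v assume S: "S \<in> G" "v \<in> {1..n}" "K \<le> card (S \<inter> U - {v})"
  then have "(S, v) \<in> I4" by (auto simp: I4_def)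
  note b = n4[OF this]
  have "0 < \<mu> * real (card (S \<inter> U - {v}))" using S K_ge \<mu> by (intro mult_pos_pos) linarith+
  moreover have "\<mu> / 2 * real (card (S \<inter> U - {v})) = \<mu> * real (card (S \<inter> U - {v})) / 2" by simp
  moreover have "\<bar>cut (wt w) {v} (S \<inter> U - {v}) - \<mu> * real (card (S \<inter> U - {v}))\<bar> < \<mu> / 2 * real (card (S \<inter> U - {v}))" if "v \<in> S"
    using b that by (simp add: B4_def not_le)
  moreover have "\<bar>cut (wt w) {v} (S \<inter> U - {v}) + \<mu> * real (card (S \<inter> U - {v}))\<bar> < \<mu> / 2 * real (card (S \<inter> U - {v}))" if "v \<notin> S"
    using b that by (simp add: B4_def not_le)
  ultimately show "v \<in> S \<Longrightarrow> 0 < cut (wt w) {v} (S \<inter> U - {v})" "v \<notin> S \<Longrightarrow> cut (wt w) {v} (S \<inter> U - {v}) < 0"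
    by linarith+
qed

lemma not_good_prob:
  assumes nq: "real n * q \<le> 1"
  shows "measure_pmf.prob T {w. \<not> good n G U \<mu> \<epsilon> K w} \<le> 28 * (real n ^ 3 * q)"
proof -
  let ?E1 = "\<Union>z\<in>I1 (-1). {w. B1 (-1) z w}" and ?E1' = "\<Union>z\<in>I1 1. {w. B1 1 z w}"
  let ?E2 = "\<Union>X\<in>I2. {w. B2 X w}" and ?E3 = "\<Union>z\<in>I3. {w. B3 z w}" and ?E4 = "\<Union>z\<in>I4. {w. B4 z w}" and ?E5 = "\<Union>z\<in>I5. {w. B5 z w}"
  have "measure_pmf.prob T {w. \<not> good n G U \<mu> \<epsilon> K w} \<le> measure_pmf.prob T (?E1 \<union> (?E1' \<union> (?E2 \<union> (?E3 \<union> (?E4 \<union> ?E5)))))"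
  proof (rule measure_pmf.finite_measure_mono_AE)
    have "w \<in> ?E1 \<union> (?E1' \<union> (?E2 \<union> (?E3 \<union> (?E4 \<union> ?E5))))" if "w \<in> set_pmf T" "\<not> good n G U \<mu> \<epsilon> K w" for w
    proof (rule ccontr)
      assume a: "w \<notin> ?E1 \<union> (?E1' \<union> (?E2 \<union> (?E3 \<union> (?E4 \<union> ?E5))))"
      have "good n G U \<mu> \<epsilon> K w"
        using a set_answer_table(1)[OF that(1)] by (intro good_if) auto
      then show False using that by simp
    qed
    then show "AE w in measure_pmf T. w \<in> {w. \<not> good n G U \<mu> \<epsilon> K w} \<longrightarrow> w \<in> ?E1 \<union> (?E1' \<union> (?E2 \<union> (?E3 \<union> (?E4 \<union> ?E5))))"
      by (auto simp: AE_measure_pmf_iff simp del: Un_iff UN_iff)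
  qed auto
  also have "\<dots> \<le> measure_pmf.prob T ?E1 + (measure_pmf.prob T ?E1' + (measure_pmf.prob T ?E2 + (measure_pmf.prob T ?E3 + (measure_pmf.prob T ?E4 + measure_pmf.prob T ?E5))))"
    by (intro order_trans[OF measure_Un_le] add_left_mono) auto
  also have "\<dots> \<le> 8 * (real n * q) + (8 * (real n * q) + (4 * (real n * q) + (4 * (real n ^ 2 * q) + (2 * (real n ^ 2 * q) + 2 * (real n ^ 3 * q)))))"
    using prob_cut[OF nq] prob_inner[OF nq] prob_small_cut[OF nq] prob_star prob_exchange by (intro add_mono)
  also have "\<dots> \<le> 28 * (real n ^ 3 * q)"
  proof -
    have "real n * q \<le> real n ^ 3 * q" "real n ^ 2 * q \<le> real n ^ 3 * q"
      using n_pos q_pos power_increasing[of 1 3 "real n"] power_increasing[of 2 3 "real n"] by (auto intro!: mult_right_mono)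
    then show ?thesis by linarith
  qed
  finally show ?thesis .
qed

end

text \<open>The size from which on a cluster is recognizable.\<close>

definition large_size :: "real \<Rightarrow> real \<Rightarrow> real" where
  "large_size \<mu> K = 16 * 10 ^ 7 * K / \<mu> ^ 7"

lemma good_whp:
  fixes lam c :: real
  assumes "0 < lam" "lam < 1 / 2" "c > 0"
  shows "\<exists>\<epsilon> \<kappa>. 0 < \<kappa> \<and> (\<forall>n\<ge>40. \<forall>G U. partition_on {1..n} G \<longrightarrow> U \<subseteq> {1..n} \<longrightarrow>
    measure_pmf.prob (answer_table n (1 / 2 - lam) G) {w. \<not> good n G U (2 * lam) \<epsilon> (\<kappa> * ln (real n)) w} \<le> real n powr (- c))"
proof -
  define \<epsilon> where "\<epsilon> = (2 * lam) ^ 5 / 400000"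
  \<comment> \<open>Chosen so that \<open>q\<close> becomes \<open>n powr - (c + 4)\<close>: three
    powers of \<open>n\<close> are spent on the union bounds and one on the constant
    \<open>28\<close>.\<close>
  define \<kappa> where "\<kappa> = (c + 4) * (512 / \<epsilon>\<^sup>2)"
  have \<epsilon>: "0 < \<epsilon>" using assms by (simp add: \<epsilon>_def)
  have \<kappa>: "0 < \<kappa>" using \<epsilon> assms by (simp add: \<kappa>_def)
  have "measure_pmf.prob (answer_table n (1 / 2 - lam) G) {w. \<not> good n G U (2 * lam) \<epsilon> (\<kappa> * ln (real n)) w} \<le> real n powr (- c)"
    if n: "n \<ge> 40" and G: "partition_on {1..n} G" and U: "U \<subseteq> {1..n}" for n G U
  proof -
    have n0: "real n > 0" using n by simp
    have ln1: "1 \<le> ln (real n)"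
    proof -
      have "exp 1 \<le> real n" using n exp_le by linarith
      then show ?thesis using n0 by (simp add: ln_ge_iff)
    qed
    have qe: "exp (- (\<epsilon>\<^sup>2 / 512 * (\<kappa> * ln (real n)))) = real n powr (- (c + 4))"
      using \<epsilon> n0 by (simp add: \<kappa>_def powr_def field_simps)
    have Kb: "1024 / \<epsilon>\<^sup>2 \<le> \<kappa> * ln (real n)"
    proof -
      have "1024 / \<epsilon>\<^sup>2 = 2 * (512 / \<epsilon>\<^sup>2) * 1" by simp
      also have "\<dots> \<le> (c + 4) * (512 / \<epsilon>\<^sup>2) * ln (real n)"
        using assms ln1 \<epsilon> by (intro mult_mono mult_right_mono) auto
      finally show ?thesis by (simp add: \<kappa>_def)
    qed
    interpret answer_setting n "2 * lam" \<epsilon> "\<kappa> * ln (real n)" "1 / 2 - lam" G U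
      by unfold_locales (use assms n G U \<epsilon> Kb in \<open>auto simp: \<epsilon>_def\<close>)
    have "measure_pmf.prob (answer_table n (1 / 2 - lam) G) {w. \<not> good n G U (2 * lam) \<epsilon> (\<kappa> * ln (real n)) w}
       \<le> 28 * (real n ^ 3 * exp (- (\<epsilon>\<^sup>2 / 512 * (\<kappa> * ln (real n)))))"
    proof (rule not_good_prob[unfolded q_def])
      have "real n * exp (- (\<epsilon>\<^sup>2 / 512 * (\<kappa> * ln (real n)))) = real n powr (1 + - (c + 4))"
        unfolding qe powr_add using n0 by simp
      also have "\<dots> \<le> real n powr 0" using n assms by (intro powr_mono) auto
      finally show "real n * exp (- (\<epsilon>\<^sup>2 / 512 * (\<kappa> * ln (real n)))) \<le> 1" using n0 by simp
    qed
    also have "\<dots> = 28 * real n powr (3 + - (c + 4))"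
      unfolding qe powr_add using n0 by (simp add: powr_numeral)
    also have "\<dots> \<le> real n powr 1 * real n powr (3 + - (c + 4))"
      using n by (intro mult_right_mono) auto
    also have "\<dots> = real n powr (1 + (3 + - (c + 4)))" by (rule powr_add[symmetric])
    also have "\<dots> = real n powr (- c)" by simp
    finally show ?thesis .
  qed
  then show ?thesis using \<kappa> by blast
qed

section \<open>The algorithm\<close>

lemma score_likelihood:
  assumes "finite X" "partition_on X P"
  shows "score (wt w) P = 2 * real_of_int (likelihood_score w P)"
proof -
  have "cut (wt w) S S = 2 * (\<Sum>j\<in>S. \<Sum>i\<in>{i \<in> S. i < j}. real_of_int (w {i, j}))" if "S \<in> P" for S
    using assms that by (subst cut_self_eq) (auto simp: wt_def partition_on_def intro: finite_subset)
  then show ?thesis by (simp add: score_def likelihood_score_def sum_distrib_left)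
qed

lemma ex_likelihood_max:
  assumes "finite X"
  shows "\<exists>P. is_arg_max (likelihood_score w) (partition_on X) P"
proof -
  have fin: "finite {P. partition_on X P}" using assms finitely_many_partition_on by blast
  have "(\<lambda>v. {v}) ` X \<in> {P. partition_on X P}" by (auto simp: partition_on_def disjoint_def)
  then have "{P. partition_on X P} \<noteq> {}" by blast
  then have "Max (likelihood_score w ` {P. partition_on X P}) \<in> likelihood_score w ` {P. partition_on X P}"
    using fin by (intro Max_in) auto
  then obtain P where P: "partition_on X P" "likelihood_score w P = Max (likelihood_score w ` {P. partition_on X P})" by auto
  have "likelihood_score w Q \<le> likelihood_score w P" if "partition_on X Q" for Q
    unfolding P(2) using fin that by (intro Max_ge) auto
  then show ?thesis using P(1) by (auto simp: is_arg_max_def not_less intro!: exI[of _ P])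
qed

definition best_partition :: "nat set \<Rightarrow> (nat set \<Rightarrow> int) \<Rightarrow> nat set set" where
  "best_partition X w = (SOME P. is_arg_max (likelihood_score w) (partition_on X) P)"

lemma best_partition_arg_max:
  "finite X \<Longrightarrow> is_arg_max (likelihood_score w) (partition_on X) (best_partition X w)"
  unfolding best_partition_def using ex_likelihood_max by (rule someI_ex)

lemma partition_on_best: "finite X \<Longrightarrow> partition_on X (best_partition X w)"
  using best_partition_arg_max by (auto simp: is_arg_max_def)

lemma arg_max_optimal_partition:
  assumes "finite X" "is_arg_max (likelihood_score w) (partition_on X) P"
  shows "optimal_partition (wt w) X P"
proof
  show "partition_on X P" using assms(2) by (simp add: is_arg_max_def)
  fix P' assume "partition_on X P'"
  then show "score (wt w) P' \<le> score (wt w) P"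
    using assms score_likelihood[OF assms(1)] by (auto simp: is_arg_max_def not_less)
qed (fact assms)

text \<open>This is what makes the rule usable in a strategy: even the arbitrary choice by
  \<open>SOME\<close> is not influenced by pairs outside \<open>X\<close>.\<close>

lemma best_partition_cong:
  assumes "\<And>i j. i \<in> X \<Longrightarrow> j \<in> X \<Longrightarrow> i \<noteq> j \<Longrightarrow> w {i, j} = w' {i, j}"
  shows "best_partition X w = best_partition X w'"
proof -
  have "likelihood_score w P = likelihood_score w' P" if "partition_on X P" for P
    unfolding likelihood_score_def using that assms by (intro sum.cong refl) (auto simp: partition_on_def)
  then have "is_arg_max (likelihood_score w) (partition_on X) P \<longleftrightarrow> is_arg_max (likelihood_score w') (partition_on X) P" for P
    by (auto simp: is_arg_max_def)
  then show ?thesis by (simp add: best_partition_def)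
qed

text \<open>The vertices in \<open>X\<close> have been compared with all vertices. A block of size at least \<open>L\<close> of a best
  partition of \<open>X\<close> reveals a whole cluster.\<close>

definition found :: "nat \<Rightarrow> real \<Rightarrow> nat set \<Rightarrow> (nat set \<Rightarrow> int) \<Rightarrow> nat set set" where
  "found n L X w = (\<lambda>B. {v \<in> {1..n}. 0 < cut (wt w) {v} (B - {v})}) ` {B \<in> best_partition X w. L \<le> real (card B)}"

definition unseen :: "nat \<Rightarrow> real \<Rightarrow> nat set \<Rightarrow> (nat set \<Rightarrow> int) \<Rightarrow> nat set" where
  "unseen n L X w = {1..n} - X - \<Union> (found n L X w)"

text \<open>When the algorithm stops, every vertex outside the recognized clusters has been treated,
  so the answers among these vertices are known.\<close>

definition estimate :: "nat \<Rightarrow> real \<Rightarrow> nat set \<Rightarrow> (nat set \<Rightarrow> int) \<Rightarrow> nat set set" where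
  "estimate n L X w = found n L X w \<union> best_partition ({1..n} - \<Union> (found n L X w)) w"

text \<open>Treated vertices are left out because their pairs with \<open>x\<close> were asked
  before.\<close>

definition star :: "nat \<Rightarrow> nat \<Rightarrow> nat set \<Rightarrow> nat set set" where
  "star n x X = (\<lambda>v. {x, v}) ` ({1..n} - X - {x})"

text \<open>The counter only serves the recursion: each round treats one more vertex, so
  \<open>n\<close> is enough. \<open>w\<close> collects the answers received and is arbitrary
  elsewhere.\<close>

primrec explore :: "nat \<Rightarrow> real \<Rightarrow> nat \<Rightarrow> nat set \<Rightarrow> (nat set \<Rightarrow> int) \<Rightarrow> strategy" where
  "explore n L 0 X w = Output (estimate n L X w)"
| "explore n L (Suc m) X w =
    (if unseen n L X w = {} then Output (estimate n L X w)
     else let x = Min (unseen n L X w) in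
       Round (star n x X) (\<lambda>ans. explore n L m (insert x X) (\<lambda>e. if e \<in> star n x X then ans e else w e)))"

definition touching :: "nat \<Rightarrow> nat set \<Rightarrow> nat set set" where
  "touching n X = {e \<in> all_pairs n. e \<inter> X \<noteq> {}}"

section \<open>Queries asked so far and decisions based on them\<close>

lemma star_props:
  assumes "x \<in> {1..n}" "x \<notin> X"
  shows "star n x X \<subseteq> all_pairs n" "star n x X \<inter> touching n X = {}"
    "touching n X \<union> star n x X = touching n (insert x X)" "card (star n x X) \<le> n"
proof -
  show "star n x X \<subseteq> all_pairs n" using assms by (auto simp: star_def intro!: pair_in_all_pairs)
  show "star n x X \<inter> touching n X = {}" using assms by (auto simp: star_def touching_def)
  show "touching n X \<union> star n x X = touching n (insert x X)"
  proof
    show "touching n X \<union> star n x X \<subseteq> touching n (insert x X)"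
      using assms by (auto simp: star_def touching_def intro!: pair_in_all_pairs)
    show "touching n (insert x X) \<subseteq> touching n X \<union> star n x X"
    proof
      fix e assume e: "e \<in> touching n (insert x X)"
      then have "e \<in> all_pairs n" by (simp add: touching_def)
      then obtain a b where ab: "a \<in> {1..n}" "b \<in> {1..n}" "a \<noteq> b" "e = {a, b}" by (rule all_pairsE)
      show "e \<in> touching n X \<union> star n x X"
      proof (cases "e \<inter> X = {}")
        case True
        then have "x = a \<or> x = b" using e ab by (auto simp: touching_def)
        then show ?thesis
        proof
          assume "x = a"
          then have "e = {x, b}" "b \<in> {1..n} - X - {x}" using ab True by auto
          then show ?thesis by (auto simp: star_def)
        next
          assume "x = b"
          then have "e = {x, a}" "a \<in> {1..n} - X - {x}" using ab True by auto
          then show ?thesis by (auto simp: star_def)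
        qed
      qed (use e in \<open>auto simp: touching_def\<close>)
    qed
  qed
  have "card (star n x X) \<le> card ({1..n} - X - {x})" unfolding star_def by (rule card_image_le) simp
  also have "\<dots> \<le> card {1..n}" by (rule card_mono) auto
  finally show "card (star n x X) \<le> n" by simp
qed

lemma Min_unseen:
  assumes "unseen n L X w \<noteq> {}"
  shows "Min (unseen n L X w) \<in> {1..n}" "Min (unseen n L X w) \<notin> X" "Min (unseen n L X w) \<in> unseen n L X w"
proof -
  have "finite (unseen n L X w)" by (simp add: unseen_def)
  then show m: "Min (unseen n L X w) \<in> unseen n L X w" using assms by (rule Min_in)
  show "Min (unseen n L X w) \<in> {1..n}" "Min (unseen n L X w) \<notin> X" using m by (auto simp: unseen_def)
qed

lemma admissible_explore:
  assumes "n \<le> b"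
  shows "admissible n b (touching n X) (explore n L m X w)"
proof (induction m arbitrary: X w)
  case (Suc m)
  show ?case
  proof (cases "unseen n L X w = {}")
    case False
    note x = Min_unseen(1,2)[OF False]
    show ?thesis
      using False Suc star_props[OF x] assms by (simp add: Let_def)
  qed simp
qed simp

text \<open>The invariant between the collected answers and the true table; the pairs asked are
  those that meet \<open>X\<close>.\<close>

definition agree :: "nat \<Rightarrow> nat set \<Rightarrow> (nat set \<Rightarrow> int) \<Rightarrow> (nat set \<Rightarrow> int) \<Rightarrow> bool" where
  "agree n X w w' \<longleftrightarrow> (\<forall>e\<in>touching n X. w e = w' e)"

lemma agreeD: "agree n X w w' \<Longrightarrow> X \<subseteq> {1..n} \<Longrightarrow> x \<in> X \<Longrightarrow> v \<in> {1..n} \<Longrightarrow> x \<noteq> v \<Longrightarrow> w {x, v} = w' {x, v}"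
  unfolding agree_def touching_def using pair_in_all_pairs[of x n v] by blast

lemma found_cong:
  assumes "agree n X w w'" "X \<subseteq> {1..n}"
  shows "found n L X w = found n L X w'"
proof -
  have b: "best_partition X w = best_partition X w'"
    using assms(2) by (intro best_partition_cong agreeD[OF assms]) auto
  have "finite X" using assms(2) finite_subset by blast
  then have sub: "B \<subseteq> X" if "B \<in> best_partition X w'" for B
    using partition_on_best[of X w'] that by (auto simp: partition_on_def)
  have "cut (wt w) {v} (B - {v}) = cut (wt w') {v} (B - {v})" if "B \<in> best_partition X w'" "v \<in> {1..n}" for v B
  proof -
    have "w {v, x} = w' {v, x}" if "x \<in> B - {v}" for x
      using agreeD[OF assms, of x v] that sub[OF \<open>B \<in> best_partition X w'\<close>] \<open>v \<in> {1..n}\<close>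
      by (auto simp: insert_commute)
    then show ?thesis by (auto simp: cut_def wt_def intro!: sum.cong)
  qed
  then show ?thesis unfolding found_def b by (intro image_cong) auto
qed

lemma unseen_cong: "agree n X w w' \<Longrightarrow> X \<subseteq> {1..n} \<Longrightarrow> unseen n L X w = unseen n L X w'"
  by (simp add: unseen_def found_cong)

lemma estimate_cong:
  assumes "agree n X w w'" "X \<subseteq> {1..n}" "unseen n L X w' = {}"
  shows "estimate n L X w = estimate n L X w'"
proof -
  have "{1..n} - \<Union> (found n L X w') \<subseteq> X" using assms(3) by (auto simp: unseen_def)
  then have "best_partition ({1..n} - \<Union> (found n L X w')) w = best_partition ({1..n} - \<Union> (found n L X w')) w'"
    using assms(2) by (intro best_partition_cong agreeD[OF assms(1,2)]) auto
  then show ?thesis by (simp add: estimate_def found_cong[OF assms(1,2)])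
qed

lemma agree_step:
  assumes "agree n X w0 w" "x \<in> {1..n}" "x \<notin> X"
  shows "agree n (insert x X) (\<lambda>e. if e \<in> star n x X then restrict w (star n x X) e else w0 e) w"
  using assms star_props(3)[OF assms(2,3)] by (auto simp: agree_def)

text \<open>The course of the algorithm if every answer were correct. It depends on the clustering only,
  so that a union bound over its steps suffices.\<close>

definition big_in :: "nat set set \<Rightarrow> real \<Rightarrow> nat set \<Rightarrow> nat set set" where
  "big_in G L X = {S \<in> G. L \<le> real (card (S \<inter> X))}"

primrec ideal :: "nat \<Rightarrow> nat set set \<Rightarrow> real \<Rightarrow> nat \<Rightarrow> nat set" where
  "ideal n G L 0 = {}"
| "ideal n G L (Suc t) = (let N = {1..n} - ideal n G L t - \<Union> (big_in G L (ideal n G L t)) in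
     if N = {} then ideal n G L t else insert (Min N) (ideal n G L t))"

section \<open>The error-free course and its length\<close>

lemma ideal_sub: "ideal n G L t \<subseteq> {1..n}"
proof (induction t)
  case (Suc t)
  let ?N = "{1..n} - ideal n G L t - \<Union> (big_in G L (ideal n G L t))"
  have "Min ?N \<in> ?N" if "?N \<noteq> {}" using that by (intro Min_in) auto
  then show ?case using Suc by (auto simp: Let_def)
qed simp

text \<open>A vertex of \<open>S\<close> is chosen only while \<open>S\<close> has fewer than
  \<open>L\<close> treated vertices; the last choice accounts for the \<open>+ 1\<close>.\<close>

lemma ideal_cluster_bound:
  assumes G: "partition_on {1..n} G" and S: "S \<in> G" and L: "0 \<le> L"
  shows "real (card (S \<inter> ideal n G L t)) \<le> L + 1"
proof (induction t)
  case (Suc t)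
  let ?X = "ideal n G L t"
  let ?N = "{1..n} - ?X - \<Union> (big_in G L ?X)"
  show ?case
  proof (cases "?N = {} \<or> Min ?N \<notin> S")
    case True
    then show ?thesis using Suc by (auto simp: Let_def Int_insert_right)
  next
    case False
    then have "?N \<noteq> {}" by blast
    then have "Min ?N \<in> ?N" by (intro Min_in) auto
    then have "S \<notin> big_in G L ?X" using False by blast
    then have "real (card (S \<inter> ?X)) < L" using S by (simp add: big_in_def)
    moreover have "card (S \<inter> ideal n G L (Suc t)) \<le> Suc (card (S \<inter> ?X))"
      using False by (simp add: Let_def Int_insert_right card_insert_le_m1 card_insert_if finite_subset[OF ideal_sub])
    ultimately show ?thesis by linarith
  qed
qed (use L in simp)

lemma card_ideal_le:
  assumes G: "partition_on {1..n} G" and L: "0 \<le> L"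
  shows "real (card (ideal n G L t)) \<le> real (card G) * (L + 1)"
proof -
  have "real (card (ideal n G L t)) = (\<Sum>S\<in>G. real (card (S \<inter> ideal n G L t)))"
    using partition_on_sum_card[OF _ G ideal_sub] by (simp flip: of_nat_sum)
  also have "\<dots> \<le> (\<Sum>S\<in>G. L + 1)" using ideal_cluster_bound[OF G _ L] by (intro sum_mono) auto
  finally show ?thesis by simp
qed

text \<open>\<open>good_all\<close> is for the maximum likelihood estimate of the whole graph,
  \<open>good_ideal\<close> for the decisions on the way.\<close>

locale good_table =
  fixes n :: nat and G :: "nat set set" and \<mu> \<epsilon> K :: real and w :: "nat set \<Rightarrow> int"
  assumes G: "partition_on {1..n} G"
    and good_all: "good n G {1..n} \<mu> \<epsilon> K w"
    and good_ideal: "\<And>t. t \<le> n \<Longrightarrow> good n G (ideal n G (2 * large_size \<mu> K) t) \<mu> \<epsilon> K w"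
begin

abbreviation "L \<equiv> 2 * large_size \<mu> K"
abbreviation "X \<equiv> ideal n G L"

lemma large_size_ge: "K \<le> large_size \<mu> K" "1 \<le> K" "0 < \<mu>"
proof -
  interpret typical_weights "wt w" "{1..n}" "clusters G {1..n}" \<mu> \<epsilon> K
    using good_all by (simp add: good_def)
  show "1 \<le> K" "0 < \<mu>" using K \<mu> by auto
  have "K * \<mu> ^ 7 \<le> K * (16 * 10 ^ 7)"
    using K \<mu> power_le_one[of \<mu> 7] by (intro mult_left_mono) auto
  then show "K \<le> large_size \<mu> K" using \<mu> by (simp add: large_size_def field_simps)
qed

lemma typical_best:
  assumes "good n G Y \<mu> \<epsilon> K w" "is_arg_max (likelihood_score w) (partition_on Y) P"
  shows "typical_optimum (wt w) Y (clusters G Y) \<mu> \<epsilon> K P"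
proof -
  interpret typical_weights "wt w" Y "clusters G Y" \<mu> \<epsilon> K using assms(1) by (simp add: good_def)
  interpret optimal_partition "wt w" Y P using arg_max_optimal_partition[OF finite_U assms(2)] .
  show ?thesis by unfold_locales
qed

text \<open>The threshold is twice \<open>large_size\<close> because a block needs that size to be a
  trace for certain, whereas such a trace is certainly a block. The votes of the trace then single
  out the whole cluster.\<close>

lemma found_ideal:
  assumes "t \<le> n"
  shows "found n L (X t) w = big_in G L (X t)"
proof -
  have gd: "good n G (X t) \<mu> \<epsilon> K w" using good_ideal assms by auto
  have finX: "finite (X t)" by (rule finite_subset[OF ideal_sub]) simp
  interpret typical_optimum "wt w" "X t" "clusters G (X t)" \<mu> \<epsilon> K "best_partition (X t) w"
    using typical_best[OF gd best_partition_arg_max[OF finX]] .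
  have Sub: "S \<subseteq> {1..n}" if "S \<in> G" for S using that partition_onD1[OF G] by auto
  have recog: "{v \<in> {1..n}. 0 < cut (wt w) {v} (S \<inter> X t - {v})} = S" if S: "S \<in> G" "L \<le> real (card (S \<inter> X t))" for S
  proof -
    have "0 < cut (wt w) {v} (S \<inter> X t - {v}) \<longleftrightarrow> v \<in> S" if "v \<in> {1..n}" for v
    proof -
      have "real (card (S \<inter> X t)) - 1 \<le> real (card (S \<inter> X t - {v}))"
        using finX by (simp add: card_Diff_singleton_if of_nat_diff) linarith
      then have "K \<le> real (card (S \<inter> X t - {v}))" using S(2) large_size_ge by linarith
      then have "(v \<in> S \<longrightarrow> 0 < cut (wt w) {v} (S \<inter> X t - {v})) \<and> (v \<notin> S \<longrightarrow> cut (wt w) {v} (S \<inter> X t - {v}) < 0)"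
        using gd S(1) that unfolding good_def by blast
      then show ?thesis by (cases "v \<in> S") auto
    qed
    then show ?thesis using Sub[OF S(1)] by blast
  qed
  show ?thesis
  proof
    show "found n L (X t) w \<subseteq> big_in G L (X t)"
    proof
      fix T assume "T \<in> found n L (X t) w"
      then obtain B where B: "B \<in> best_partition (X t) w" "L \<le> real (card B)"
        "T = {v \<in> {1..n}. 0 < cut (wt w) {v} (B - {v})}" by (auto simp: found_def)
      have "B \<in> clusters G (X t)" using large_block_is_cluster[OF B(1)] B(2) by (simp add: large_size_def)
      then obtain S where S: "S \<in> G" "B = S \<inter> X t" by (auto simp: clusters_def)
      then have "T = S" using recog[OF S(1)] B by simp
      then show "T \<in> big_in G L (X t)" using S B by (simp add: big_in_def)
    qed
    show "big_in G L (X t) \<subseteq> found n L (X t) w"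
    proof
      fix S assume "S \<in> big_in G L (X t)"
      then have S: "S \<in> G" "L \<le> real (card (S \<inter> X t))" by (auto simp: big_in_def)
      then have "S \<inter> X t \<noteq> {}" using large_size_ge by auto
      then have "S \<inter> X t \<in> clusters G (X t)" using S by (auto simp: clusters_def)
      moreover have "16 * 10 ^ 7 * K / \<mu> ^ 7 \<le> card (S \<inter> X t)"
        using S(2) large_size_ge unfolding large_size_def by linarith
      ultimately have "S \<inter> X t \<in> best_partition (X t) w" by (rule large_cluster_is_block)
      then show "S \<in> found n L (X t) w" using recog[OF S] S(2) unfolding found_def by blast
    qed
  qed
qed

lemma large_in_ml:
  assumes "max_likelihood n w P" "S \<in> G" "large_size \<mu> K \<le> card S"
  shows "S \<in> P"
proof -
  interpret typical_optimum "wt w" "{1..n}" "clusters G {1..n}" \<mu> \<epsilon> K P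
    using typical_best[OF good_all] assms(1) by (simp add: max_likelihood_def)
  have "S \<inter> {1..n} = S" "S \<noteq> {}" using assms(2) partition_onD1[OF G] partition_onD3[OF G] by auto
  then have "S \<in> clusters G {1..n}" using assms(2) unfolding clusters_def by blast
  then show ?thesis using large_cluster_is_block assms(3) by (simp add: large_size_def)
qed

text \<open>The recognized clusters are blocks of a maximum likelihood estimate \<open>P\<close>.
  The other blocks of \<open>P\<close> partition the remaining vertices, where the computed
  partition scores at least as well; so replacing them loses nothing.\<close>

lemma estimate_ideal:
  assumes t: "t \<le> n" and all: "unseen n L (X t) w = {}"
  shows "max_likelihood n w (estimate n L (X t) w)"
proof -
  let ?D = "big_in G L (X t)"
  let ?R = "{1..n} - \<Union> ?D"
  let ?B = "best_partition ?R w"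
  have e: "estimate n L (X t) w = ?D \<union> ?B" by (simp add: estimate_def found_ideal[OF t])
  obtain P where P: "max_likelihood n w P" using ex_likelihood_max[of "{1..n}" w] by (auto simp: max_likelihood_def)
  then have pP: "partition_on {1..n} P" by (simp add: max_likelihood_def is_arg_max_def)
  have finP: "finite P" using finite_elements[OF _ pP] by simp
  have DG: "?D \<subseteq> G" by (auto simp: big_in_def)
  have DP: "?D \<subseteq> P"
  proof
    fix S assume "S \<in> ?D"
    then have S: "S \<in> G" "L \<le> real (card (S \<inter> X t))" by (auto simp: big_in_def)
    have "finite S" using S(1) partition_onD1[OF G] by (auto intro: finite_subset)
    then have "card (S \<inter> X t) \<le> card S" by (intro card_mono) auto
    then have "large_size \<mu> K \<le> card S" using S(2) large_size_ge by linarith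
    then show "S \<in> P" using large_in_ml[OF P S(1)] by simp
  qed
  have disj: "B \<inter> B' = {}" if "B \<in> P" "B' \<in> P" "B \<noteq> B'" for B B'
    using disjointD[OF partition_onD2[OF pP]] that by blast
  have pR: "partition_on ?R (P - ?D)"
  proof (rule partition_onI)
    show "\<Union> (P - ?D) = ?R"
    proof
      show "\<Union> (P - ?D) \<subseteq> ?R" using disj DP partition_onD1[OF pP] by blast
      show "?R \<subseteq> \<Union> (P - ?D)" using partition_onD1[OF pP] by auto
    qed
  next
    fix p p' assume "p \<in> P - ?D" "p' \<in> P - ?D" "p \<noteq> p'"
    then show "disjnt p p'" using disj by (auto simp: disjnt_def)
  next
    show "{} \<notin> P - ?D" using partition_onD3[OF pP] by auto
  qed
  have pB: "partition_on ?R ?B" by (rule partition_on_best) simp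
  have BD: "B \<inter> S = {}" if "B \<in> ?B" "S \<in> ?D" for B S
    using partition_onD1[OF pB] that by blast
  have "?D \<inter> ?B = {}"
  proof (rule ccontr)
    assume "?D \<inter> ?B \<noteq> {}"
    then obtain B where "B \<in> ?D" "B \<in> ?B" by blast
    then show False using BD[of B B] partition_onD3[OF pB] by auto
  qed
  have finD: "finite ?D" using DP finP finite_subset by blast
  have finB: "finite ?B" using finite_elements[OF _ pB] by simp
  have part: "partition_on {1..n} (?D \<union> ?B)"
  proof (rule partition_onI)
    have "\<Union> ?D \<subseteq> {1..n}" using DP partition_onD1[OF pP] by blast
    then show "\<Union> (?D \<union> ?B) = {1..n}" using partition_onD1[OF pB, symmetric] by (simp add: Un_absorb1)
  next
    fix p p' assume pp: "p \<in> ?D \<union> ?B" "p' \<in> ?D \<union> ?B" "p \<noteq> p'"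
    have "p \<inter> p' = {}"
    proof (cases "p \<in> ?D"; cases "p' \<in> ?D")
      assume "p \<in> ?D" "p' \<in> ?D" then show ?thesis using disj DP pp(3) by blast
    next
      assume "p \<in> ?D" "p' \<notin> ?D" then show ?thesis using BD[of p' p] pp by auto
    next
      assume "p \<notin> ?D" "p' \<in> ?D" then show ?thesis using BD[of p p'] pp by auto
    next
      assume "p \<notin> ?D" "p' \<notin> ?D" then show ?thesis using disjointD[OF partition_onD2[OF pB]] pp by blast
    qed
    then show "disjnt p p'" by (simp add: disjnt_def)
  next
    show "{} \<notin> ?D \<union> ?B" using partition_onD3[OF pB] partition_onD3[OF pP] DP by blast
  qed
  have "likelihood_score w P = likelihood_score w ?D + likelihood_score w (P - ?D)"
    using sum.subset_diff[OF DP finP] unfolding likelihood_score_def by (simp add: add.commute)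
  also have "likelihood_score w (P - ?D) \<le> likelihood_score w ?B"
    using best_partition_arg_max[of ?R w] pR by (auto simp: is_arg_max_def not_less)
  also have "likelihood_score w ?D + likelihood_score w ?B = likelihood_score w (?D \<union> ?B)"
    unfolding likelihood_score_def using finD finB \<open>?D \<inter> ?B = {}\<close> by (intro sum.union_disjoint[symmetric])
  finally have le: "likelihood_score w P \<le> likelihood_score w (?D \<union> ?B)" by simp
  show ?thesis
    using P le part unfolding e max_likelihood_def is_arg_max_def by (metis leD le_less_trans not_less)
qed

text \<open>On a good table every decision equals that of the ideal course, and each round treats
  exactly one new vertex. So the number of rounds is the growth of the ideal set.\<close>

lemma explore_correct:
  assumes "m + t = n" "card (X t) = t" "agree n (X t) w0 w"
  shows "max_likelihood n w (run (explore n L m (X t) w0) w) \<and>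
    (\<exists>t'\<le>n. card (X t') = t + rounds (explore n L m (X t) w0) w)"
  using assms
proof (induction m arbitrary: t w0)
  case 0
  \<comment> \<open>The counter runs out only when all vertices have been treated.\<close>
  have "X t = {1..n}" using 0 ideal_sub by (intro card_subset_eq) auto
  then have u: "unseen n L (X t) w = {}" by (simp add: unseen_def)
  then show ?case
    using 0 estimate_ideal[OF _ u] estimate_cong[OF 0(3) ideal_sub u] by auto
next
  case (Suc m)
  have tn: "t \<le> n" using Suc.prems by simp
  have un: "unseen n L (X t) w0 = unseen n L (X t) w" by (rule unseen_cong[OF Suc.prems(3) ideal_sub])
  show ?case
  proof (cases "unseen n L (X t) w = {}")
    case True
    then show ?thesis
      using un Suc.prems tn estimate_ideal[OF tn True] estimate_cong[OF Suc.prems(3) ideal_sub True]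
      by (auto intro!: exI[of _ t])
  next
    case False
    define x where "x = Min (unseen n L (X t) w)"
    have x: "x \<in> {1..n}" "x \<notin> X t" using Min_unseen[OF False] by (auto simp: x_def)
    have Xs: "X (Suc t) = insert x (X t)"
      using False by (simp add: x_def unseen_def found_ideal[OF tn] Let_def)
    have "card (X (Suc t)) = Suc t"
      unfolding Xs using x Suc.prems finite_subset[OF ideal_sub] by (subst card_insert_disjoint) auto
    then have IH: "max_likelihood n w (run (explore n L m (X (Suc t)) w1) w) \<and>
      (\<exists>t'\<le>n. card (X t') = Suc t + rounds (explore n L m (X (Suc t)) w1) w)" if "agree n (X (Suc t)) w1 w" for w1
      using Suc.prems that by (intro Suc.IH) auto
    have "explore n L (Suc m) (X t) w0 = Round (star n x (X t))
       (\<lambda>ans. explore n L m (X (Suc t)) (\<lambda>e. if e \<in> star n x (X t) then ans e else w0 e))"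
      using False un unfolding Xs x_def by (simp add: Let_def del: ideal.simps)
    then show ?thesis
      using IH[OF agree_step[OF Suc.prems(3) x, folded Xs]] by (simp del: ideal.simps explore.simps)
  qed
qed

lemma explore_all:
  "max_likelihood n w (run (explore n L n {} (\<lambda>_. 0)) w)"
  "real (rounds (explore n L n {} (\<lambda>_. 0)) w) \<le> real (card G) * (L + 1)"
proof -
  have "agree n (X 0) (\<lambda>_. 0) w" by (simp add: agree_def touching_def)
  from explore_correct[of n 0, OF _ _ this]
  have *: "max_likelihood n w (run (explore n L n {} (\<lambda>_. 0)) w)"
    "\<exists>t'\<le>n. card (X t') = rounds (explore n L n {} (\<lambda>_. 0)) w" by auto
  then show "max_likelihood n w (run (explore n L n {} (\<lambda>_. 0)) w)" by simp
  from *(2) obtain t' where "card (X t') = rounds (explore n L n {} (\<lambda>_. 0)) w" by auto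
  moreover have "0 \<le> L" using large_size_ge by simp
  ultimately show "real (rounds (explore n L n {} (\<lambda>_. 0)) w) \<le> real (card G) * (L + 1)"
    using card_ideal_le[OF G, of L t'] by metis
qed

end

lemma good_table_whp:
  fixes lam c :: real
  assumes "0 < lam" "lam < 1 / 2" "c > 0"
  shows "\<exists>\<epsilon> \<kappa>. 0 < \<kappa> \<and> (\<forall>n\<ge>40. \<forall>G. partition_on {1..n} G \<longrightarrow>
    measure_pmf.prob (answer_table n (1 / 2 - lam) G) {w. \<not> good_table n G (2 * lam) \<epsilon> (\<kappa> * ln (real n)) w} \<le> real n powr (- c))"
proof -
  \<comment> \<open>Two extra powers of \<open>n\<close> pay for the \<open>n + 2\<close> vertex
    sets in \<open>good_table\<close>.\<close>
  obtain \<epsilon> \<kappa> where \<kappa>: "0 < \<kappa>" and good: "\<And>n G U. n \<ge> 40 \<Longrightarrow> partition_on {1..n} G \<Longrightarrow> U \<subseteq> {1..n} \<Longrightarrow>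
    measure_pmf.prob (answer_table n (1 / 2 - lam) G) {w. \<not> good n G U (2 * lam) \<epsilon> (\<kappa> * ln (real n)) w} \<le> real n powr (- (c + 2))"
    using good_whp[of lam "c + 2"] assms by (metis add_pos_pos zero_less_numeral)
  have "measure_pmf.prob (answer_table n (1 / 2 - lam) G) {w. \<not> good_table n G (2 * lam) \<epsilon> (\<kappa> * ln (real n)) w} \<le> real n powr (- c)"
    if n: "n \<ge> 40" and G: "partition_on {1..n} G" for n G
  proof -
    let ?T = "answer_table n (1 / 2 - lam) G" and ?K = "\<kappa> * ln (real n)"
    define Y where "Y i = (case i of None \<Rightarrow> {1..n} | Some t \<Rightarrow> ideal n G (2 * large_size (2 * lam) ?K) t)" for i
    let ?I = "insert None (Some ` {..n})"
    have YU: "Y i \<subseteq> {1..n}" for i using ideal_sub by (auto simp: Y_def split: option.splits)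
    have "{w. \<not> good_table n G (2 * lam) \<epsilon> ?K w} \<subseteq> (\<Union>i\<in>?I. {w. \<not> good n G (Y i) (2 * lam) \<epsilon> ?K w})"
      using G by (auto simp: good_table_def Y_def)
    then have "measure_pmf.prob ?T {w. \<not> good_table n G (2 * lam) \<epsilon> ?K w} \<le> measure_pmf.prob ?T (\<Union>i\<in>?I. {w. \<not> good n G (Y i) (2 * lam) \<epsilon> ?K w})"
      by (intro measure_pmf.finite_measure_mono) auto
    also have "\<dots> \<le> (\<Sum>i\<in>?I. real n powr (- (c + 2)))"
      using good[OF n G YU] by (intro prob_Union_le) auto
    also have "\<dots> = (real n + 2) * real n powr (- (c + 2))"
      by (simp add: card_image card_insert_if image_iff)
    also have "\<dots> \<le> (real n * real n) * real n powr (- (c + 2))"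
    proof (intro mult_right_mono)
      have "40 * real n \<le> real n * real n" using n by (intro mult_right_mono) auto
      then show "real n + 2 \<le> real n * real n" using n by linarith
    qed auto
    also have "\<dots> = real n powr 2 * real n powr (- (c + 2))" using n by (simp add: powr_numeral power2_eq_square)
    also have "\<dots> = real n powr (2 + - (c + 2))" by (rule powr_add[symmetric])
    finally show ?thesis by simp
  qed
  then show ?thesis using \<kappa> by blast
qed

section \<open>Lower bounds on the number of rounds\<close>

text \<open>The errors are separated from the clustering. Under a common error pattern the tables of
  two clusterings differ only where the correct answers differ.\<close>

definition noise :: "nat \<Rightarrow> real \<Rightarrow> (nat set \<Rightarrow> bool) pmf" where
  "noise n p = Pi_pmf (all_pairs n) False (\<lambda>_. bernoulli_pmf p)"

definition noisy_table :: "nat \<Rightarrow> nat set set \<Rightarrow> (nat set \<Rightarrow> bool) \<Rightarrow> nat set \<Rightarrow> int" where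
  "noisy_table n G z e = (if e \<in> all_pairs n then if z e then - correct_answer G e else correct_answer G e else 0)"

lemma answer_table_noise: "answer_table n p G = map_pmf (noisy_table n G) (noise n p)"
proof -
  have "answer_table n p G = Pi_pmf (all_pairs n) 0 (\<lambda>e. bernoulli_pmf p \<bind>
      (\<lambda>b. return_pmf (if b then - correct_answer G e else correct_answer G e)))"
    unfolding answer_table_def noisy_answer_def map_pmf_def by simp
  also have "\<dots> = noise n p \<bind> (\<lambda>z. Pi_pmf (all_pairs n) 0 (\<lambda>e. return_pmf (if z e then - correct_answer G e else correct_answer G e)))"
    unfolding noise_def by (rule Pi_pmf_bind) simp
  also have "\<dots> = map_pmf (noisy_table n G) (noise n p)"
    unfolding map_pmf_def by (intro bind_pmf_cong refl) (simp add: noisy_table_def[abs_def])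
  finally show ?thesis .
qed

lemma prob_outcome_noise:
  "measure_pmf.prob (outcome n p G A) {(s, w). Q s w}
    = measure_pmf.prob (pair_pmf A (noise n p)) {(s, z). Q s (noisy_table n G z)}"
  unfolding outcome_def answer_table_noise pair_map_pmf2 by (simp add: vimage_def case_prod_beta')

lemma noisy_table_pm: "e \<in> all_pairs n \<Longrightarrow> noisy_table n G z e \<in> {-1, 1}"
  using correct_answer_pm[of G e] by (auto simp: noisy_table_def)

lemma prob_outcome_snd:
  "measure_pmf.prob (outcome n p G A) {(s, w). Q w} = measure_pmf.prob (answer_table n p G) {w. Q w}"
proof -
  have "measure_pmf.prob (answer_table n p G) {w. Q w} = measure_pmf.prob (map_pmf snd (outcome n p G A)) {w. Q w}"
    by (simp add: outcome_def map_snd_pair_pmf)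
  then show ?thesis by (simp add: vimage_def case_prod_beta')
qed

lemma prob_conj_ge:
  assumes "measure_pmf.prob M {x. P x} \<ge> 1 - a" "measure_pmf.prob M {x. \<not> Q x} \<le> b"
  shows "measure_pmf.prob M {x. P x \<and> Q x} \<ge> 1 - (a + b)"
proof -
  have "measure_pmf.prob M {x. P x} \<le> measure_pmf.prob M ({x. P x \<and> Q x} \<union> {x. \<not> Q x})"
    by (intro measure_pmf.finite_measure_mono) auto
  also have "\<dots> \<le> measure_pmf.prob M {x. P x \<and> Q x} + measure_pmf.prob M {x. \<not> Q x}"
    by (intro measure_Un_le) auto
  finally show ?thesis using assms by linarith
qed

lemma prob_not: "measure_pmf.prob M {x. P x} \<ge> 1 - a \<Longrightarrow> measure_pmf.prob M {x. \<not> P x} \<le> a"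
  using measure_pmf.prob_compl[of "{x. P x}" M] by (simp add: Compl_eq_Diff_UNIV[symmetric] Collect_neg_eq)

text \<open>Double counting: if every outcome lies in few of the events, the events cannot all be
  likely.\<close>

lemma sum_prob_le:
  assumes "finite I" "\<And>x. x \<in> set_pmf M \<Longrightarrow> real (card {i \<in> I. P i x}) \<le> B"
  shows "(\<Sum>i\<in>I. measure_pmf.prob M {x. P i x}) \<le> B"
proof -
  have "(\<Sum>i\<in>I. measure_pmf.prob M {x. P i x}) = (\<Sum>i\<in>I. measure_pmf.expectation M (indicator {x. P i x}))"
    by simp
  also have "\<dots> = measure_pmf.expectation M (\<lambda>x. \<Sum>i\<in>I. indicator {x. P i x} x)"
    by (subst Bochner_Integration.integral_sum)
       (auto intro!: measure_pmf.integrable_const_bound[where B = 1])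
  also have "\<dots> = measure_pmf.expectation M (\<lambda>x. real (card {i \<in> I. P i x}))"
    using assms(1) by (simp add: indicator_def sum.If_cases Int_def)
  also have "\<dots> \<le> measure_pmf.expectation M (\<lambda>_. B)"
  proof (rule integral_mono_AE)
    show "integrable (measure_pmf M) (\<lambda>x. real (card {i \<in> I. P i x}))"
      using assms(1) by (intro measure_pmf.integrable_const_bound[where B = "real (card I)"]) (auto intro!: card_mono)
  qed (use assms(2) in \<open>auto simp: AE_measure_pmf_iff\<close>)
  finally show ?thesis by simp
qed

text \<open>\<open>FF\<close> is the set of clusterings still considered possible.\<close>

definition tied :: "nat \<Rightarrow> nat set set set \<Rightarrow> nat \<Rightarrow> nat set" where
  "tied n FF u = {v \<in> {1..n}. \<forall>G\<in>FF. \<exists>S\<in>G. u \<in> S \<and> v \<in> S}"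

definition rank :: "nat \<Rightarrow> nat set set set \<Rightarrow> nat" where
  "rank n FF = card (tied n FF ` {1..n})"

section \<open>Counting the clusterings recovered under fixed errors\<close>

lemma same_block_trans:
  assumes "partition_on {1..n} G" "S \<in> G" "u \<in> S" "v \<in> S" "S' \<in> G" "v \<in> S'" "x \<in> S'"
  shows "\<exists>S\<in>G. u \<in> S \<and> x \<in> S"
proof -
  have "S = S'"
  proof (rule ccontr)
    assume "S \<noteq> S'"
    then have "S \<inter> S' = {}" using disjointD[OF partition_onD2[OF assms(1)] assms(2,5)] by simp
    then show False using assms(4,6) by auto
  qed
  then show ?thesis using assms(2,3,7) by auto
qed

lemma tied_eq:
  assumes FF: "\<And>G. G \<in> FF \<Longrightarrow> partition_on {1..n} G" and v: "v \<in> tied n FF u"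
  shows "tied n FF v = tied n FF u"
proof -
  have "(\<exists>S\<in>G. v \<in> S \<and> x \<in> S) \<longleftrightarrow> (\<exists>S\<in>G. u \<in> S \<and> x \<in> S)" if "G \<in> FF" for G x
  proof -
    from v that obtain S where S: "S \<in> G" "u \<in> S" "v \<in> S" by (auto simp: tied_def)
    show ?thesis
    proof
      assume "\<exists>S\<in>G. v \<in> S \<and> x \<in> S"
      then obtain S' where "S' \<in> G" "v \<in> S'" "x \<in> S'" by auto
      then show "\<exists>S\<in>G. u \<in> S \<and> x \<in> S" by (rule same_block_trans[OF FF[OF that] S])
    next
      assume "\<exists>S\<in>G. u \<in> S \<and> x \<in> S"
      then obtain S' where "S' \<in> G" "u \<in> S'" "x \<in> S'" by auto
      then show "\<exists>S\<in>G. v \<in> S \<and> x \<in> S" by (rule same_block_trans[OF FF[OF that] S(1,3,2)])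
    qed
  qed
  then show ?thesis unfolding tied_def by (intro Collect_cong conj_cong ball_cong refl)
qed

lemma tied_self:
  assumes "\<And>G. G \<in> FF \<Longrightarrow> partition_on {1..n} G" "u \<in> {1..n}"
  shows "u \<in> tied n FF u"
proof -
  have "\<exists>S\<in>G. u \<in> S" if "G \<in> FF" for G using partition_onD1[OF assms(1)[OF that]] assms(2) by blast
  then show ?thesis using assms(2) unfolding tied_def by simp
qed

text \<open>Fewer possible clusterings tie more vertices, so the old classes map onto the new ones;
  a new tie identifies two of them.\<close>

lemma rank_mono:
  assumes FF: "\<And>G. G \<in> FF \<Longrightarrow> partition_on {1..n} G" and sub: "FF' \<subseteq> FF"
  shows "rank n FF' \<le> rank n FF"
    and "u \<in> {1..n} \<Longrightarrow> v \<in> tied n FF' u \<Longrightarrow> v \<notin> tied n FF u \<Longrightarrow> rank n FF' < rank n FF"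
proof -
  define \<phi> where "\<phi> X = (\<Union>x\<in>X. tied n FF' x)" for X
  have FF': "\<And>G. G \<in> FF' \<Longrightarrow> partition_on {1..n} G" using FF sub by auto
  have \<phi>: "\<phi> (tied n FF u) = tied n FF' u" if "u \<in> {1..n}" for u
  proof -
    have "tied n FF' x = tied n FF' u" if "x \<in> tied n FF u" for x
    proof (rule tied_eq[OF FF'])
      show "x \<in> tied n FF' u" using that sub unfolding tied_def by blast
    qed
    then show ?thesis using tied_self[OF FF that] unfolding \<phi>_def by blast
  qed
  have im: "tied n FF' ` {1..n} = \<phi> ` (tied n FF ` {1..n})"
    unfolding image_image by (intro image_cong refl \<phi>[symmetric])
  show le: "rank n FF' \<le> rank n FF" unfolding rank_def im by (rule card_image_le) simp
  assume uv: "u \<in> {1..n}" "v \<in> tied n FF' u" "v \<notin> tied n FF u"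
  have v: "v \<in> {1..n}" using uv by (auto simp: tied_def)
  show "rank n FF' < rank n FF"
  proof (rule ccontr)
    assume "\<not> ?thesis"
    then have "card (\<phi> ` (tied n FF ` {1..n})) = card (tied n FF ` {1..n})" using le unfolding rank_def im by simp
    then have "inj_on \<phi> (tied n FF ` {1..n})" by (intro eq_card_imp_inj_on) auto
    moreover have "\<phi> (tied n FF u) = \<phi> (tied n FF v)" using \<phi> uv v tied_eq[OF FF' uv(2)] by simp
    ultimately have "tied n FF u = tied n FF v" using uv(1) v by (simp add: inj_on_def)
    then show False using tied_self[OF FF v] uv(3) by simp
  qed
qed

text \<open>Vertices in different blocks of a clustering that is still possible are not
  tied.\<close>

lemma rank_ge_card:
  assumes FF: "\<And>G. G \<in> FF \<Longrightarrow> partition_on {1..n} G" and G: "G \<in> FF"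
  shows "card G \<le> rank n FF"
proof -
  have p: "partition_on {1..n} G" using FF G .
  have "G \<subseteq> tied n {G} ` {1..n}"
  proof
    fix S assume S: "S \<in> G"
    then obtain u where u: "u \<in> S" using partition_onD3[OF p] by (metis ex_in_conv)
    have "tied n {G} u = S"
    proof
      show "S \<subseteq> tied n {G} u" using S u partition_onD1[OF p] unfolding tied_def by blast
      show "tied n {G} u \<subseteq> S"
        using disjointD[OF partition_onD2[OF p] S] u unfolding tied_def by blast
    qed
    moreover have "u \<in> {1..n}" using S u partition_onD1[OF p] by blast
    ultimately show "S \<in> tied n {G} ` {1..n}" by blast
  qed
  then have "card G \<le> rank n {G}" unfolding rank_def by (intro card_mono) auto
  also have "\<dots> \<le> rank n FF" using rank_mono(1)[of FF n "{G}"] FF G by auto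
  finally show ?thesis .
qed

text \<open>A query splits the possible clusterings in two. If both parts are nonempty, the positive answer
  lowers the rank, hence the recursion of binomial sums, here in the form of a generating function.\<close>

lemma count_batch:
  fixes a B :: real
  assumes a: "1 \<le> a" and B: "0 \<le> B" and E: "finite E" "E \<subseteq> all_pairs n"
    and FF: "finite FF" "\<And>G. G \<in> FF \<Longrightarrow> partition_on {1..n} G"
    and const: "\<And>FF'. FF' \<subseteq> FF \<Longrightarrow> (\<And>G G' e. G \<in> FF' \<Longrightarrow> G' \<in> FF' \<Longrightarrow> e \<in> E \<Longrightarrow> correct_answer G e = correct_answer G' e) \<Longrightarrow>
       real (card {G \<in> FF'. Q G}) \<le> B * a ^ rank n FF'"
  shows "real (card {G \<in> FF. Q G}) \<le> B * (1 + 1 / a) ^ card E * a ^ rank n FF"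
  using E FF const
proof (induction E arbitrary: FF rule: finite_induct)
  case empty
  then show ?case by simp
next
  case (insert e E)
  define Fp where "Fp = {G \<in> FF. correct_answer G e = 1}"
  define Fm where "Fm = {G \<in> FF. correct_answer G e \<noteq> 1}"
  have sub: "Fp \<subseteq> FF" "Fm \<subseteq> FF" "FF = Fp \<union> Fm" by (auto simp: Fp_def Fm_def)
  have fin: "finite Fp" "finite Fm" using insert.prems sub finite_subset by auto
  have m1: "correct_answer G e = -1" if "G \<in> Fm" for G
    using that correct_answer_pm[of G e] by (auto simp: Fm_def)
  let ?c = "B * (1 + 1 / a) ^ card E"
  have c0: "0 \<le> ?c" using a B by simp
  have Ip: "real (card {G \<in> Fp. Q G}) \<le> ?c * a ^ rank n Fp"
  proof (rule insert.IH)
    fix FF' assume s: "FF' \<subseteq> Fp" and c: "\<And>G G' e. G \<in> FF' \<Longrightarrow> G' \<in> FF' \<Longrightarrow> e \<in> E \<Longrightarrow> correct_answer G e = correct_answer G' e"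
    have ce: "correct_answer G e = 1" if "G \<in> FF'" for G using that s by (auto simp: Fp_def)
    show "real (card {G \<in> FF'. Q G}) \<le> B * a ^ rank n FF'"
    proof (rule insert.prems(4))
      fix G G' e' assume "G \<in> FF'" "G' \<in> FF'" "e' \<in> insert e E"
      then show "correct_answer G e' = correct_answer G' e'" using c ce by auto
    qed (use s sub in auto)
  qed (use insert.prems fin sub in auto)
  have Im: "real (card {G \<in> Fm. Q G}) \<le> ?c * a ^ rank n Fm"
  proof (rule insert.IH)
    fix FF' assume s: "FF' \<subseteq> Fm" and c: "\<And>G G' e. G \<in> FF' \<Longrightarrow> G' \<in> FF' \<Longrightarrow> e \<in> E \<Longrightarrow> correct_answer G e = correct_answer G' e"
    have ce: "correct_answer G e = -1" if "G \<in> FF'" for G using that s m1 by auto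
    show "real (card {G \<in> FF'. Q G}) \<le> B * a ^ rank n FF'"
    proof (rule insert.prems(4))
      fix G G' e' assume "G \<in> FF'" "G' \<in> FF'" "e' \<in> insert e E"
      then show "correct_answer G e' = correct_answer G' e'" using c ce by auto
    qed (use s sub in auto)
  qed (use insert.prems fin sub in auto)
  have "{G \<in> FF. Q G} = {G \<in> Fp. Q G} \<union> {G \<in> Fm. Q G}" using sub by auto
  then have "card {G \<in> FF. Q G} \<le> card {G \<in> Fp. Q G} + card {G \<in> Fm. Q G}" by (simp add: card_Un_le)
  then have tot: "real (card {G \<in> FF. Q G}) \<le> real (card {G \<in> Fp. Q G}) + real (card {G \<in> Fm. Q G})" by linarith
  have "B * (1 + 1 / a) ^ card (insert e E) * a ^ rank n FF = ?c * ((1 + 1 / a) * a ^ rank n FF)"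
    using insert.hyps by simp
  moreover have "real (card {G \<in> FF. Q G}) \<le> ?c * ((1 + 1 / a) * a ^ rank n FF)"
  \<comment> \<open>If the answer is forced, the query gains nothing and the factor
    \<open>1 + 1 / a\<close> is spare. Otherwise the positive branch has smaller rank and costs only
    the share \<open>1 / a\<close>.\<close>
  proof (cases "Fp = {} \<or> Fm = {}")
    case True
    have "real (card {G \<in> FF. Q G}) \<le> ?c * a ^ rank n FF"
    proof (cases "Fp = {}")
      case True
      then have "FF = Fm" using sub by simp
      then show ?thesis using Im by simp
    next
      case False
      then have "FF = Fp" using sub \<open>Fp = {} \<or> Fm = {}\<close> by simp
      then show ?thesis using Ip by simp
    qed
    also have "\<dots> \<le> ?c * ((1 + 1 / a) * a ^ rank n FF)"
      using c0 a by (intro mult_left_mono) (auto simp: algebra_simps)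
    finally show ?thesis .
  next
    case False
    then obtain Gp Gm where Gpm: "Gp \<in> Fp" "Gm \<in> Fm" by auto
    have "e \<in> all_pairs n" using insert.prems by simp
    then obtain u v where uv: "u \<in> {1..n}" "v \<in> {1..n}" "u \<noteq> v" "e = {u, v}" by (rule all_pairsE)
    have "v \<in> tied n Fp u"
      unfolding tied_def using uv by (auto simp: Fp_def correct_answer_def split: if_splits)
    moreover have "v \<notin> tied n FF u"
    proof
      assume "v \<in> tied n FF u"
      then have "\<exists>S\<in>Gm. e \<subseteq> S" using Gpm sub uv by (auto simp: tied_def)
      then show False using m1[OF Gpm(2)] by (simp add: correct_answer_def)
    qed
    ultimately have less: "rank n Fp < rank n FF"
      using rank_mono(2)[of FF n Fp u v] insert.prems(3) sub uv by auto
    then have "a ^ rank n Fp * a \<le> a ^ rank n FF"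
      unfolding power_Suc2[symmetric] using a by (intro power_increasing) auto
    then have 1: "a ^ rank n Fp \<le> a ^ rank n FF / a" using a by (simp add: field_simps)
    have 2: "a ^ rank n Fm \<le> a ^ rank n FF"
      using rank_mono(1)[of FF n Fm] insert.prems(3) sub a by (intro power_increasing) auto
    have "real (card {G \<in> FF. Q G}) \<le> ?c * (a ^ rank n FF / a) + ?c * a ^ rank n FF"
      using tot Ip Im mult_left_mono[OF 1 c0] mult_left_mono[OF 2 c0] by linarith
    then show ?thesis by (simp add: algebra_simps)
  qed
  ultimately show ?case by (simp only:)
qed

text \<open>With the errors fixed, a strategy is a decision tree on clusterings. Each query costs a
  factor \<open>1 + 1 / a\<close>; a leaf outputs one clustering, and if that has \<open>k\<close>
  blocks and is still possible, the rank is at least \<open>k\<close>, which makes up for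
  \<open>1 / a ^ k\<close>.\<close>

lemma count_recovered:
  fixes a :: real
  assumes a: "1 \<le> a" and FF: "finite FF" "\<And>G. G \<in> FF \<Longrightarrow> partition_on {1..n} G" "\<And>G. G \<in> FF \<Longrightarrow> card G = k"
    and adm: "admissible n b asked s"
  shows "real (card {G \<in> FF. run s (noisy_table n G z) = G \<and> rounds s (noisy_table n G z) \<le> r})
    \<le> 1 / a ^ k * (1 + 1 / a) ^ (b * r) * a ^ rank n FF"
  using FF adm
proof (induction s arbitrary: FF r asked)
  case (Output P)
  show ?case
  proof (cases "P \<in> FF")
    case False
    then have "{G \<in> FF. run (Output P) (noisy_table n G z) = G \<and> rounds (Output P) (noisy_table n G z) \<le> r} = {}" by auto
    then show ?thesis using a by (simp only: card.empty) simp
  next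
    case True
    then have "{G \<in> FF. run (Output P) (noisy_table n G z) = G \<and> rounds (Output P) (noisy_table n G z) \<le> r} = {P}" by auto
    moreover have "k \<le> rank n FF" using rank_ge_card[of FF n P] Output.prems True by auto
    then have "a ^ k \<le> a ^ rank n FF" using a by (rule power_increasing)
    then have "1 \<le> 1 / a ^ k * a ^ rank n FF" using a by (simp add: field_simps)
    moreover have "1 \<le> (1 + 1 / a) ^ (b * r)" using a by (intro one_le_power) auto
    ultimately show ?thesis
      using mult_mono[of 1 "1 / a ^ k * a ^ rank n FF" 1 "(1 + 1 / a) ^ (b * r)"] a by (simp add: mult_ac)
  qed
next
  case (Round E f)
  have E: "E \<subseteq> all_pairs n" "card E \<le> b" using Round.prems by auto
  have finE: "finite E" using E finite_subset finite_all_pairs by blast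
  show ?case
  proof (cases r)
    case 0
    then show ?thesis using a by simp
  next
    case (Suc r')
    let ?Q = "\<lambda>G. run (Round E f) (noisy_table n G z) = G \<and> rounds (Round E f) (noisy_table n G z) \<le> r"
    let ?B = "1 / a ^ k * (1 + 1 / a) ^ (b * r')"
    have "real (card {G \<in> FF. ?Q G}) \<le> ?B * (1 + 1 / a) ^ card E * a ^ rank n FF"
    proof (rule count_batch[OF a _ finE E(1) Round.prems(1,2)])
      show "0 \<le> ?B" using a by simp
      fix FF' assume sub: "FF' \<subseteq> FF"
        and c: "\<And>G G' e. G \<in> FF' \<Longrightarrow> G' \<in> FF' \<Longrightarrow> e \<in> E \<Longrightarrow> correct_answer G e = correct_answer G' e"
      show "real (card {G \<in> FF'. ?Q G}) \<le> ?B * a ^ rank n FF'"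
      proof (cases "FF' = {}")
        case True
        then show ?thesis using a by simp
      next
        case False
        then obtain G0 where G0: "G0 \<in> FF'" by auto
        let ?ans = "restrict (noisy_table n G0 z) E"
        \<comment> \<open>Equal correct answers and equal errors: the strategy continues in the same
          way for all of \<open>FF'\<close>.\<close>
        have ans: "restrict (noisy_table n G z) E = ?ans" if "G \<in> FF'" for G
          using c[OF that G0] by (intro ext) (auto simp: noisy_table_def restrict_def)
        have "{G \<in> FF'. ?Q G} = {G \<in> FF'. run (f ?ans) (noisy_table n G z) = G \<and> rounds (f ?ans) (noisy_table n G z) \<le> r'}"
          using ans Suc by auto
        moreover have "?ans \<in> E \<rightarrow>\<^sub>E {-1, 1}"
        proof (rule PiE_I)
          fix e assume "e \<in> E"
          then show "?ans e \<in> {-1, 1}" using noisy_table_pm[of e n G0 z] E by auto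
        qed auto
        then have "admissible n b (asked \<union> E) (f ?ans)" using Round.prems(4) by simp
        then have "real (card {G \<in> FF'. run (f ?ans) (noisy_table n G z) = G \<and> rounds (f ?ans) (noisy_table n G z) \<le> r'}) \<le> ?B * a ^ rank n FF'"
          using sub Round.prems(1-3) finite_subset[OF sub] by (intro Round.IH) auto
        ultimately show ?thesis by simp
      qed
    qed
    also have "\<dots> \<le> ?B * (1 + 1 / a) ^ b * a ^ rank n FF"
      using a E(2) by (intro mult_right_mono mult_left_mono power_increasing) auto
    also have "\<dots> = 1 / a ^ k * (1 + 1 / a) ^ (b * r) * a ^ rank n FF"
      unfolding Suc by (simp add: power_add mult_ac)
    finally show ?thesis .
  qed
qed

text \<open>Clusterings into \<open>k\<close> clusters with fixed disjoint cores of size \<open>l\<close>; the other vertices are free.\<close>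

definition core_label :: "nat \<Rightarrow> nat \<Rightarrow> (nat \<Rightarrow> nat) \<Rightarrow> nat \<Rightarrow> nat" where
  "core_label k l g v = (if v \<le> k * l then (v - 1) div l else g v)"

definition core_clustering :: "nat \<Rightarrow> nat \<Rightarrow> nat \<Rightarrow> (nat \<Rightarrow> nat) \<Rightarrow> nat set set" where
  "core_clustering n k l g = (\<lambda>j. {v \<in> {1..n}. core_label k l g v = j}) ` {..<k}"

definition core_clusterings :: "nat \<Rightarrow> nat \<Rightarrow> nat \<Rightarrow> nat set set set" where
  "core_clusterings n k l = core_clustering n k l ` ({k * l<..n} \<rightarrow>\<^sub>E {..<k})"

section \<open>Clusterings with prescribed cores\<close>

context
  fixes n k l :: nat
  assumes l: "0 < l" and kl: "k * l \<le> n"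
begin

lemma core_label_less:
  assumes "g \<in> {k * l<..n} \<rightarrow>\<^sub>E {..<k}" "v \<in> {1..n}"
  shows "core_label k l g v < k"
proof (cases "v \<le> k * l")
  case True
  then have "v - 1 < k * l" using assms by auto
  then show ?thesis using True by (simp add: core_label_def less_mult_imp_div_less)
next
  case False
  then show ?thesis using assms by (auto simp: core_label_def PiE_iff)
qed

lemma core_in: "j < k \<Longrightarrow> i < l \<Longrightarrow> j * l + i + 1 \<in> {1..n} \<and> core_label k l g (j * l + i + 1) = j"
proof -
  assume ji: "j < k" "i < l"
  have "(j + 1) * l \<le> k * l" using ji by (intro mult_right_mono) auto
  then have "j * l + i + 1 \<le> k * l" using ji by (simp add: algebra_simps)
  moreover have "(j * l + i) div l = j" using ji by simp
  ultimately show ?thesis using kl by (simp add: core_label_def)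
qed

lemma core_clustering_props:
  assumes g: "g \<in> {k * l<..n} \<rightarrow>\<^sub>E {..<k}"
  shows "partition_on {1..n} (core_clustering n k l g)" "card (core_clustering n k l g) = k"
    "S \<in> core_clustering n k l g \<Longrightarrow> l \<le> card S"
proof -
  let ?S = "\<lambda>j. {v \<in> {1..n}. core_label k l g v = j}"
  have ne: "?S j \<noteq> {}" if "j < k" for j using core_in[OF that l] by blast
  have "partition_on {1..n} (?S ` {..<k} - {{}})"
    using core_label_less[OF g] by (intro partition_on_image) (auto simp: disjoint_family_on_def)
  moreover have "?S ` {..<k} - {{}} = ?S ` {..<k}" using ne by auto
  ultimately show "partition_on {1..n} (core_clustering n k l g)" by (simp add: core_clustering_def)
  have "inj_on ?S {..<k}"
  proof (rule inj_onI)
    fix i j assume ij: "i \<in> {..<k}" "j \<in> {..<k}" "?S i = ?S j"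
    then obtain v where "v \<in> ?S i" using ne[of i] by blast
    then show "i = j" using ij(3) by auto
  qed
  then show "card (core_clustering n k l g) = k" by (simp add: core_clustering_def card_image)
  assume "S \<in> core_clustering n k l g"
  then obtain j where j: "j < k" "S = ?S j" by (auto simp: core_clustering_def)
  have "card ((\<lambda>i. j * l + i + 1) ` {..<l}) = l" by (subst card_image) (auto simp: inj_on_def)
  moreover have "(\<lambda>i. j * l + i + 1) ` {..<l} \<subseteq> S" using core_in[OF j(1)] j(2) by auto
  moreover have "finite S" using j(2) by simp
  ultimately show "l \<le> card S" by (metis card_mono)
qed

text \<open>A clustering does not remember labels, but the core inside a block reveals which label
  it had.\<close>

lemma core_clustering_inj: "inj_on (core_clustering n k l) ({k * l<..n} \<rightarrow>\<^sub>E {..<k})"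
proof (rule inj_onI)
  fix g g' assume g: "g \<in> {k * l<..n} \<rightarrow>\<^sub>E {..<k}" "g' \<in> {k * l<..n} \<rightarrow>\<^sub>E {..<k}"
    and eq: "core_clustering n k l g = core_clustering n k l g'"
  show "g = g'"
  proof (rule PiE_ext[OF g])
    fix v assume v: "v \<in> {k * l<..n}"
    let ?j = "g v"
    have j: "?j < k" using g(1) v by (auto simp: PiE_iff)
    let ?S = "{u \<in> {1..n}. core_label k l g u = ?j}"
    have vS: "v \<in> ?S" using v by (auto simp: core_label_def)
    have cS: "?j * l + 0 + 1 \<in> ?S" using core_in[OF j l, of g] unfolding mem_Collect_eq .
    have "?S \<in> core_clustering n k l g"
      unfolding core_clustering_def by (rule image_eqI[of _ _ ?j]) (use j in simp_all)
    then have "?S \<in> core_clustering n k l g'" unfolding eq .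
    then obtain j' where j': "?S = {u \<in> {1..n}. core_label k l g' u = j'}" by (auto simp: core_clustering_def)
    have "core_label k l g' (?j * l + 0 + 1) = j'" using cS unfolding j' by blast
    then have "j' = ?j" using core_in[OF j l, of g'] by simp
    moreover have "core_label k l g' v = j'" using vS unfolding j' by blast
    ultimately show "g v = g' v" using v by (simp add: core_label_def)
  qed
qed

text \<open>The vertices of a core are tied throughout the family, so the classes are at most the
  cores and the free vertices.\<close>

lemma core_clusterings_props:
  "finite (core_clusterings n k l)" "card (core_clusterings n k l) = k ^ (n - k * l)"
  "rank n (core_clusterings n k l) \<le> k + (n - k * l)"
proof -
  have fin: "finite ({k * l<..n} \<rightarrow>\<^sub>E {..<k})" by (intro finite_PiE) auto
  then show "finite (core_clusterings n k l)" by (simp add: core_clusterings_def)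
  show "card (core_clusterings n k l) = k ^ (n - k * l)"
    unfolding core_clusterings_def card_image[OF core_clustering_inj] by (simp add: card_PiE)
  let ?t = "tied n (core_clusterings n k l)"
  have part: "\<And>G. G \<in> core_clusterings n k l \<Longrightarrow> partition_on {1..n} G"
    using core_clustering_props(1) by (auto simp: core_clusterings_def)
  have "?t ` {1..n} \<subseteq> ?t ` ((\<lambda>j. j * l + 0 + 1) ` {..<k} \<union> {k * l<..n})"
  proof
    fix X assume "X \<in> ?t ` {1..n}"
    then obtain v where v: "v \<in> {1..n}" "X = ?t v" by auto
    show "X \<in> ?t ` ((\<lambda>j. j * l + 0 + 1) ` {..<k} \<union> {k * l<..n})"
    proof (cases "v \<le> k * l")
      case False
      then show ?thesis using v by auto
    next
      case True
      let ?j = "(v - 1) div l"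
      have "v - 1 < k * l" using True v by auto
      then have j: "?j < k" by (simp add: less_mult_imp_div_less)
      have "v \<in> ?t (?j * l + 0 + 1)"
        unfolding tied_def
      proof (intro CollectI conjI ballI v(1))
        fix G assume "G \<in> core_clusterings n k l"
        then obtain g where g: "G = core_clustering n k l g" by (auto simp: core_clusterings_def)
        let ?S = "{u \<in> {1..n}. core_label k l g u = ?j}"
        have "?S \<in> G" using j by (auto simp: g core_clustering_def)
        moreover have "v \<in> ?S" using True v by (simp add: core_label_def)
        moreover have "?j * l + 0 + 1 \<in> ?S" using core_in[OF j l, of g] unfolding mem_Collect_eq .
        ultimately show "\<exists>S\<in>G. ?j * l + 0 + 1 \<in> S \<and> v \<in> S" by (intro bexI[of _ ?S] conjI)
      qed
      then have "?t v = ?t (?j * l + 0 + 1)" by (intro tied_eq part)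
      then show ?thesis using v j by blast
    qed
  qed
  then have "rank n (core_clusterings n k l) \<le> card (?t ` ((\<lambda>j. j * l + 0 + 1) ` {..<k} \<union> {k * l<..n}))"
    unfolding rank_def by (intro card_mono) auto
  also have "\<dots> \<le> card ((\<lambda>j. j * l + 0 + 1) ` {..<k} \<union> {k * l<..n})" by (intro card_image_le) auto
  also have "\<dots> \<le> card ((\<lambda>j. j * l + 0 + 1) ` {..<k}) + card {k * l<..n}" by (rule card_Un_le)
  also have "\<dots> \<le> k + (n - k * l)" using card_image_le[of "{..<k}" "\<lambda>j. j * l + 0 + 1"] by simp
  finally show "rank n (core_clusterings n k l) \<le> k + (n - k * l)" .
qed

end

text \<open>An arbitrary algorithm meeting the requirement. The locale serves to turn this
  requirement into a statement about the true clustering: the estimate contains every cluster of at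
  least \<open>l\<close> vertices with high probability.\<close>

locale recovery =
  fixes n b :: nat and p d \<mu> \<epsilon> K :: real and A :: "strategy pmf" and l :: nat
  assumes rec: "recovers_estimate n b p d A"
    and typical: "\<And>G. partition_on {1..n} G \<Longrightarrow> measure_pmf.prob (answer_table n p G) {w. \<not> good_table n G \<mu> \<epsilon> K w} \<le> d"
    and d: "0 \<le> d" "d \<le> 1 / 8"
    and l: "large_size \<mu> K \<le> real l" "2 \<le> l"
begin

definition fast :: "nat \<Rightarrow> nat \<Rightarrow> bool" where
  "fast k r \<longleftrightarrow> (\<forall>G. partition_on {1..n} G \<and> card G = k \<longrightarrow>
     measure_pmf.prob (outcome n p G A) {(s, w). rounds s w \<le> r} \<ge> 1 - d)"

lemma large_recovered:
  assumes G: "partition_on {1..n} G"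
  shows "measure_pmf.prob (outcome n p G A)
    {(s, w). max_likelihood n w (run s w) \<and> (\<forall>S\<in>G. l \<le> card S \<longrightarrow> S \<in> run s w)} \<ge> 1 - 2 * d"
proof -
  let ?O = "outcome n p G A"
  have 1: "measure_pmf.prob ?O {x. case x of (s, w) \<Rightarrow> max_likelihood n w (run s w)} \<ge> 1 - d"
    using rec G by (auto simp: recovers_estimate_def)
  have 2: "measure_pmf.prob ?O {x. \<not> (case x of (s, w) \<Rightarrow> good_table n G \<mu> \<epsilon> K w)} \<le> d"
    using typical[OF G] prob_outcome_snd[of n p G A "\<lambda>w. \<not> good_table n G \<mu> \<epsilon> K w"] by (simp add: case_prod_beta')
  have "1 - (d + d) \<le> measure_pmf.prob ?O {x. (case x of (s, w) \<Rightarrow> max_likelihood n w (run s w)) \<and> (case x of (s, w) \<Rightarrow> good_table n G \<mu> \<epsilon> K w)}"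
    by (rule prob_conj_ge[OF 1 2])
  also have "\<dots> \<le> measure_pmf.prob ?O {(s, w). max_likelihood n w (run s w) \<and> (\<forall>S\<in>G. l \<le> card S \<longrightarrow> S \<in> run s w)}"
  proof (intro measure_pmf.finite_measure_mono subsetI)
    fix x assume "x \<in> {x. (case x of (s, w) \<Rightarrow> max_likelihood n w (run s w)) \<and> (case x of (s, w) \<Rightarrow> good_table n G \<mu> \<epsilon> K w)}"
    then obtain s w where x: "x = (s, w)" "max_likelihood n w (run s w)" "good_table n G \<mu> \<epsilon> K w" by auto
    have "S \<in> run s w" if "S \<in> G" "l \<le> card S" for S
      using good_table.large_in_ml[OF x(3,2) that(1)] that(2) l by simp
    then show "x \<in> {(s, w). max_likelihood n w (run s w) \<and> (\<forall>S\<in>G. l \<le> card S \<longrightarrow> S \<in> run s w)}" using x by auto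
  qed auto
  finally show ?thesis by simp
qed

lemma large_clusters_exact:
  assumes G: "partition_on {1..n} G" "\<And>S. S \<in> G \<Longrightarrow> l \<le> card S"
  shows "measure_pmf.prob (outcome n p G A) {(s, w). run s w = G} \<ge> 1 - 2 * d"
proof -
  have "{(s, w). max_likelihood n w (run s w) \<and> (\<forall>S\<in>G. l \<le> card S \<longrightarrow> S \<in> run s w)} \<subseteq> {(s, w). run s w = G}"
  proof clarify
    fix s w assume ml: "max_likelihood n w (run s w)" and sub: "\<forall>S\<in>G. l \<le> card S \<longrightarrow> S \<in> run s w"
    have p: "partition_on {1..n} (run s w)" using ml by (simp add: max_likelihood_def is_arg_max_def)
    have GR: "G \<subseteq> run s w" using sub G(2) by auto
    have "B \<in> G" if B: "B \<in> run s w" for B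
    proof -
      obtain v where v: "v \<in> B" using partition_onD3[OF p] B by (metis ex_in_conv)
      then have "v \<in> {1..n}" using partition_onD1[OF p] B by blast
      then obtain S where S: "S \<in> G" "v \<in> S" using partition_onD1[OF G(1)] by blast
      have "B = S"
      proof (rule ccontr)
        assume "B \<noteq> S"
        then have "B \<inter> S = {}" using disjointD[OF partition_onD2[OF p] B, of S] S GR by auto
        then show False using v S by auto
      qed
      then show ?thesis using S by simp
    qed
    then show "run s w = G" using GR by auto
  qed
  then have "measure_pmf.prob (outcome n p G A) {(s, w). max_likelihood n w (run s w) \<and> (\<forall>S\<in>G. l \<le> card S \<longrightarrow> S \<in> run s w)}
      \<le> measure_pmf.prob (outcome n p G A) {(s, w). run s w = G}"
    by (intro measure_pmf.finite_measure_mono) auto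
  then show ?thesis using large_recovered[OF G(1)] by linarith
qed

lemma exact_and_fast:
  assumes G: "partition_on {1..n} G" "\<And>S. S \<in> G \<Longrightarrow> l \<le> card S" and r: "fast (card G) r"
  shows "measure_pmf.prob (outcome n p G A) {(s, w). run s w = G \<and> rounds s w \<le> r} \<ge> 5 / 8"
proof -
  let ?O = "outcome n p G A"
  have 1: "measure_pmf.prob ?O {x. case x of (s, w) \<Rightarrow> run s w = G} \<ge> 1 - 2 * d"
    using large_clusters_exact[OF G] .
  have "measure_pmf.prob ?O {x. case x of (s, w) \<Rightarrow> rounds s w \<le> r} \<ge> 1 - d"
    using r G(1) by (simp add: fast_def)
  then have 2: "measure_pmf.prob ?O {x. \<not> (case x of (s, w) \<Rightarrow> rounds s w \<le> r)} \<le> d" by (rule prob_not)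
  have "{x. (case x of (s, w) \<Rightarrow> run s w = G) \<and> (case x of (s, w) \<Rightarrow> rounds s w \<le> r)} = {(s, w). run s w = G \<and> rounds s w \<le> r}"
    by auto
  then show ?thesis using prob_conj_ge[OF 1 2] d by simp
qed

lemma adm: "s \<in> set_pmf A \<Longrightarrow> admissible n b {} s"
  using rec by (auto simp: recovers_estimate_def)

text \<open>Each of the \<open>k ^ (n - k * l)\<close> clusterings is recovered in time with
  probability at least one half, so under some errors half of them are;
  \<open>count_recovered\<close> limits how many this can be.\<close>

lemma rounds_lower_balanced:
  assumes k: "9 \<le> k" "2 * k * l \<le> n" and r: "fast k r"
  shows "n * k \<le> 18 * (b * r)"
proof -
  let ?FF = "core_clusterings n k l" and ?f = "n - k * l"
  \<comment> \<open>With this weight the powers of \<open>a\<close> cancel and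
    \<open>9 ^ f \<le> 2 * exp (b * r / a)\<close> remains, \<open>f\<close> being the number of
    free vertices. The base exceeds \<open>exp 2\<close>, which leaves room for the factor
    \<open>2\<close>.\<close>
  define a where "a = real k / 9"
  have a: "1 \<le> a" using k by (simp add: a_def)
  have l0: "0 < l" and kl: "k * l \<le> n" using l k by auto
  note props = core_clusterings_props[OF l0 kl]
  have FF: "partition_on {1..n} G" "card G = k" "\<And>S. S \<in> G \<Longrightarrow> l \<le> card S" if "G \<in> ?FF" for G
    using that core_clustering_props[OF l0 kl] by (auto simp: core_clusterings_def)
  have "real k ^ ?f * (1 / 2) = (\<Sum>G\<in>?FF. 1 / 2)" by (simp add: props)
  also have "\<dots> \<le> (\<Sum>G\<in>?FF. measure_pmf.prob (pair_pmf A (noise n p)) {x. case x of (s, z) \<Rightarrow> run s (noisy_table n G z) = G \<and> rounds s (noisy_table n G z) \<le> r})"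
  proof (rule sum_mono)
    fix G assume "G \<in> ?FF"
    note G = FF[OF this]
    have "5 / 8 \<le> measure_pmf.prob (outcome n p G A) {(s, w). run s w = G \<and> rounds s w \<le> r}"
      using G r by (intro exact_and_fast) auto
    then show "1 / 2 \<le> measure_pmf.prob (pair_pmf A (noise n p)) {x. case x of (s, z) \<Rightarrow> run s (noisy_table n G z) = G \<and> rounds s (noisy_table n G z) \<le> r}"
      unfolding prob_outcome_noise[of n p G A "\<lambda>s w. run s w = G \<and> rounds s w \<le> r"] by linarith
  qed
  also have "\<dots> \<le> 1 / a ^ k * (1 + 1 / a) ^ (b * r) * a ^ (k + ?f)"
  proof (rule sum_prob_le[OF props(1)])
    fix x assume "x \<in> set_pmf (pair_pmf A (noise n p))"
    then obtain s z where x: "x = (s, z)" "s \<in> set_pmf A" by auto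
    have "real (card {G \<in> ?FF. run s (noisy_table n G z) = G \<and> rounds s (noisy_table n G z) \<le> r})
      \<le> 1 / a ^ k * (1 + 1 / a) ^ (b * r) * a ^ rank n ?FF"
      using a props(1) FF adm[OF x(2)] by (intro count_recovered) auto
    also have "\<dots> \<le> 1 / a ^ k * (1 + 1 / a) ^ (b * r) * a ^ (k + ?f)"
      using a props(3) by (intro mult_left_mono power_increasing) auto
    finally show "real (card {G \<in> ?FF. case x of (s, z) \<Rightarrow> run s (noisy_table n G z) = G \<and> rounds s (noisy_table n G z) \<le> r})
      \<le> 1 / a ^ k * (1 + 1 / a) ^ (b * r) * a ^ (k + ?f)" by (simp add: x)
  qed
  also have "\<dots> = (1 + 1 / a) ^ (b * r) * a ^ ?f" using a by (simp add: power_add)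
  also have "\<dots> \<le> exp (1 / a) ^ (b * r) * a ^ ?f"
    using a by (intro mult_right_mono power_mono exp_ge_add_one_self) auto
  finally have "(9 * a) ^ ?f * (1 / 2) \<le> exp (1 / a) ^ (b * r) * a ^ ?f" by (simp add: a_def)
  then have "(9 ^ ?f * (1 / 2)) * a ^ ?f \<le> exp (1 / a) ^ (b * r) * a ^ ?f" by (simp add: power_mult_distrib)
  then have "9 ^ ?f * (1 / 2) \<le> exp (1 / a) ^ (b * r)" using a by (simp add: mult_le_cancel_right)
  also have "\<dots> = exp (real (b * r) / a)" by (simp flip: exp_of_nat_mult)
  finally have 1: "9 ^ ?f \<le> 2 * exp (real (b * r) / a)" by simp
  have e9: "exp 2 \<le> (9 :: real)"
  proof -
    have "exp 1 ^ 2 \<le> (3 :: real) ^ 2" by (intro power_mono exp_le) auto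
    then show ?thesis by (simp flip: exp_of_nat_mult)
  qed
  have "exp (2 * real ?f) = exp 2 ^ ?f" by (simp add: mult.commute flip: exp_of_nat_mult)
  also have "\<dots> \<le> 9 ^ ?f" using e9 by (intro power_mono) auto
  also have "\<dots> \<le> exp 1 * exp (real (b * r) / a)"
    using 1 exp_ge_add_one_self[of "1 :: real"] by (intro order_trans[OF 1] mult_right_mono) auto
  finally have "2 * real ?f \<le> 1 + real (b * r) / a" by (simp flip: exp_add)
  moreover have "real n \<le> 2 * real ?f"
  proof -
    have "n \<le> 2 * ?f" using k(2) by simp
    then have "real n \<le> real (2 * ?f)" by (simp only: of_nat_le_iff)
    then show ?thesis by simp
  qed
  moreover have "1 \<le> real ?f"
  proof -
    have "1 \<le> k * l" using k l by simp
    then have "1 \<le> ?f" using k(2) by linarith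
    then show ?thesis by (simp only: of_nat_1 flip: of_nat_le_iff)
  qed
  ultimately have "real n \<le> 2 * (real (b * r) / a)" by linarith
  then have "real n * real k \<le> 18 * real (b * r)" using k by (simp add: a_def field_simps)
  then have "real (n * k) \<le> real (18 * (b * r))" by simp
  then show ?thesis by linarith
qed

text \<open>Without queries the output is independent of the answers, so it cannot be right with
  probability above one half for two clusterings. This serves the case of fewer than
  \<open>9\<close> clusters, where one round already suffices for the bound.\<close>

lemma rounds_positive:
  assumes k: "1 \<le> k" "2 * k * l \<le> n" and r: "fast k r"
  shows "1 \<le> r"
proof (rule ccontr)
  assume "\<not> ?thesis"
  then have "r = 0" by simp
  then have r0: "fast k 0" using r by (simp only:)
  have l0: "0 < l" using l by simp
  have ex: "\<exists>G. partition_on {1..n} G \<and> card G = j \<and> (\<forall>S\<in>G. l \<le> card S)" if j: "1 \<le> j" "j * l \<le> n" for j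
  proof -
    have "restrict (\<lambda>_. 0) {j * l<..n} \<in> {j * l<..n} \<rightarrow>\<^sub>E {..<j}" using j by auto
    from core_clustering_props[OF l0 j(2) this] show ?thesis by blast
  qed
  obtain G where G: "partition_on {1..n} G" "card G = k" "\<And>S. S \<in> G \<Longrightarrow> l \<le> card S"
    using ex[of k] k by auto
  have "1 * l \<le> k * l" using k by (intro mult_right_mono) auto
  then have "1 * l \<le> n" "2 * l \<le> n" using k(2) by linarith+
  \<comment> \<open>Any other clustering into large clusters will do: it has to be recovered, but
    not quickly.\<close>
  then obtain G' where G': "partition_on {1..n} G'" "card G' = (if k = 1 then 2 else 1)" "\<And>S. S \<in> G' \<Longrightarrow> l \<le> card S"
    using ex[of 1] ex[of 2] by (cases "k = 1") auto
  have ne: "G \<noteq> G'" using G(2) G'(2) by (auto split: if_splits)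
  have fst_prob: "measure_pmf.prob (outcome n p H A) {(s, w). s = Output G} = measure_pmf.prob A {Output G}" for H
  proof -
    have "measure_pmf.prob A {Output G} = measure_pmf.prob (map_pmf fst (outcome n p H A)) {Output G}"
      by (simp add: outcome_def map_fst_pair_pmf)
    also have "\<dots> = measure_pmf.prob (outcome n p H A) (fst -` {Output G})" by simp
    also have "fst -` {Output G} = {(s, w :: nat set \<Rightarrow> int). s = Output G}" by auto
    finally show ?thesis ..
  qed
  have "run s w = G \<and> rounds s w \<le> 0 \<Longrightarrow> s = Output G" for s w by (cases s) auto
  then have "measure_pmf.prob (outcome n p G A) {(s, w). run s w = G \<and> rounds s w \<le> 0} \<le> measure_pmf.prob (outcome n p G A) {(s, w). s = Output G}"
    by (intro measure_pmf.finite_measure_mono) auto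
  moreover have "5 / 8 \<le> measure_pmf.prob (outcome n p G A) {(s, w). run s w = G \<and> rounds s w \<le> 0}"
    using G r0 by (intro exact_and_fast) auto
  ultimately have 1: "5 / 8 \<le> measure_pmf.prob (outcome n p G' A) {(s, w). s = Output G}"
    unfolding fst_prob by linarith
  have 2: "1 - 2 * d \<le> measure_pmf.prob (outcome n p G' A) {(s, w). run s w = G'}"
    using G' by (intro large_clusters_exact) auto
  have "measure_pmf.prob (outcome n p G' A) ({(s, w). s = Output G} \<union> {(s, w). run s w = G'})
     = measure_pmf.prob (outcome n p G' A) {(s, w). s = Output G} + measure_pmf.prob (outcome n p G' A) {(s, w). run s w = G'}"
    using ne by (intro measure_pmf.finite_measure_Union) auto
  then have "5 / 8 + (1 - 2 * d) \<le> 1"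
    using 1 2 measure_pmf.prob_le_1[of "outcome n p G' A" "{(s, w). s = Output G} \<union> {(s, w). run s w = G'}"] by linarith
  then show False using d by simp
qed

end

section \<open>Merged singletons: the bound for many clusters\<close>

primrec asked :: "strategy \<Rightarrow> (nat set \<Rightarrow> int) \<Rightarrow> nat set set" where
  "asked (Output P) w = {}"
| "asked (Round E f) w = E \<union> asked (f (restrict w E)) w"

lemma run_cong: "(\<And>e. e \<in> asked s w \<Longrightarrow> w e = w' e) \<Longrightarrow> run s w' = run s w"
proof (induction s)
  case (Round E f)
  have eq: "restrict w' E = restrict w E"
  proof
    fix e show "restrict w' E e = restrict w E e" using Round.prems[of e] by (cases "e \<in> E") auto
  qed
  have "run (f (restrict w E)) w' = run (f (restrict w E)) w"
    by (rule Round.IH) (use Round.prems in auto)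
  then show ?case by (simp add: eq)
qed simp

lemma card_asked:
  assumes "admissible n b Q s" "\<And>e. e \<in> all_pairs n \<Longrightarrow> w e \<in> {-1, 1}"
  shows "asked s w \<subseteq> all_pairs n" "card (asked s w) \<le> b * rounds s w"
proof -
  have "asked s w \<subseteq> all_pairs n \<and> card (asked s w) \<le> b * rounds s w"
    using assms(1)
  proof (induction s arbitrary: Q)
    case (Round E f)
    have "restrict w E \<in> E \<rightarrow>\<^sub>E {-1, 1}"
    proof (rule PiE_I)
      fix e assume "e \<in> E"
      then show "restrict w E e \<in> {-1, 1}" using assms(2)[of e] Round.prems by auto
    qed auto
    then have "admissible n b (Q \<union> E) (f (restrict w E))" using Round.prems by simp
    from Round.IH[OF _ this] have IH: "asked (f (restrict w E)) w \<subseteq> all_pairs n"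
      "card (asked (f (restrict w E)) w) \<le> b * rounds (f (restrict w E)) w" by auto
    then show ?case using Round.prems card_Un_le[of E "asked (f (restrict w E)) w"] by auto
  qed simp
  then show "asked s w \<subseteq> all_pairs n" "card (asked s w) \<le> b * rounds s w" by auto
qed

text \<open>Vertices below \<open>k\<close> are arranged in a grid of \<open>l\<close> rows of length \<open>m\<close>; \<open>graph_set\<close> picks one
  vertex in each row. Two fixed vertices lie in few of these sets.\<close>

definition graph_set :: "nat \<Rightarrow> nat \<Rightarrow> (nat \<Rightarrow> nat) \<Rightarrow> nat set" where
  "graph_set l m h = (\<lambda>x. x * m + h x + 1) ` {..<l}"

definition dust :: "nat \<Rightarrow> nat \<Rightarrow> nat set set" where
  "dust n k = insert {k..n} ((\<lambda>v. {v}) ` {1..<k})"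

text \<open>Merging \<open>U\<close> may change the number of clusters. Of these instances only
  correctness is used; the rounds are counted on \<open>dust\<close>, which has \<open>k\<close>
  clusters.\<close>

definition dust_with :: "nat \<Rightarrow> nat \<Rightarrow> nat set \<Rightarrow> nat set set" where
  "dust_with n k U = insert {k..n} (insert U ((\<lambda>v. {v}) ` ({1..<k} - U)))"

lemma dust_partition:
  assumes "1 \<le> k" "k \<le> n"
  shows "partition_on {1..n} (dust n k)" "card (dust n k) = k"
proof -
  show "partition_on {1..n} (dust n k)"
    using assms by (intro partition_onI) (auto simp: dust_def disjnt_def)
  have "{k..n} \<notin> (\<lambda>v. {v}) ` {1..<k}" 
  proof
    assume "{k..n} \<in> (\<lambda>v. {v}) ` {1..<k}"
    moreover have "k \<in> {k..n}" using assms by simp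
    ultimately show False by auto
  qed
  then have "card (dust n k) = Suc (card ((\<lambda>v. {v}) ` {1..<k}))" by (simp add: dust_def)
  also have "card ((\<lambda>v. {v}) ` {1..<k}) = k - 1" by (subst card_image) auto
  finally show "card (dust n k) = k" using assms by simp
qed

lemma dust_with_partition:
  assumes "1 \<le> k" "k \<le> n" "U \<subseteq> {1..<k}" "U \<noteq> {}"
  shows "partition_on {1..n} (dust_with n k U)"
proof (rule partition_onI)
  show "\<Union> (dust_with n k U) = {1..n}" using assms by (auto simp: dust_with_def)
  show "{} \<notin> dust_with n k U" using assms by (auto simp: dust_with_def)
  have 1: "disjnt {k..n} U" "disjnt U {k..n}" using assms(3) unfolding disjnt_def by fastforce+
  have 2: "disjnt {k..n} {v}" "disjnt {v} {k..n}" "disjnt U {v}" "disjnt {v} U" if "v \<in> {1..<k} - U" for v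
    using that by auto
  fix p p' assume p: "p \<in> dust_with n k U" "p' \<in> dust_with n k U" "p \<noteq> p'"
  have "p = {k..n} \<or> p = U \<or> (\<exists>v\<in>{1..<k} - U. p = {v})"
    "p' = {k..n} \<or> p' = U \<or> (\<exists>v\<in>{1..<k} - U. p' = {v})"
    using p(1,2) unfolding dust_with_def by blast+
  then show "disjnt p p'" by (elim disjE bexE) (use p(3) 1 2 in simp_all)
qed

lemma dust_same_answer:
  assumes "e \<in> all_pairs n" "\<not> e \<subseteq> U"
  shows "correct_answer (dust n k) e = correct_answer (dust_with n k U) e"
proof -
  have "\<not> e \<subseteq> {v}" for v
  proof
    assume "e \<subseteq> {v}"
    then have "card e \<le> 1" using card_mono[of "{v}" e] by simp
    then show False using assms(1) by (simp add: all_pairs_def)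
  qed
  then show ?thesis using assms(2) by (auto simp: correct_answer_def dust_def dust_with_def)
qed

lemma graph_set_props:
  assumes "0 < m" "l * m < k" "h \<in> {..<l} \<rightarrow>\<^sub>E {..<m}"
  shows "graph_set l m h \<subseteq> {1..<k}" "card (graph_set l m h) = l"
    "x < l \<Longrightarrow> y < m \<Longrightarrow> x * m + y + 1 \<in> graph_set l m h \<Longrightarrow> h x = y"
proof -
  have h: "h x < m" if "x < l" for x using PiE_mem[OF assms(3), of x] that by simp
  have dm: "(x * m + y) div m = x" "(x * m + y) mod m = y" if "y < m" for x y using that by simp_all
  show "graph_set l m h \<subseteq> {1..<k}"
  proof
    fix v assume "v \<in> graph_set l m h"
    then obtain x where x: "x < l" "v = x * m + h x + 1" by (auto simp: graph_set_def)
    have "(x + 1) * m \<le> l * m" using x by (intro mult_right_mono) auto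
    then have "x * m + h x + 1 \<le> l * m" using h[OF x(1)] by (simp add: algebra_simps)
    then show "v \<in> {1..<k}" using assms(2) x by simp
  qed
  have "inj_on (\<lambda>x. x * m + h x + 1) {..<l}"
  proof (rule inj_onI)
    fix x x' assume x: "x \<in> {..<l}" "x' \<in> {..<l}" and "x * m + h x + 1 = x' * m + h x' + 1"
    then have "(x * m + h x) div m = (x' * m + h x') div m" by (simp only: add_right_cancel)
    moreover have "(x * m + h x) div m = x" using x by (intro dm(1) h) simp
    moreover have "(x' * m + h x') div m = x'" using x by (intro dm(1) h) simp
    ultimately show "x = x'" by (simp only:)
  qed
  then show "card (graph_set l m h) = l" by (simp add: graph_set_def card_image)
  assume xy: "x < l" "y < m" "x * m + y + 1 \<in> graph_set l m h"
  then obtain x' where x': "x' < l" "x * m + y = x' * m + h x'" by (auto simp: graph_set_def)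
  have "x = x'" using dm(1)[OF xy(2), of x] dm(1)[OF h[OF x'(1)], of x'] unfolding x'(2) by (simp only:)
  then show "h x = y" using x'(2) by simp
qed

text \<open>Two vertices of a graph lie in different rows, so they prescribe two of the
  \<open>l\<close> values.\<close>

lemma card_graphs_through_pair:
  assumes m: "0 < m" "l * m < k" and l: "2 \<le> l" and e: "card e = 2"
  shows "card {h \<in> {..<l} \<rightarrow>\<^sub>E {..<m}. e \<subseteq> graph_set l m h} \<le> m ^ (l - 2)"
proof (cases "{h \<in> {..<l} \<rightarrow>\<^sub>E {..<m}. e \<subseteq> graph_set l m h} = {}")
  case False
  let ?Hs = "{..<l} \<rightarrow>\<^sub>E {..<m}"
  obtain h0 where h0: "h0 \<in> ?Hs" "e \<subseteq> graph_set l m h0" using False by auto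
  obtain u v where uv: "u \<noteq> v" "e = {u, v}" using e by (auto simp: card_2_iff)
  obtain x y where x: "x < l" "u = x * m + h0 x + 1" "y < l" "v = y * m + h0 y + 1"
    using h0 uv by (auto simp: graph_set_def)
  have xy: "x \<noteq> y" using x uv by auto
  let ?F = "\<lambda>i. if i = x then {h0 x} else if i = y then {h0 y} else {..<m}"
  have "h0 x < m" "h0 y < m" using h0 x by auto
  have "{h \<in> ?Hs. e \<subseteq> graph_set l m h} \<subseteq> PiE {..<l} ?F"
  proof
    fix h assume "h \<in> {h \<in> ?Hs. e \<subseteq> graph_set l m h}"
    then have h: "h \<in> ?Hs" "e \<subseteq> graph_set l m h" by auto
    have "h x = h0 x" "h y = h0 y"
      using graph_set_props(3)[OF m h(1) x(1) \<open>h0 x < m\<close>] graph_set_props(3)[OF m h(1) x(3) \<open>h0 y < m\<close>] h(2) uv x by auto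
    then show "h \<in> PiE {..<l} ?F" using h(1) by (auto simp: PiE_iff)
  qed
  moreover have "finite (PiE {..<l} ?F)" by (intro finite_PiE) auto
  ultimately have "card {h \<in> ?Hs. e \<subseteq> graph_set l m h} \<le> card (PiE {..<l} ?F)" by (intro card_mono)
  also have "\<dots> = (\<Prod>i<l. card (?F i))" by (simp add: card_PiE)
  also have "\<dots> = (\<Prod>i<l. if i \<in> {x, y} then 1 else m)" by (intro prod.cong) auto
  also have "\<dots> = (\<Prod>i\<in>{..<l} - {x, y}. m)"
    by (intro prod.mono_neutral_cong_right) auto
  also have "\<dots> = m ^ (l - 2)"
  proof -
    have "card ({..<l} - {x, y}) = l - card {x, y}" using x by (subst card_Diff_subset) auto
    then show ?thesis using xy by (simp add: numeral_2_eq_2)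
  qed
  finally show ?thesis .
next
  case True
  then show ?thesis by (simp only: card.empty)
qed

context recovery
begin

text \<open>Fix the errors. If no pair inside \<open>U\<close> is asked on the table of
  \<open>dust\<close>, the run with \<open>U\<close> merged is the same, so the output on
  \<open>dust\<close> already has \<open>U\<close> as a block. This happens for at most
  \<open>m\<close> graphs; each of at most \<open>b * r\<close> asked pairs lies in at most
  \<open>m ^ (l - 2)\<close> of the \<open>m ^ l\<close> graphs.\<close>

lemma rounds_lower_dust:
  assumes k: "1 \<le> k" "k \<le> n" and m: "4 \<le> m" "l * m < k" and r: "fast k r"
  shows "m ^ 2 \<le> 4 * (b * r)"
proof -
  let ?Hs = "{..<l} \<rightarrow>\<^sub>E {..<m}"
  let ?U = "graph_set l m"
  have m0: "0 < m" using m by simp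
  have finH: "finite ?Hs" by (intro finite_PiE) auto
  have cH: "card ?Hs = m ^ l" by (simp add: card_PiE)
  note U = graph_set_props[OF m0 m(2)]
  \<comment> \<open>Under common errors, correctness refers to the merged clustering and speed to
    \<open>dust\<close>.\<close>
  define Ev where "Ev h x \<longleftrightarrow> (case x of (s, z) \<Rightarrow>
     (max_likelihood n (noisy_table n (dust_with n k (?U h)) z) (run s (noisy_table n (dust_with n k (?U h)) z)) \<and>
      ?U h \<in> run s (noisy_table n (dust_with n k (?U h)) z)) \<and>
     rounds s (noisy_table n (dust n k) z) \<le> r)" for h and x :: "strategy \<times> (nat set \<Rightarrow> bool)"
  have "real m ^ l * (1 / 2) = (\<Sum>h\<in>?Hs. 1 / 2)" using cH by simp
  also have "\<dots> \<le> (\<Sum>h\<in>?Hs. measure_pmf.prob (pair_pmf A (noise n p)) {x. Ev h x})"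
  proof (rule sum_mono)
    fix h assume h: "h \<in> ?Hs"
    let ?G = "dust_with n k (?U h)"
    have Une: "?U h \<noteq> {}" using U(2)[OF h] l by auto
    have pG: "partition_on {1..n} ?G" using dust_with_partition[OF k U(1)[OF h] Une] .
    have "{(s, w). max_likelihood n w (run s w) \<and> (\<forall>S\<in>?G. l \<le> card S \<longrightarrow> S \<in> run s w)}
       \<subseteq> {(s, w). max_likelihood n w (run s w) \<and> ?U h \<in> run s w}"
      using U(2)[OF h] by (auto simp: dust_with_def)
    then have "1 - 2 * d \<le> measure_pmf.prob (outcome n p ?G A) {(s, w). max_likelihood n w (run s w) \<and> ?U h \<in> run s w}"
      by (intro order_trans[OF large_recovered[OF pG] measure_pmf.finite_measure_mono]) auto
    then have 1: "1 - 2 * d \<le> measure_pmf.prob (pair_pmf A (noise n p)) {x. case x of (s, z) \<Rightarrow>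
        max_likelihood n (noisy_table n ?G z) (run s (noisy_table n ?G z)) \<and> ?U h \<in> run s (noisy_table n ?G z)}"
      unfolding prob_outcome_noise[of n p ?G A "\<lambda>s w. max_likelihood n w (run s w) \<and> ?U h \<in> run s w"] .
    have "1 - d \<le> measure_pmf.prob (outcome n p (dust n k) A) {(s, w). rounds s w \<le> r}"
      using r dust_partition[OF k] by (simp add: fast_def)
    then have "1 - d \<le> measure_pmf.prob (pair_pmf A (noise n p)) {x. case x of (s, z) \<Rightarrow> rounds s (noisy_table n (dust n k) z) \<le> r}"
      unfolding prob_outcome_noise[of n p "dust n k" A "\<lambda>s w. rounds s w \<le> r"] .
    then have 2: "measure_pmf.prob (pair_pmf A (noise n p)) {x. \<not> (case x of (s, z) \<Rightarrow> rounds s (noisy_table n (dust n k) z) \<le> r)} \<le> d"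
      by (rule prob_not)
    have "{x. Ev h x} = {x. (case x of (s, z) \<Rightarrow>
        max_likelihood n (noisy_table n ?G z) (run s (noisy_table n ?G z)) \<and> ?U h \<in> run s (noisy_table n ?G z)) \<and>
        (case x of (s, z) \<Rightarrow> rounds s (noisy_table n (dust n k) z) \<le> r)}"
      unfolding Ev_def by auto
    then show "1 / 2 \<le> measure_pmf.prob (pair_pmf A (noise n p)) {x. Ev h x}"
      using prob_conj_ge[OF 1 2] d by simp
  qed
  also have "\<dots> \<le> real (m + b * r * m ^ (l - 2))"
  proof (rule sum_prob_le[OF finH])
    fix x assume "x \<in> set_pmf (pair_pmf A (noise n p))"
    then obtain s z where x: "x = (s, z)" "s \<in> set_pmf A" by auto
    let ?w0 = "noisy_table n (dust n k) z"
    let ?P0 = "run s ?w0" and ?Q = "asked s ?w0"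
    have Q: "?Q \<subseteq> all_pairs n" "card ?Q \<le> b * rounds s ?w0"
      using card_asked[OF adm[OF x(2)], of ?w0] noisy_table_pm by auto
    have finQ: "finite ?Q" using Q(1) finite_subset finite_all_pairs by blast
    have unasked: "partition_on {1..n} ?P0 \<and> ?U h \<in> ?P0 \<and> rounds s ?w0 \<le> r"
      if h: "h \<in> ?Hs" "Ev h x" "\<And>e. e \<in> ?Q \<Longrightarrow> \<not> e \<subseteq> ?U h" for h
    proof -
      let ?v = "noisy_table n (dust_with n k (?U h)) z"
      have "?w0 e = ?v e" if "e \<in> ?Q" for e
        using dust_same_answer[OF _ h(3)[OF that], of n k] that Q(1) by (auto simp: noisy_table_def)
      then have "run s ?v = ?P0" by (rule run_cong[of s ?w0 ?v])
      then show ?thesis using h(2) by (simp add: Ev_def x(1) max_likelihood_def is_arg_max_def)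
    qed
    define H1 where "H1 = {h \<in> ?Hs. partition_on {1..n} ?P0 \<and> ?U h \<in> ?P0}"
    have "card H1 \<le> m"
    proof (cases "partition_on {1..n} ?P0")
      case False
      then have "H1 = {}" unfolding H1_def by blast
      then show ?thesis by simp
    next
      case True
      \<comment> \<open>Graphs with the same value at \<open>0\<close> share a vertex, so as blocks
        of one partition they coincide.\<close>
      have "inj_on (\<lambda>h. h 0) H1"
      proof (rule inj_onI)
        fix h h' assume hh: "h \<in> H1" "h' \<in> H1" "h 0 = h' 0"
        then have H: "h \<in> ?Hs" "h' \<in> ?Hs" "?U h \<in> ?P0" "?U h' \<in> ?P0" by (auto simp: H1_def)
        have "0 * m + h 0 + 1 \<in> ?U h" unfolding graph_set_def using l by (intro imageI) auto
        moreover have "0 * m + h' 0 + 1 \<in> ?U h'" unfolding graph_set_def using l by (intro imageI) auto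
        ultimately have "?U h \<inter> ?U h' \<noteq> {}" using hh(3) by auto
        then have eq: "?U h = ?U h'" using disjointD[OF partition_onD2[OF True] H(3,4)] by blast
        show "h = h'"
        proof (rule PiE_ext[OF H(1,2)])
          fix i assume i: "i \<in> {..<l}"
          have "h' i < m" using H(2) i by auto
          moreover have "i * m + h' i + 1 \<in> ?U h" unfolding eq unfolding graph_set_def using i by blast
          ultimately show "h i = h' i" using U(3)[OF H(1)] i by auto
        qed
      qed
      moreover have "(\<lambda>h. h 0) ` H1 \<subseteq> {..<m}" using l by (auto simp: H1_def PiE_iff)
      ultimately show ?thesis using card_inj_on_le[of "\<lambda>h. h 0" H1 "{..<m}"] by simp
    qed
    show "real (card {h \<in> ?Hs. Ev h x}) \<le> real (m + b * r * m ^ (l - 2))"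
    proof (cases "rounds s ?w0 \<le> r")
      case False
      then have "{h \<in> ?Hs. Ev h x} = {}" by (auto simp: Ev_def x(1))
      then show ?thesis by (simp only: card.empty)
    next
      case True
      have "{h \<in> ?Hs. Ev h x} \<subseteq> H1 \<union> (\<Union>e\<in>?Q. {h \<in> ?Hs. e \<subseteq> ?U h})"
        using unasked by (auto simp: H1_def)
      moreover have "finite (H1 \<union> (\<Union>e\<in>?Q. {h \<in> ?Hs. e \<subseteq> ?U h}))" using finH finQ by (auto simp: H1_def)
      ultimately have "card {h \<in> ?Hs. Ev h x} \<le> card (H1 \<union> (\<Union>e\<in>?Q. {h \<in> ?Hs. e \<subseteq> ?U h}))" by (rule card_mono[rotated])
      also have "\<dots> \<le> card H1 + card (\<Union>e\<in>?Q. {h \<in> ?Hs. e \<subseteq> ?U h})" by (rule card_Un_le)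
      also have "card (\<Union>e\<in>?Q. {h \<in> ?Hs. e \<subseteq> ?U h}) \<le> (\<Sum>e\<in>?Q. card {h \<in> ?Hs. e \<subseteq> ?U h})"
        by (rule card_UN_le[OF finQ])
      also have "\<dots> \<le> (\<Sum>e\<in>?Q. m ^ (l - 2))"
        using Q(1) by (intro sum_mono card_graphs_through_pair[OF m0 m(2) l(2)]) (auto simp: all_pairs_def)
      also have "\<dots> = card ?Q * m ^ (l - 2)" by simp
      also have "\<dots> \<le> b * r * m ^ (l - 2)"
        using Q(2) True by (intro mult_right_mono order_trans[OF Q(2)] mult_left_mono) auto
      finally show ?thesis using \<open>card H1 \<le> m\<close> by linarith
    qed
  qed
  finally have "real (m ^ l) \<le> real (2 * (m + b * r * m ^ (l - 2)))" by simp
  then have 1: "m ^ l \<le> 2 * (m + b * r * m ^ (l - 2))" by linarith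
  have ml: "m ^ l = m ^ 2 * m ^ (l - 2)" using power_add[of m 2 "l - 2"] l(2) le_add_diff_inverse[of 2 l] by (simp only:)
  have halve: "x \<le> 4 * y" if "4 * m \<le> x" "x \<le> 2 * (m + y)" for x y :: nat using that by auto
  have "4 * m * 1 \<le> m * m * m ^ (l - 2)" using m by (intro mult_mono) auto
  then have "4 * m \<le> m ^ l" unfolding ml by (simp add: power2_eq_square)
  then have "m ^ 2 * m ^ (l - 2) \<le> 4 * (b * r) * m ^ (l - 2)" 
    using halve[OF _ 1] unfolding ml by (simp only: mult.assoc)
  then show ?thesis using m0 by (simp add: mult_le_cancel2)
qed

text \<open>The core argument needs half of the vertices to be free. Otherwise
  \<open>k > n / (2 * l)\<close>, and the grid has rows of length of order
  \<open>n / l\<^sup>2\<close>, which makes the bound from \<open>dust\<close> strong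
  enough.\<close>

lemma rounds_lower:
  assumes k: "1 \<le> k" "k \<le> n" and nb: "n \<le> b" and nl: "16 * l ^ 2 \<le> n" and r: "fast k r"
  shows "real n * real k \<le> 64 * real l ^ 4 * (real b * real r)"
proof -
  have l4: "16 \<le> real l ^ 4" using power_mono[of 2 "real l" 4] l by simp
  have br0: "0 \<le> real b * real r" by simp
  show ?thesis
  proof (cases "2 * k * l \<le> n")
    case True
    have "real n * real k \<le> 18 * (real b * real r)"
    proof (cases "9 \<le> k")
      case True
      have "n * k \<le> 18 * (b * r)" using rounds_lower_balanced[OF True \<open>2 * k * l \<le> n\<close> r] .
      then have "real (n * k) \<le> real (18 * (b * r))" by (simp only: of_nat_le_iff)
      then show ?thesis by simp
    next
      case False
      have "1 \<le> r" using rounds_positive[OF k(1) \<open>2 * k * l \<le> n\<close> r] .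
      then have "n * 1 \<le> b * r" using nb by (intro mult_mono) auto
      then have "n * k \<le> (b * r) * 9" using False by (intro mult_mono) auto
      then have "real (n * k) \<le> real ((b * r) * 9)" by (simp only: of_nat_le_iff)
      then have "real n * real k \<le> (real b * real r) * 9" by simp
      then show ?thesis using br0 by linarith
    qed
    also have "\<dots> \<le> 64 * real l ^ 4 * (real b * real r)" using l4 by (intro mult_right_mono) auto
    finally show ?thesis .
  next
    case False
    \<comment> \<open>The greatest row length for which \<open>l\<close> rows fit into the
      \<open>k - 1\<close> singletons.\<close>
    define m where "m = (k - 1) div l"
    have l0: "0 < l" using l by simp
    have lm: "l * m < k" using k using times_div_less_eq_dividend[of l "k - 1"] unfolding m_def by linarith
    have "k - 1 < l * (m + 1)" using l0 dividend_less_times_div[of l "k - 1"] by (simp add: m_def algebra_simps)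
    then have "k \<le> l * (m + 1)" using k by linarith
    then have "real k \<le> real (l * (m + 1))" by (simp only: of_nat_le_iff)
    then have kl: "2 * real k \<le> 2 * (real l * (real m + 1))" by (simp add: algebra_simps)
    have "n \<le> 2 * k * l" using False by simp
    then have "real n \<le> real (2 * k * l)" by (simp only: of_nat_le_iff)
    then have "real n \<le> 2 * real k * real l" by simp
    also have "\<dots> \<le> 2 * (real l * (real m + 1)) * real l" by (rule mult_right_mono[OF kl]) simp
    finally have "real n \<le> 2 * (real l * (real m + 1)) * real l" .
    then have nm: "real n \<le> 2 * real l ^ 2 * (real m + 1)" by (simp add: power2_eq_square mult_ac)
    moreover have "16 * real l ^ 2 \<le> real n" using iffD2[OF of_nat_le_iff[where 'a = real] nl] by simp
    ultimately have "2 * real l ^ 2 * 8 \<le> 2 * real l ^ 2 * (real m + 1)" by linarith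
    then have m7: "8 \<le> real m + 1" using l0 by simp
    then have "4 \<le> m" by linarith
    have "m ^ 2 \<le> 4 * (b * r)" using rounds_lower_dust[OF k \<open>4 \<le> m\<close> lm r] .
    have mbr: "real m ^ 2 \<le> 4 * (real b * real r)" using iffD2[OF of_nat_le_iff[where 'a = real] \<open>m ^ 2 \<le> 4 * (b * r)\<close>] by simp
    have "real n \<le> 2 * real l ^ 2 * (2 * real m)" using m7 by (intro order_trans[OF nm] mult_left_mono) auto
    then have "real n ^ 2 \<le> (4 * real l ^ 2 * real m) ^ 2" by (intro power_mono) auto
    also have "\<dots> = 16 * real l ^ 4 * real m ^ 2" by (simp add: power_mult_distrib)
    also have "\<dots> \<le> 16 * real l ^ 4 * (4 * (real b * real r))" using mbr by (intro mult_left_mono) auto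
    finally have "real n * real n \<le> 64 * real l ^ 4 * (real b * real r)" by (simp add: power2_eq_square)
    moreover have "real n * real k \<le> real n * real n" using k by (intro mult_left_mono) auto
    ultimately show ?thesis by linarith
  qed
qed

end

text \<open>The value of \<open>LEAST\<close> is meaningful: every strategy stops, so for each
  clustering the probability of at most \<open>r\<close> rounds tends to \<open>1\<close> and
  exceeds \<open>1 - d\<close> eventually; there are finitely many clusterings.\<close>

lemma round_complexity_attained:
  assumes d: "0 < d" and G: "partition_on {1..n} G"
  shows "measure_pmf.prob (outcome n p G A) {(s, w). rounds s w \<le> round_complexity n p d A (card G)} \<ge> 1 - d"
proof -
  let ?P = "\<lambda>G r. measure_pmf.prob (outcome n p G A) {(s, w). rounds s w \<le> r} \<ge> 1 - d"
  have "\<exists>r. ?P G r" for G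
  proof -
    let ?B = "\<lambda>r. {(s, w). rounds s w \<le> r}"
    have "incseq ?B" by (rule incseq_SucI) auto
    then have "(\<lambda>r. measure_pmf.prob (outcome n p G A) (?B r)) \<longlonglongrightarrow> measure_pmf.prob (outcome n p G A) (\<Union>r. ?B r)"
      by (intro measure_pmf.finite_Lim_measure_incseq) auto
    moreover have "(\<Union>r. ?B r) = UNIV" by auto
    ultimately have "(\<lambda>r. measure_pmf.prob (outcome n p G A) (?B r)) \<longlonglongrightarrow> 1" by simp
    from order_tendstoD(1)[OF this, of "1 - d"] d have "\<forall>\<^sub>F r in sequentially. 1 - d < measure_pmf.prob (outcome n p G A) (?B r)"
      by simp
    from eventually_happens'[OF _ this] show ?thesis by (auto intro: less_imp_le)
  qed
  then obtain R where R: "?P G (R G)" for G by metis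
  let ?Gs = "{G. partition_on {1..n} G}"
  have "finite ?Gs" by (intro finitely_many_partition_on) simp
  then have "R G \<le> Max (R ` ?Gs)" if "partition_on {1..n} G" for G using that by simp
  then have "?P G (Max (R ` ?Gs))" if "partition_on {1..n} G" for G
    using that by (intro order_trans[OF R[of G]] measure_pmf.finite_measure_mono) force+
  then have "\<forall>G. partition_on {1..n} G \<and> card G = k \<longrightarrow> ?P G (Max (R ` ?Gs))" for k by blast
  then have "\<forall>G'. partition_on {1..n} G' \<and> card G' = card G \<longrightarrow> ?P G' (round_complexity n p d A (card G))"
    unfolding round_complexity_def by (rule LeastI)
  then show ?thesis using G by blast
qed

lemma optimal_rounds_attained:
  assumes "recovers_estimate n b p d A0"
  obtains A where "recovers_estimate n b p d A" "round_complexity n p d A k = optimal_rounds n b p d k"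
proof -
  have "\<exists>r A. recovers_estimate n b p d A \<and> round_complexity n p d A k = r" using assms by blast
  then have "\<exists>A. recovers_estimate n b p d A \<and> round_complexity n p d A k = optimal_rounds n b p d k"
    unfolding optimal_rounds_def by (rule LeastI_ex)
  then show ?thesis using that by blast
qed

section \<open>Comparison of the algorithm with the optimum\<close>

definition explorer :: "nat \<Rightarrow> real \<Rightarrow> real \<Rightarrow> strategy pmf" where
  "explorer n \<mu> K = return_pmf (explore n (2 * large_size \<mu> K) n {} (\<lambda>_. 0))"

lemma
  assumes typical: "\<And>G. partition_on {1..n} G \<Longrightarrow>
    measure_pmf.prob (answer_table n p G) {w. \<not> good_table n G \<mu> \<epsilon> K w} \<le> d"
  shows explorer_recovers: "n \<le> b \<Longrightarrow> recovers_estimate n b p d (explorer n \<mu> K)"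
    and explorer_rounds: "large_size \<mu> K \<le> real l \<Longrightarrow> 1 \<le> l \<Longrightarrow> round_complexity n p d (explorer n \<mu> K) k \<le> 3 * l * k"
proof -
  let ?s = "explore n (2 * large_size \<mu> K) n {} (\<lambda>_. 0)"
  have prob: "1 - d \<le> measure_pmf.prob (outcome n p G (explorer n \<mu> K)) {(s, w). Q s w}"
    if G: "partition_on {1..n} G" and Q: "\<And>w. good_table n G \<mu> \<epsilon> K w \<Longrightarrow> Q ?s w" for G Q
  proof -
    have "1 - d \<le> measure_pmf.prob (answer_table n p G) {w. good_table n G \<mu> \<epsilon> K w}"
      using typical[OF G] measure_pmf.prob_compl[of "{w. good_table n G \<mu> \<epsilon> K w}" "answer_table n p G"]
      by (simp add: Compl_eq_Diff_UNIV[symmetric] Collect_neg_eq)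
    also have "\<dots> \<le> measure_pmf.prob (answer_table n p G) {w. Q ?s w}"
      using Q by (intro measure_pmf.finite_measure_mono) auto
    also have "\<dots> = measure_pmf.prob (outcome n p G (explorer n \<mu> K)) {(s, w). Q s w}"
      by (simp add: outcome_def explorer_def pair_return_pmf1 vimage_def)
    finally show ?thesis .
  qed
  show "recovers_estimate n b p d (explorer n \<mu> K)" if "n \<le> b"
    unfolding recovers_estimate_def
  proof (intro conjI allI impI ballI)
    fix s assume "s \<in> set_pmf (explorer n \<mu> K)"
    then show "admissible n b {} s"
      using admissible_explore[OF that, of "{}" "2 * large_size \<mu> K" n "\<lambda>_. 0"] by (simp add: explorer_def touching_def)
  next
    fix G assume "partition_on {1..n} G"
    then show "1 - d \<le> measure_pmf.prob (outcome n p G (explorer n \<mu> K)) {(s, w). max_likelihood n w (run s w)}"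
      by (rule prob) (rule good_table.explore_all(1))
  qed
  show "round_complexity n p d (explorer n \<mu> K) k \<le> 3 * l * k" if l: "large_size \<mu> K \<le> real l" "1 \<le> l"
    unfolding round_complexity_def
  proof (rule Least_le, intro allI impI)
    fix G assume G: "partition_on {1..n} G \<and> card G = k"
    show "1 - d \<le> measure_pmf.prob (outcome n p G (explorer n \<mu> K)) {(s, w). rounds s w \<le> 3 * l * k}"
    proof (rule prob)
      fix w assume "good_table n G \<mu> \<epsilon> K w"
      then have "real (rounds ?s w) \<le> real k * (2 * large_size \<mu> K + 1)"
        using good_table.explore_all(2)[of n G \<mu> \<epsilon> K w] G by simp
      also have "\<dots> \<le> real k * (3 * real l)" using l by (intro mult_left_mono) auto
      also have "\<dots> = real (3 * l * k)" by simp
      finally show "rounds ?s w \<le> 3 * l * k" by (simp only: of_nat_le_iff)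
    qed (use G in simp)
  qed
qed

text \<open>Upper and lower bound are both proportional to \<open>k\<close>, so \<open>k\<close>
  drops out of the ratio and only \<open>l ^ 5\<close> and \<open>b / n\<close> remain.\<close>

lemma explorer_near_optimal:
  assumes typical: "\<And>G. partition_on {1..n} G \<Longrightarrow>
      measure_pmf.prob (answer_table n p G) {w. \<not> good_table n G \<mu> \<epsilon> K w} \<le> d"
    and pos: "0 < d" and small: "d \<le> 1 / 8" and size: "large_size \<mu> K \<le> real l" "2 \<le> l" "16 * l ^ 2 \<le> n"
    and b: "n \<le> b" and k: "1 \<le> k" "k \<le> n"
  shows "real n * real (round_complexity n p d (explorer n \<mu> K) k)
    \<le> 192 * real l ^ 5 * (real b * real (optimal_rounds n b p d k))"
proof -
  obtain A where A: "recovers_estimate n b p d A" "round_complexity n p d A k = optimal_rounds n b p d k"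
    using optimal_rounds_attained[OF explorer_recovers[OF typical b]] by blast
  interpret recovery n b p d \<mu> \<epsilon> K A l
    by unfold_locales (use A(1) typical pos small size in auto)
  have "fast k (optimal_rounds n b p d k)"
    unfolding fast_def using round_complexity_attained[OF pos, of n _ p A] by (auto simp flip: A(2))
  then have lower: "real n * real k \<le> 64 * real l ^ 4 * (real b * real (optimal_rounds n b p d k))"
    using k b size by (intro rounds_lower) auto
  have "round_complexity n p d (explorer n \<mu> K) k \<le> 3 * l * k"
    using explorer_rounds[OF typical size(1)] size(2) by simp
  then have "real (round_complexity n p d (explorer n \<mu> K) k) \<le> real (3 * l * k)" by (simp only: of_nat_le_iff)
  then have "real n * real (round_complexity n p d (explorer n \<mu> K) k) \<le> real n * real (3 * l * k)"
    by (rule mult_left_mono) simp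
  also have "\<dots> = 3 * real l * (real n * real k)" by simp
  also have "\<dots> \<le> 3 * real l * (64 * real l ^ 4 * (real b * real (optimal_rounds n b p d k)))"
    using lower by (intro mult_left_mono) auto
  also have "\<dots> = 192 * real l ^ 5 * (real b * real (optimal_rounds n b p d k))" by (simp add: power_eq_if)
  finally show ?thesis .
qed

theorem theorem8:
  fixes lam c :: real and b :: "nat \<Rightarrow> nat"
  assumes lam: "0 < lam" "lam < 1 / 2"
    and c: "c > 0"
    and b: "(\<lambda>n. real (b n)) \<in> \<Theta>(\<lambda>n. real n * ln (real n))"
  shows "\<exists>(A :: nat \<Rightarrow> strategy pmf) (g :: nat \<Rightarrow> real).
    g \<in> soft_O (\<lambda>n. sqrt (ln (real n))) \<and>
    (\<forall>\<^sub>F n in sequentially.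
       recovers_estimate n (b n) (1 / 2 - lam) (real n powr (- c)) (A n) \<and>
       (\<forall>k \<in> {1..n}.
          real (round_complexity n (1 / 2 - lam) (real n powr (- c)) (A n) k)
            \<le> g n * real (optimal_rounds n (b n) (1 / 2 - lam) (real n powr (- c)) k)))"
proof -
  obtain \<epsilon> \<kappa> where \<kappa>: "0 < \<kappa>" and typical: "\<And>n G. n \<ge> 40 \<Longrightarrow> partition_on {1..n} G \<Longrightarrow>
    measure_pmf.prob (answer_table n (1 / 2 - lam) G) {w. \<not> good_table n G (2 * lam) \<epsilon> (\<kappa> * ln (real n)) w} \<le> real n powr (- c)"
    using good_table_whp[OF lam c] by blast
  \<comment> \<open>The summand \<open>3\<close> covers the rounding and the \<open>+ 2\<close> in
    \<open>l\<close>, as \<open>ln n \<ge> 1\<close>.\<close>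
  define a where "a = 16 * 10 ^ 7 * \<kappa> / (2 * lam) ^ 7 + 3"
  have a: "3 \<le> a" using lam \<kappa> by (simp add: a_def)
  define l where "l n = nat \<lceil>large_size (2 * lam) (\<kappa> * ln (real n))\<rceil> + 2" for n
  obtain B where B: "0 < B" "\<forall>\<^sub>F n in sequentially. norm (real (b n)) \<le> B * norm (real n * ln (real n))"
    using landau_o.bigE[OF bigthetaD1[OF b]] by blast
  obtain B' where B': "0 < B'" "\<forall>\<^sub>F n in sequentially. norm (real (b n)) \<ge> B' * norm (real n * ln (real n))"
    using landau_omega.bigE[OF bigthetaD2[OF b]] by blast
  define D where "D = 192 * a ^ 5 * B"
  have D: "0 < D" using a B by (simp add: D_def)
  have l_ge: "large_size (2 * lam) (\<kappa> * ln (real n)) \<le> real (l n)" "2 \<le> l n" for n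
    unfolding l_def by linarith+
  have l_le: "real (l n) \<le> a * ln (real n)" if "1 \<le> ln (real n)" for n
  proof -
    have nn: "0 \<le> large_size (2 * lam) (\<kappa> * ln (real n))" using lam \<kappa> that by (simp add: large_size_def)
    have "real (l n) \<le> large_size (2 * lam) (\<kappa> * ln (real n)) + 3" using nn unfolding l_def by linarith
    also have "\<dots> \<le> large_size (2 * lam) (\<kappa> * ln (real n)) + 3 * ln (real n)" using that by simp
    also have "\<dots> = a * ln (real n)" using lam by (simp add: a_def large_size_def field_simps)
    finally show ?thesis .
  qed
  have ln1: "\<forall>\<^sub>F n in sequentially. 1 \<le> ln (real n)" by real_asymp
  have ev: "\<forall>\<^sub>F n in sequentially. 16 * (a * ln (real n)) ^ 2 \<le> real n" using a by real_asymp
  have evd: "\<forall>\<^sub>F n in sequentially. real n powr (- c) \<le> 1 / 8" using c by real_asymp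
  have evb: "\<forall>\<^sub>F n in sequentially. 1 \<le> B' * ln (real n)" using B'(1) by real_asymp
  let ?A = "\<lambda>n. explorer n (2 * lam) (\<kappa> * ln (real n))"
  \<comment> \<open>Five logarithms come from \<open>l ^ 5\<close> and one from
    \<open>b n / n\<close>; the exponent \<open>6\<close> is also the witness for
    \<open>soft_O\<close>.\<close>
  let ?g = "\<lambda>n. D * ln (real n) ^ 6"
  have "?g \<in> O(\<lambda>n. sqrt (ln (real n)) * ln (real n) ^ 6)"
  proof (rule bigoI[of _ D])
    show "\<forall>\<^sub>F n in sequentially. norm (?g n) \<le> D * norm (sqrt (ln (real n)) * ln (real n) ^ 6)"
      using ln1
    proof eventually_elim
      case (elim n)
      then have "1 * ln (real n) ^ 6 \<le> sqrt (ln (real n)) * ln (real n) ^ 6"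
        by (intro mult_right_mono) auto
      then show ?case using D elim by simp
    qed
  qed
  then have "?g \<in> soft_O (\<lambda>n. sqrt (ln (real n)))" by (auto simp: soft_O_def)
  moreover have "\<forall>\<^sub>F n in sequentially.
       recovers_estimate n (b n) (1 / 2 - lam) (real n powr (- c)) (?A n) \<and>
       (\<forall>k \<in> {1..n}.
          real (round_complexity n (1 / 2 - lam) (real n powr (- c)) (?A n) k)
            \<le> ?g n * real (optimal_rounds n (b n) (1 / 2 - lam) (real n powr (- c)) k))"
    using ln1 ev evd evb B(2) B'(2) eventually_ge_at_top[of 40]
  proof eventually_elim
    case (elim n)
    note ty = typical[OF elim(7)]
    have n: "0 < real n" using elim(7) by simp
    have "real n * 1 \<le> real n * (B' * ln (real n))" using elim(4) by (intro mult_left_mono) auto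
    also have "\<dots> \<le> real (b n)" using elim(6) elim(1) n by (simp add: mult_ac)
    finally have nb: "n \<le> b n" by simp
    have bn: "real (b n) \<le> B * (real n * ln (real n))" using elim(5) elim(1) n by simp
    have "16 * real (l n) ^ 2 \<le> 16 * (a * ln (real n)) ^ 2"
      using l_le[OF elim(1)] by (intro mult_left_mono power_mono) auto
    then have "real (16 * l n ^ 2) \<le> real n" using elim(2) by simp
    then have l2: "16 * l n ^ 2 \<le> n" by (simp only: of_nat_le_iff)
    have "real (round_complexity n (1 / 2 - lam) (real n powr (- c)) (?A n) k)
      \<le> ?g n * real (optimal_rounds n (b n) (1 / 2 - lam) (real n powr (- c)) k)" if k: "k \<in> {1..n}" for k
    proof -
      let ?o = "real (optimal_rounds n (b n) (1 / 2 - lam) (real n powr (- c)) k)"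
      have "real n * real (round_complexity n (1 / 2 - lam) (real n powr (- c)) (?A n) k)
        \<le> 192 * real (l n) ^ 5 * (real (b n) * ?o)"
        by (rule explorer_near_optimal[OF ty _ elim(3) l_ge l2 nb]) (use k n in auto)
      also have "\<dots> \<le> 192 * (a * ln (real n)) ^ 5 * (B * (real n * ln (real n)) * ?o)"
        using l_le[OF elim(1)] bn a elim(1) by (intro mult_mono power_mono) auto
      also have "\<dots> = real n * (?g n * ?o)" by (simp add: D_def power_mult_distrib power_eq_if)
      finally show ?thesis using n by simp
    qed
    then show ?case using explorer_recovers[OF ty nb] by blast
  qed
  ultimately show ?thesis by (intro exI[of _ ?A] exI[of _ ?g] conjI)
qed

end
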